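(* Let the spinor-valued function $g$ be hermitian monogenic in the open region $\Omega\subset\mathbb{R}^{2n}$. Then for each bounded domain $D$ with smooth boundary $\partial D$ such that $\overline{D}\subset\Omega$, and for all $\underline{X}\in\overset{\circ}{D}$, it holds that $$g(\underline{X})=\frac{1}{(-2i)^n}\int_{\partial D}\left(E^\dagger(\underline{v}-\underline{z})\,d\sigma_{\underline{v}^\dagger}+E(\underline{v}-\underline{z})\,d\sigma_{\underline{v}}\right)g(\underline{Y}),$$ together with the integral identities $$\int_{\partial D}E(\underline{v}-\underline{z})\,d\sigma_{\underline{v}^\dagger}\,g(\underline{Y})=0,\qquad \int_{\partial D}E^\dagger(\underline{v}-\underline{z})\,d\sigma_{\underline{v}}\,g(\underline{Y})=0 .$$
   Context: Setting: coordinates on $\mathbb{R}^{2n}$ are $(x_1,y_1,\dots,x_n,y_n)$; $(e_1,\dots,e_{2n})$ is the standard orthonormal basis, generating the complex Clifford algebra $\mathbb{C}_{2n}$ with $e_\alpha e_\beta+e_\beta e_\alpha=-2\delta_{\alpha\beta}$. Complex coordinates: $z_k=x_k+iy_k$, $z_k^c=x_k-iy_k$; $\partial_{z_k}=\frac12(\partial_{x_k}-i\partial_{y_k})$, $\partial_{z_k^c}=\frac12(\partial_{x_k}+i\partial_{y_k})$. Witt basis: $\mathfrak{f}_k=-\frac12(e_{2k-1}-ie_{2k})$, $\mathfrak{f}_k^\dagger=\frac12(e_{2k-1}+ie_{2k})$, $k=1,\dots,n$. Spinor space: $\mathbb{S}=\mathbb{C}_{2n}I$ with $I=I_1\cdots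 I_n$, $I_j=\mathfrak{f}_j\mathfrak{f}_j^\dagger$; spinor-valued means $\mathbb{S}$-valued. Hermitian vector variables: for a point $\underline{X}$ with complex coordinates $z_k$, $\underline{z}=\sum_k z_k\mathfrak{f}_k$, $\underline{z}^\dagger=\sum_k z_k^c\mathfrak{f}_k^\dagger$ (so $\underline{X}=\underline{z}^\dagger-\underline{z}$), $|\underline{z}|^2=\sum_k|z_k|^2=|\underline{X}|^2$. For $\underline{Y}\in\partial D$ with complex coordinates $v_k$ one defines $\underline{v},\underline{v}^\dagger$ in the same way. In the integrals $\underline{X}$ corresponds to $\underline{z}$ and the integration variable $\underline{Y}$ to $\underline{v}$. Hermitian Dirac operators: $\partial_{\underline{z}}=\sum_k\partial_{z_k}\mathfrak{f}_k^\dagger$, $\partial_{\underline{z}}^\dagger=\sum_k\partial_{z_k^c}\mathfrak{f}_k$. A continuously differentiable function $F$ is hermitian monogenic in $\Omega$ if $\partial_{\underline{z}}F=0$ and $\partial_{\underline{z}}^\dagger F=0$ in $\Omega$. Kernels ($a_{2n}$ = area of the unit sphere $S^{2n-1}$): $E(\underline{z})=\frac{2}{a_{2n}}\frac{\underline{z}}{|\underline{z}|^{2n}}$, $E^\dagger(\underline{z})=\frac{2}{a_{2n}}\frac{\underline{z}^\dagger}{|\underline{z}|^{2n}}$. Differential forms: $\widehat{dz_j}$ (resp. $\widehat{dz_j^c}$) is the $(2n-1)$-form obtained from $dz_1\wedge dz_1^c\wedge\cdots\wedge dz_n\wedge dz_n^c$ by omitting $dz_j$ (resp. $dz_j^c$),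 order otherwise kept; $d\sigma_{\underline{z}}=\sum_{j=1}^n\mathfrak{f}_j^\dagger\widehat{dz_j}$, $d\sigma_{\underline{z}^\dagger}=-\sum_{j=1}^n\mathfrak{f}_j\widehat{dz_j^c}$, and likewise with $\underline{v}$ in place of $\underline{z}$. $\mathbb{R}^{2n}$ is oriented by $dx_1\wedge dy_1\wedge\cdots\wedge dx_n\wedge dy_n$ and $\partial D$ carries the induced boundary orientation. *)

theory Defs
  imports "HOL-Analysis.Analysis"
begin

text \<open>
  The space \<open>'n cvec\<close> with its real inner product is \<open>\<real>\<^sup>2\<^sup>n\<close>, \<open>n = CARD('n)\<close>: the component
  \<open>X $ k\<close> is \<open>z\<^sub>k = x\<^sub>k + i y\<^sub>k\<close>.  The \<open>2n\<close> real directions are labelled by \<open>'n \<times> bool\<close>, where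
  \<open>(k, False)\<close> stands for \<open>x\<^sub>k\<close> and \<open>(k, True)\<close> for \<open>y\<^sub>k\<close>; \<open>labels\<close> lists them as
  \<open>x\<^sub>1, y\<^sub>1, \<dots>, x\<^sub>n, y\<^sub>n\<close>.
\<close>

type_synonym 'n cvec = "(complex, 'n) vec"

definition labels :: "('n::{finite,linorder} \<times> bool) list"
  where "labels = concat (map (\<lambda>k. [(k, False), (k, True)]) (sorted_list_of_set UNIV))"

definition label_less :: "'n::linorder \<times> bool \<Rightarrow> 'n \<times> bool \<Rightarrow> bool"
  where "label_less p q \<longleftrightarrow> fst p < fst q \<or> (fst p = fst q \<and> \<not> snd p \<and> snd q)"


section \<open>The complex Clifford algebra and the spinor space\<close>

text \<open>
  An element is the family of its coefficients with respect to the basis \<open>e\<^sub>A\<close>, where \<open>A\<close> ranges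
  over the sets of labels and \<open>e\<^sub>A\<close> is the increasing product of the generators in \<open>A\<close>.  One has
  \<open>e\<^sub>A e\<^sub>B = cliff_sign A B \<cdot> e\<^bsub>sym_diff A B\<^esub>\<close>: a factor \<open>-1\<close> for each pair that has to be swapped and
  one for each square \<open>e\<^sub>a\<^sup>2 = -1\<close>.
\<close>

type_synonym 'n clifford = "complex ^ (('n \<times> bool) set)"

definition cliff_sign :: "('n::linorder \<times> bool) set \<Rightarrow> ('n \<times> bool) set \<Rightarrow> complex"
  where "cliff_sign A B = (\<Prod>a\<in>A. \<Prod>b\<in>B. if label_less a b then 1 else - 1)"

definition cliff_mult ::
    "'n::{finite,linorder} clifford \<Rightarrow> 'n clifford \<Rightarrow> 'n clifford"  (infixl "\<star>" 70)
  where "a \<star> b = (\<chi> C. \<Sum>A\<in>UNIV. cliff_sign A (sym_diff A C) * a $ A * b $ sym_diff A C)"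

definition cliff_basis :: "('n::{finite,linorder} \<times> bool) set \<Rightarrow> 'n clifford"
  where "cliff_basis A = axis A 1"

definition cliff_one :: "'n::{finite,linorder} clifford"
  where "cliff_one = cliff_basis {}"

definition cliff_gen :: "'n::{finite,linorder} \<times> bool \<Rightarrow> 'n clifford"
  where "cliff_gen p = cliff_basis {p}"

definition witt_f :: "'n::{finite,linorder} \<Rightarrow> 'n clifford"
  where "witt_f k = (- 1 / 2) *s (cliff_gen (k, False) - \<i> *s cliff_gen (k, True))"

definition witt_fd :: "'n::{finite,linorder} \<Rightarrow> 'n clifford"
  where "witt_fd k = (1 / 2) *s (cliff_gen (k, False) + \<i> *s cliff_gen (k, True))"

definition spinor_idem :: "'n::{finite,linorder} clifford"
  where "spinor_idem =
    foldr (\<lambda>k a. (witt_f k \<star> witt_fd k) \<star> a) (sorted_list_of_set UNIV) cliff_one"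

definition spinor_space :: "'n::{finite,linorder} clifford set"
  where "spinor_space = {a \<star> spinor_idem | a. True}"

text \<open>
  The product is the Clifford product: it is unital and associative, the generators satisfy the
  Clifford relations, and \<open>e\<^sub>A\<close> is the increasing product of the generators in \<open>A\<close>.
\<close>

lemma prod_sym_diff:
  fixes f :: "'a::finite \<Rightarrow> complex"
  assumes "\<And>x. f x * f x = 1"
  shows "prod f (sym_diff A B) = prod f A * prod f B"
proof -
  have 1: "prod f (sym_diff A B) = prod f (A - B) * prod f (B - A)"
    by (rule prod.union_disjoint) auto
  have A: "prod f A = prod f (A - B) * prod f (A \<inter> B)"
    by (subst prod.union_disjoint[symmetric]) (auto intro: prod.cong)
  have B: "prod f B = prod f (B - A) * prod f (A \<inter> B)"
    by (subst prod.union_disjoint[symmetric]) (auto intro: prod.cong)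
  have "prod f (A \<inter> B) * prod f (A \<inter> B) = 1"
    by (simp add: prod.distrib[symmetric] assms)
  then show ?thesis
    unfolding 1 A B by (simp add: mult.assoc mult.left_commute)
qed

lemma cliff_sign_sym_diff_left:
  "cliff_sign (sym_diff A B) C = cliff_sign A C * cliff_sign B C"
  for A B C :: "('n::{finite,linorder} \<times> bool) set"
  unfolding cliff_sign_def
  by (rule prod_sym_diff) (simp add: prod.distrib[symmetric] prod.neutral)

lemma cliff_sign_sym_diff_right:
  "cliff_sign A (sym_diff B C) = cliff_sign A B * cliff_sign A C"
  for A B C :: "('n::{finite,linorder} \<times> bool) set"
  unfolding cliff_sign_def prod.distrib[symmetric]
  by (intro prod.cong refl prod_sym_diff) simp

lemma cliff_mult_assoc: "(a \<star> b) \<star> c = a \<star> (b \<star> c)"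
  for a b c :: "'n::{finite,linorder} clifford"
proof (subst vec_eq_iff, rule allI)
  fix C :: "('n \<times> bool) set"
  have inv: "sym_diff A (sym_diff A B) = B" for A B :: "('n \<times> bool) set"
    by auto
  have "((a \<star> b) \<star> c) $ C =
      (\<Sum>A\<in>UNIV. \<Sum>P\<in>UNIV. cliff_sign P (sym_diff P C) * cliff_sign A (sym_diff A P) *
         a $ A * b $ sym_diff A P * c $ sym_diff P C)"
    by (subst sum.swap) (simp add: cliff_mult_def sum_distrib_left sum_distrib_right mult_ac)
  also have "\<dots> = (\<Sum>A\<in>UNIV. \<Sum>B\<in>UNIV. cliff_sign A (sym_diff A C) *
        cliff_sign B (sym_diff B (sym_diff A C)) *
        a $ A * b $ B * c $ sym_diff B (sym_diff A C))"
  proof (rule sum.cong[OF refl])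
    fix A :: "('n \<times> bool) set"
    show "(\<Sum>P\<in>UNIV. cliff_sign P (sym_diff P C) * cliff_sign A (sym_diff A P) *
         a $ A * b $ sym_diff A P * c $ sym_diff P C) =
       (\<Sum>B\<in>UNIV. cliff_sign A (sym_diff A C) * cliff_sign B (sym_diff B (sym_diff A C)) *
        a $ A * b $ B * c $ sym_diff B (sym_diff A C))"
    proof (rule sum.reindex_bij_witness[of _ "sym_diff A" "sym_diff A"], goal_cases)
      case (5 P)
      define B where "B = sym_diff A P"
      have P: "P = sym_diff A B" "sym_diff P C = sym_diff B (sym_diff A C)"
        unfolding B_def by auto
      have "cliff_sign P (sym_diff P C) * cliff_sign A B =
          cliff_sign A (sym_diff A C) * cliff_sign B (sym_diff B (sym_diff A C)) *
          (cliff_sign A B * cliff_sign A B)"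
        unfolding P(2) unfolding P(1)
        by (simp add: cliff_sign_sym_diff_left cliff_sign_sym_diff_right)
      moreover have "cliff_sign A B * cliff_sign A B = 1"
        unfolding cliff_sign_def prod.distrib[symmetric] by (intro prod.neutral ballI) simp
      ultimately show ?case
        unfolding B_def[symmetric] P(2)[symmetric] by simp
    qed (simp_all only: inv UNIV_I)
  qed
  also have "\<dots> = (a \<star> (b \<star> c)) $ C"
    by (simp add: cliff_mult_def sum_distrib_left mult_ac)
  finally show "((a \<star> b) \<star> c) $ C = (a \<star> (b \<star> c)) $ C" .
qed

lemma cliff_basis_mult:
  "cliff_basis A \<star> cliff_basis B = cliff_sign A B *s cliff_basis (sym_diff A B)"
  for A B :: "('n::{finite,linorder} \<times> bool) set"
proof -
  have eq: "sym_diff A C = B \<longleftrightarrow> C = sym_diff A B" for C by auto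
  have "(cliff_basis A \<star> cliff_basis B) $ C = (cliff_sign A B *s cliff_basis (sym_diff A B)) $ C" for C
  proof -
    have "(cliff_basis A \<star> cliff_basis B) $ C =
        (\<Sum>P\<in>UNIV. if P = A then cliff_sign A (sym_diff A C) * axis B 1 $ sym_diff A C else 0)"
      unfolding cliff_mult_def vec_lambda_beta
      by (intro sum.cong refl) (simp add: cliff_basis_def axis_def)
    also have "\<dots> = cliff_sign A (sym_diff A C) * axis B 1 $ sym_diff A C"
      by simp
    also have "\<dots> = (cliff_sign A B *s cliff_basis (sym_diff A B)) $ C"
    proof (cases "C = sym_diff A B")
      case True
      then have "sym_diff A C = B" using eq by blast
      then show ?thesis by (simp add: True cliff_basis_def)
    next
      case False
      then have "sym_diff A C \<noteq> B" using eq by blast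
      then show ?thesis using False by (simp add: cliff_basis_def axis_def)
    qed
    finally show ?thesis .
  qed
  then show ?thesis by (simp add: vec_eq_iff)
qed

lemma cliff_one_left: "cliff_one \<star> a = a"
  for a :: "'n::{finite,linorder} clifford"
proof -
  have "(cliff_one \<star> a) $ C = a $ C" for C
  proof -
    have "(cliff_one \<star> a) $ C = (\<Sum>A\<in>(UNIV :: ('n \<times> bool) set set). if A = {} then a $ C else 0)"
      unfolding cliff_mult_def vec_lambda_beta
      by (rule sum.cong[OF refl])
        (simp add: cliff_one_def cliff_basis_def axis_def cliff_sign_def)
    then show ?thesis by simp
  qed
  then show ?thesis by (simp add: vec_eq_iff)
qed

lemma cliff_one_right: "a \<star> cliff_one = a"
  for a :: "'n::{finite,linorder} clifford"
proof -
  have "(a \<star> cliff_one) $ C = a $ C" for C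
  proof -
    have "(a \<star> cliff_one) $ C = (\<Sum>A\<in>UNIV. if A = C then a $ C else 0)"
      unfolding cliff_mult_def vec_lambda_beta
    proof (intro sum.cong refl)
      fix A :: "('n \<times> bool) set"
      have "sym_diff A C = {} \<longleftrightarrow> A = C" by auto
      then show "cliff_sign A (sym_diff A C) * a $ A * cliff_one $ sym_diff A C =
          (if A = C then a $ C else 0)"
        by (auto simp: cliff_one_def cliff_basis_def axis_def cliff_sign_def)
    qed
    then show ?thesis by simp
  qed
  then show ?thesis by (simp add: vec_eq_iff)
qed

lemma cliff_gen_anticommute:
  "cliff_gen p \<star> cliff_gen q + cliff_gen q \<star> cliff_gen p =
     (if p = q then - 2 else 0) *s cliff_one"
  for p q :: "'n::{finite,linorder} \<times> bool"
proof (cases "p = q")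
  case True
  then show ?thesis
    by (auto simp: cliff_gen_def cliff_basis_mult cliff_sign_def label_less_def cliff_one_def
        vec_eq_iff)
next
  case False
  have "sym_diff {q} {p} = sym_diff {p} {q}" by auto
  moreover have "cliff_sign {q} {p} = - cliff_sign {p} {q}"
    using False
    by (cases p; cases q) (auto simp: cliff_sign_def label_less_def)
  ultimately show ?thesis
    using False by (simp add: cliff_gen_def cliff_basis_mult vec_eq_iff)
qed

lemma cliff_basis_insert:
  assumes "\<And>a. a \<in> A \<Longrightarrow> label_less p a"
  shows "cliff_basis (insert p A) = cliff_gen p \<star> cliff_basis A"
proof -
  have "p \<notin> A" using assms[of p] by (auto simp: label_less_def)
  then have "sym_diff {p} A = insert p A" by auto
  moreover have "cliff_sign {p} A = 1"
    using assms by (simp add: cliff_sign_def)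
  ultimately show ?thesis
    by (simp add: cliff_gen_def cliff_basis_mult)
qed


section \<open>Hermitian monogenic functions\<close>

text \<open>\<open>Ck_on m f S\<close>: the function \<open>f\<close> is \<open>m\<close> times continuously differentiable on the open set \<open>S\<close>.\<close>

primrec Ck_on :: "nat \<Rightarrow> ('a::euclidean_space \<Rightarrow> 'b::real_normed_vector) \<Rightarrow> 'a set \<Rightarrow> bool"
  where
    "Ck_on 0 f S \<longleftrightarrow> continuous_on S f"
  | "Ck_on (Suc m) f S \<longleftrightarrow>
       (\<forall>x\<in>S. f differentiable (at x)) \<and> (\<forall>v. Ck_on m (\<lambda>x. frechet_derivative f (at x) v) S)"

definition pderiv_x :: "'n::{finite,linorder} \<Rightarrow> ('n cvec \<Rightarrow> 'n clifford) \<Rightarrow> 'n cvec \<Rightarrow> 'n clifford"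
  where "pderiv_x k F X = frechet_derivative F (at X) (axis k 1)"

definition pderiv_y :: "'n::{finite,linorder} \<Rightarrow> ('n cvec \<Rightarrow> 'n clifford) \<Rightarrow> 'n cvec \<Rightarrow> 'n clifford"
  where "pderiv_y k F X = frechet_derivative F (at X) (axis k \<i>)"

definition pderiv_z :: "'n::{finite,linorder} \<Rightarrow> ('n cvec \<Rightarrow> 'n clifford) \<Rightarrow> 'n cvec \<Rightarrow> 'n clifford"
  where "pderiv_z k F X = (1 / 2) *s (pderiv_x k F X - \<i> *s pderiv_y k F X)"

definition pderiv_zc :: "'n::{finite,linorder} \<Rightarrow> ('n cvec \<Rightarrow> 'n clifford) \<Rightarrow> 'n cvec \<Rightarrow> 'n clifford"
  where "pderiv_zc k F X = (1 / 2) *s (pderiv_x k F X + \<i> *s pderiv_y k F X)"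

definition dirac_z :: "('n cvec \<Rightarrow> 'n clifford) \<Rightarrow> 'n cvec \<Rightarrow> 'n::{finite,linorder} clifford"
  where "dirac_z F X = (\<Sum>k\<in>UNIV. witt_fd k \<star> pderiv_z k F X)"

definition dirac_zd :: "('n cvec \<Rightarrow> 'n clifford) \<Rightarrow> 'n cvec \<Rightarrow> 'n::{finite,linorder} clifford"
  where "dirac_zd F X = (\<Sum>k\<in>UNIV. witt_f k \<star> pderiv_zc k F X)"

definition hermitian_monogenic_on ::
    "'n cvec set \<Rightarrow> ('n cvec \<Rightarrow> 'n::{finite,linorder} clifford) \<Rightarrow> bool"
  where "hermitian_monogenic_on \<Omega> F \<longleftrightarrow>
    Ck_on 1 F \<Omega> \<and> (\<forall>X\<in>\<Omega>. dirac_z F X = 0 \<and> dirac_zd F X = 0)"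


section \<open>Differential forms\<close>

text \<open>
  A form at a point is a function of the list of tangent vectors it is evaluated on.  The wedge
  product of \<open>m\<close> covectors, evaluated on \<open>m\<close> vectors, is the determinant of the matrix of values.
\<close>

definition wedge :: "('v \<Rightarrow> 'a::comm_ring_1) list \<Rightarrow> 'v list \<Rightarrow> 'a"
  where "wedge \<phi>s ws =
    (\<Sum>\<pi> | \<pi> permutes {..<length \<phi>s}. of_int (sign \<pi>) * (\<Prod>i<length \<phi>s. (\<phi>s ! i) (ws ! \<pi> i)))"

fun dx_covector :: "'n::finite \<times> bool \<Rightarrow> 'n cvec \<Rightarrow> real"
  where
    "dx_covector (k, False) = (\<lambda>w. Re (w $ k))"
  | "dx_covector (k, True) = (\<lambda>w. Im (w $ k))"

definition vol_form :: "'n::{finite,linorder} cvec list \<Rightarrow> real"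
  where "vol_form = wedge (map dx_covector labels)"

text \<open>Here the label \<open>(k, False)\<close> stands for \<open>dz\<^sub>k\<close> and \<open>(k, True)\<close> for its conjugate.\<close>

fun dz_covector :: "'n::finite \<times> bool \<Rightarrow> 'n cvec \<Rightarrow> complex"
  where
    "dz_covector (k, False) = (\<lambda>w. w $ k)"
  | "dz_covector (k, True) = (\<lambda>w. cnj (w $ k))"

definition hat_form :: "'n::{finite,linorder} \<times> bool \<Rightarrow> 'n cvec list \<Rightarrow> complex"
  where "hat_form p = wedge (map dz_covector (remove1 p labels))"

definition dsigma :: "'n cvec list \<Rightarrow> 'n::{finite,linorder} clifford"
  where "dsigma ws = (\<Sum>j\<in>UNIV. hat_form (j, False) ws *s witt_fd j)"

definition dsigma_d :: "'n cvec list \<Rightarrow> 'n::{finite,linorder} clifford"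
  where "dsigma_d ws = - (\<Sum>j\<in>UNIV. hat_form (j, True) ws *s witt_f j)"


section \<open>Integration over the boundary of a smooth domain\<close>

definition smooth_boundary :: "('a::euclidean_space) set \<Rightarrow> bool"
  where "smooth_boundary D \<longleftrightarrow>
    (\<forall>p\<in>frontier D. \<exists>U (r :: 'a \<Rightarrow> real). open U \<and> p \<in> U \<and> (\<forall>m. Ck_on m r U) \<and>
       (\<forall>q\<in>U. frechet_derivative r (at q) \<noteq> (\<lambda>v. 0)) \<and>
       D \<inter> U = {q\<in>U. r q < 0} \<and> frontier D \<inter> U = {q\<in>U. r q = 0})"

text \<open>
  Boundary charts are defined on open subsets of \<open>\<real>\<^bsup>2n-1\<^esup>\<close>, realised as \<open>real ^ 'n tcoord\<close>, where
  \<open>'n tcoord\<close> is an index type with \<open>2n - 1\<close> elements, namely all labels but the first one.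
\<close>

typedef (overloaded) ('n::"{finite,linorder}") tcoord = "set (tl (labels :: ('n \<times> bool) list))"
proof -
  have "sorted_list_of_set (UNIV :: 'n set) \<noteq> []" by simp
  then obtain k ks where "sorted_list_of_set (UNIV :: 'n set) = k # ks"
    by (cases "sorted_list_of_set (UNIV :: 'n set)") auto
  then have "(k, True) \<in> set (tl (labels :: ('n \<times> bool) list))"
    by (simp add: labels_def)
  then show ?thesis by blast
qed

instance tcoord :: ("{finite,linorder}") finite
proof
  have "UNIV = Abs_tcoord ` set (tl (labels :: ('a \<times> bool) list))"
    by (metis UNIV_eq_I Rep_tcoord Rep_tcoord_inverse image_eqI)
  then show "finite (UNIV :: 'a tcoord set)"
    by (metis List.finite_set finite_imageI)
qed

lemma length_labels: "length (labels :: ('n::{finite,linorder} \<times> bool) list) = 2 * CARD('n)"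
  by (simp add: labels_def length_concat o_def sum_list_triv)

lemma distinct_labels: "distinct (labels :: ('n::{finite,linorder} \<times> bool) list)"
proof -
  have "distinct (concat (map (\<lambda>k. [(k, False), (k, True)]) ks))"
    if "distinct ks" for ks :: "'n list"
    using that by (induction ks) auto
  then show ?thesis by (simp add: labels_def)
qed

lemma card_tcoord: "CARD('n::{finite,linorder} tcoord) = 2 * CARD('n) - 1"
proof -
  have "CARD('n tcoord) = card (set (tl (labels :: ('n \<times> bool) list)))"
    by (rule type_definition.card) (rule type_definition_tcoord)
  then show ?thesis
    by (simp add: distinct_card distinct_tl distinct_labels length_labels)
qed

type_synonym 'n param = "(real, 'n tcoord) vec"

definition tangents ::
    "('n param \<Rightarrow> 'n cvec) \<Rightarrow> 'n param \<Rightarrow> 'n::{finite,linorder} cvec list"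
  where "tangents \<phi> u =
    map (\<lambda>p. frechet_derivative \<phi> (at u) (axis (Abs_tcoord p) 1)) (tl labels)"

definition outward :: "'a::real_normed_vector set \<Rightarrow> 'a \<Rightarrow> 'a \<Rightarrow> bool"
  where "outward D p \<nu> \<longleftrightarrow>
    (\<exists>\<epsilon>>0. \<forall>t. 0 < t \<and> t < \<epsilon> \<longrightarrow> p - t *\<^sub>R \<nu> \<in> D \<and> p + t *\<^sub>R \<nu> \<notin> closure D)"

text \<open>
  The last condition expresses the induced orientation (outward vector first).  The determinant
  being nonzero also makes the parametrisation regular and \<open>\<nu>\<close> transversal to the boundary.
\<close>

definition oriented_chart ::
    "'n cvec set \<Rightarrow> 'n param set \<Rightarrow>
     ('n param \<Rightarrow> 'n::{finite,linorder} cvec) \<Rightarrow> bool"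
  where "oriented_chart D U \<phi> \<longleftrightarrow>
    open U \<and> Ck_on 1 \<phi> U \<and> (\<exists>\<psi>. homeomorphism U (\<phi> ` U) \<phi> \<psi>) \<and>
    openin (top_of_set (frontier D)) (\<phi> ` U) \<and>
    (\<forall>u\<in>U. \<exists>\<nu>. outward D (\<phi> u) \<nu> \<and> vol_form (\<nu> # tangents \<phi> u) > 0)"

text \<open>A finite oriented atlas with a subordinate partition of unity \<open>\<rho>\<close> on the boundary.\<close>

definition oriented_atlas ::
    "'n cvec set \<Rightarrow> nat \<Rightarrow> (nat \<Rightarrow> 'n param set) \<Rightarrow>
     (nat \<Rightarrow> 'n param \<Rightarrow> 'n::{finite,linorder} cvec) \<Rightarrow> (nat \<Rightarrow> 'n cvec \<Rightarrow> real) \<Rightarrow> bool"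
  where "oriented_atlas D N U \<phi> \<rho> \<longleftrightarrow>
    (\<forall>i<N. oriented_chart D (U i) (\<phi> i) \<and> continuous_on (frontier D) (\<rho> i) \<and>
       (\<forall>p\<in>frontier D. \<rho> i p \<ge> 0) \<and> closure {p\<in>frontier D. \<rho> i p \<noteq> 0} \<subseteq> \<phi> i ` U i) \<and>
    (\<forall>p\<in>frontier D. (\<Sum>i<N. \<rho> i p) = 1)"

text \<open>
  The integral of a \<open>(2n-1)\<close>-form \<open>\<omega>\<close> over the boundary of \<open>D\<close>: for a compact smooth boundary and a
  continuous form the sum below does not depend on the atlas and the partition of unity.
\<close>

definition boundary_integral ::
    "'n::{finite,linorder} cvec set \<Rightarrow>
     ('n cvec \<Rightarrow> 'n cvec list \<Rightarrow> 'b::real_normed_vector) \<Rightarrow> 'b"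
  where "boundary_integral D \<omega> =
    (THE I. \<exists>N U \<phi> \<rho>. oriented_atlas D N U \<phi> \<rho> \<and>
       I = (\<Sum>i<N. integral (U i) (\<lambda>u. \<rho> i (\<phi> i u) *\<^sub>R \<omega> (\<phi> i u) (tangents (\<phi> i) u))))"


section \<open>The Cauchy kernels\<close>

text \<open>
  The area of the unit sphere is the integral of its area form, the contraction of the volume form
  with the outward unit normal; at a point \<open>p\<close> of the sphere this normal is \<open>p\<close> itself.
\<close>

definition sphere_area :: "'n::{finite,linorder} itself \<Rightarrow> real"
  where "sphere_area _ = boundary_integral (ball (0 :: 'n cvec) 1) (\<lambda>p ws. vol_form (p # ws))"

definition hvec :: "'n cvec \<Rightarrow> 'n::{finite,linorder} clifford"
  where "hvec X = (\<Sum>k\<in>UNIV. (X $ k) *s witt_f k)"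

definition hvec_d :: "'n cvec \<Rightarrow> 'n::{finite,linorder} clifford"
  where "hvec_d X = (\<Sum>k\<in>UNIV. cnj (X $ k) *s witt_fd k)"

definition E_kernel :: "'n cvec \<Rightarrow> 'n::{finite,linorder} clifford"
  where "E_kernel X =
    (2 / sphere_area TYPE('n)) *\<^sub>R ((1 / norm X ^ (2 * CARD('n))) *\<^sub>R hvec X)"

definition E_kernel_d :: "'n cvec \<Rightarrow> 'n::{finite,linorder} clifford"
  where "E_kernel_d X =
    (2 / sphere_area TYPE('n)) *\<^sub>R ((1 / norm X ^ (2 * CARD('n))) *\<^sub>R hvec_d X)"

end

theory Submission
  imports Defs "Jordan_Normal_Form.Determinant"
begin

text \<open>
  For a chart \<open>\<phi>\<close> of the boundary and a constant transversal vector \<open>\<nu>\<close>, the map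
  \<open>(u, t) \<mapsto> \<phi> u + t \<nu>\<close> has the Jacobian \<open>vol_form (\<nu> # tangents \<phi> u)\<close>, which does not depend on \<open>t\<close>.
  Change of variables and the fundamental theorem of calculus in \<open>t\<close> thus give the divergence theorem
  for a field \<open>f \<nu>\<close> supported near a boundary point, for every chart.  The transversal directions
  span, and a partition into bumps makes the result global.  Hence the boundary integral of a
  continuously differentiable form is an integral over \<open>D\<close>, whichever atlas is used.

  On the boundary of \<open>D\<close> the factor \<open>|z|\<^bsup>-2n\<^esup>\<close> of the Cauchy kernels may be replaced by a continuously
  differentiable radial function that differs from it only near \<open>z = 0\<close>.  By \<open>z z = 0\<close>,
  \<open>z\<^sup>\<dagger> z\<^sup>\<dagger> = 0\<close> and \<open>z z\<^sup>\<dagger> + z\<^sup>\<dagger> z = |z|\<^sup>2\<close> the divergences of the two mixed forms vanish, and that of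
  the main form is \<open>g\<close> times a nonnegative scalar weight concentrated at \<open>X\<close>.  The divergence theorem
  on the unit ball shows that the total mass of this weight is half the area of the sphere.
\<close>

no_notation Matrix.vec_index (infixl "$" 100)
no_notation Matrix.scalar_prod (infix "\<bullet>" 70)
hide_const (open) Determinant.det Matrix.vec Matrix.mat Matrix.row
hide_fact (open) Matrix.vec_eq_iff Matrix.row_def Determinant.det_def

section \<open>Determinants and wedge products\<close>

text \<open>\<open>boundary_integral\<close> is a description over all oriented atlases, so it
  denotes a value only once an atlas exists and all atlases agree. The obstacle to agreement is that
  charts are merely \<open>Ck_on 1\<close> and partition functions merely continuous: a field times
  a partition function cannot be differentiated. Charts are therefore compared locally. Near a
  boundary point two charts give the same flux for differentiable fields, both being one volume
  integral, hence by density also for continuous ones, and all partition functions can be moved into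
  a single chart. Displacing a C1 chart along a constant vector, rather than along its normal field,
  keeps the tube C1. Regularising the kernel inside D avoids excising a ball around X, which would
  bring in a second boundary component with its own charts and a limit of surface integrals. Since
  \<open>sphere_area\<close> is itself a \<open>boundary_integral\<close>, no polar coordinates are
  needed for the normalisation.\<close>

lemma wedge_eq_det_mat:
  fixes \<phi>s :: "('v \<Rightarrow> 'a::comm_ring_1) list"
  assumes "length \<phi>s = m"
  shows "wedge \<phi>s ws = Determinant.det (Matrix.mat m m (\<lambda>(i, j). (\<phi>s ! i) (ws ! j)))"
proof -
  have "(\<Prod>i<m. (\<phi>s ! i) (ws ! \<pi> i)) =
        (\<Prod>i = 0..<m. Matrix.mat m m (\<lambda>(i, j). (\<phi>s ! i) (ws ! j)) $$ (i, \<pi> i))"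
    if "\<pi> permutes {0..<m}" for \<pi>
    using permutes_in_image[OF that] by (auto simp: lessThan_atLeast0 intro!: prod.cong)
  then show ?thesis
    unfolding wedge_def Determinant.det_def assms
    by (auto simp: lessThan_atLeast0 intro!: sum.cong)
qed

text \<open>Laplace expansion along the column of \<open>v\<close>: covectors index the rows and
  vectors the columns, so deleting row i and column 0 leaves the wedge without the i-th
  covector.\<close>

lemma wedge_Cons_expand:
  fixes \<phi>s :: "('v \<Rightarrow> 'a::comm_ring_1) list"
  assumes "length \<phi>s = Suc (length ws)"
  shows "wedge \<phi>s (v # ws) =
    (\<Sum>i<length \<phi>s. (- 1) ^ i * (\<phi>s ! i) v * wedge (take i \<phi>s @ drop (Suc i) \<phi>s) ws)"
proof -
  let ?m = "length \<phi>s" and ?A = "Matrix.mat (length \<phi>s) (length \<phi>s) (\<lambda>(i, j). (\<phi>s ! i) ((v # ws) ! j))"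
  have "wedge \<phi>s (v # ws) = Determinant.det ?A"
    by (rule wedge_eq_det_mat) simp
  also have "\<dots> = (\<Sum>i<?m. ?A $$ (i, 0) * cofactor ?A i 0)"
    by (rule laplace_expansion_column) (use assms in auto)
  also have "\<dots> = (\<Sum>i<?m. (- 1) ^ i * (\<phi>s ! i) v * wedge (take i \<phi>s @ drop (Suc i) \<phi>s) ws)"
  proof (rule sum.cong[OF refl])
    fix i assume i: "i \<in> {..<?m}"
    let ?\<psi>s = "take i \<phi>s @ drop (Suc i) \<phi>s"
    have "mat_delete ?A i 0 =
        Matrix.mat (?m - 1) (?m - 1) (\<lambda>(i, j). (?\<psi>s ! i) (ws ! j))"
      using i by (intro eq_matI) (auto simp: mat_delete_def nth_append min_def)
    moreover have "length ?\<psi>s = ?m - 1" using i by auto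
    ultimately have "Determinant.det (mat_delete ?A i 0) = wedge ?\<psi>s ws"
      by (metis wedge_eq_det_mat)
    then show "?A $$ (i, 0) * cofactor ?A i 0 = (- 1) ^ i * (\<phi>s ! i) v * wedge ?\<psi>s ws"
      using i assms by (simp add: cofactor_def mult_ac)
  qed
  finally show ?thesis .
qed

text \<open>The bijection transports permutations of the index type to permutations of an initial
  segment and keeps their signs. Any index type of the right size can thus carry the matrix, in
  particular the one over which variables are changed.\<close>

lemma wedge_eq_det:
  fixes \<phi>s :: "('v \<Rightarrow> 'a::comm_ring_1) list" and \<beta> :: "'m::finite \<Rightarrow> nat"
  assumes \<beta>: "bij_betw \<beta> UNIV {..<length \<phi>s}"
  shows "wedge \<phi>s ws = det (\<chi> i j. (\<phi>s ! \<beta> i) (ws ! \<beta> j))"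
proof -
  let ?m = "length \<phi>s"
  have inj: "inj \<beta>" using \<beta> by (simp add: bij_betw_def)
  have img: "\<beta> ` UNIV = {..<?m}" using \<beta> by (simp add: bij_betw_def)
  have "(\<Sum>\<pi> | \<pi> permutes {..<?m}. of_int (sign \<pi>) * (\<Prod>i<?m. (\<phi>s ! i) (ws ! \<pi> i))) =
      (\<Sum>p | p permutes (UNIV :: 'm set). of_int (sign p) * (\<Prod>i\<in>UNIV. (\<phi>s ! \<beta> i) (ws ! \<beta> (p i))))"
  proof (rule trans[OF sum.reindex_bij_betw[where h = "map_permutation UNIV \<beta>", symmetric]])
    show "bij_betw (map_permutation UNIV \<beta>) {p. p permutes (UNIV :: 'm set)} {\<pi>. \<pi> permutes {..<?m}}"
      using bij_betw_permutations[OF \<beta>]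
      by (rule bij_betw_cong[THEN iffD1, rotated]) (auto simp: map_permutation_def restrict_id_def img fun_eq_iff)
    show "(\<Sum>p | p permutes (UNIV :: 'm set). of_int (sign (map_permutation UNIV \<beta> p)) *
            (\<Prod>i<?m. (\<phi>s ! i) (ws ! map_permutation UNIV \<beta> p i))) =
      (\<Sum>p | p permutes (UNIV :: 'm set). of_int (sign p) * (\<Prod>i\<in>UNIV. (\<phi>s ! \<beta> i) (ws ! \<beta> (p i))))"
    proof (rule sum.cong[OF refl])
      fix p assume p: "p \<in> {p. p permutes (UNIV :: 'm set)}"
      have 1: "sign (map_permutation UNIV \<beta> p) = sign p"
        using p inj by (intro sign_map_permutation) auto
      have 2: "(\<Prod>i<?m. (\<phi>s ! i) (ws ! map_permutation UNIV \<beta> p i)) =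
          (\<Prod>i\<in>UNIV. (\<phi>s ! \<beta> i) (ws ! \<beta> (p i)))"
        unfolding img[symmetric] using inj
        by (subst prod.reindex) (auto simp: map_permutation_apply)
      show "of_int (sign (map_permutation UNIV \<beta> p)) *
            (\<Prod>i<?m. (\<phi>s ! i) (ws ! map_permutation UNIV \<beta> p i)) =
          of_int (sign p) * (\<Prod>i\<in>UNIV. (\<phi>s ! \<beta> i) (ws ! \<beta> (p i)))"
        unfolding 1 2 ..
    qed
  qed
  then show ?thesis
    by (simp add: wedge_def det_def)
qed

text \<open>With \<open>c\<close> the imaginary unit this is the matrix form of dz \<and> dz^c = -2i
  dx \<and> dy.\<close>

lemma det_rows_pair:
  fixes a b :: "'a::comm_ring_1 ^ 'm"
  assumes "i \<noteq> j"
  shows "det (\<chi> l. if l = i then a + c *s b else if l = j then a - c *s b else R l) =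
    (- 2 * c) * det (\<chi> l. if l = i then a else if l = j then b else R l)"
proof -
  let ?B = "\<chi> l. if l = i then a else if l = j then b else R l"
  let ?C = "\<chi> l. if l = i then row i ?B + c *s row j ?B else row l ?B"
  \<comment> \<open>\<open>a - c *s b\<close> is \<open>(- 2 * c) *s b\<close> plus the row
    \<open>a + c *s b\<close>, so this matrix is one row operation away from the left-hand side, and
    its row \<open>j\<close> releases the scalar.\<close>
  let ?E = "\<chi> l. if l = j then (- 2 * c) *s b else if l = i then a + c *s b else R l"
  have "det ?C = det ?B"
    by (rule det_row_operation) (use assms in auto)
  moreover have "det ?E = (- 2 * c) * det (\<chi> l. if l = j then b else if l = i then a + c *s b else R l)"
    by (rule det_row_mul)
  moreover have "(\<chi> l. if l = j then b else if l = i then a + c *s b else R l) = ?C"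
    using assms by (intro vec_eq_iff[THEN iffD2] allI) (simp add: row_def vec_lambda_eta)
  moreover have "det (\<chi> l. if l = j then row j ?E + 1 *s row i ?E else row l ?E) = det ?E"
    by (rule det_row_operation) (use assms in auto)
  moreover have "(\<chi> l. if l = j then row j ?E + 1 *s row i ?E else row l ?E) =
     (\<chi> l. if l = i then a + c *s b else if l = j then a - c *s b else R l)"
    using assms by (intro vec_eq_iff[THEN iffD2] allI) (simp add: row_def vec_lambda_eta)
  ultimately show ?thesis by simp
qed

section \<open>Real coordinates\<close>

text \<open>
  The index type \<open>'n bit0\<close> has \<open>2n\<close> elements and is well-ordered, as the library's change of variables
  theorem requires.
\<close>
definition pos :: "'n::{finite,linorder} bit0 \<Rightarrow> nat"
  where "pos i = nat (Rep_bit0 i)"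

definition lab :: "'n::{finite,linorder} bit0 \<Rightarrow> 'n \<times> bool"
  where "lab i = labels ! pos i"

lemma bij_betw_pos: "bij_betw pos (UNIV :: 'n::{finite,linorder} bit0 set) {..<2 * CARD('n)}"
proof (rule bij_betw_byWitness[where f' = "\<lambda>k. Abs_bit0 (int k)"])
  show "\<forall>i\<in>UNIV. Abs_bit0 (int (pos i)) = (i :: 'n bit0)"
  proof
    fix i :: "'n bit0"
    have "0 \<le> Rep_bit0 i" using Rep_bit0[of i] by simp
    then show "Abs_bit0 (int (pos i)) = i"
      by (simp add: pos_def Rep_bit0_inverse)
  qed
  show "\<forall>k\<in>{..<2 * CARD('n)}. pos (Abs_bit0 (int k) :: 'n bit0) = k"
    by (auto simp: pos_def Abs_bit0_inverse)
  have "pos i < 2 * CARD('n)" for i :: "'n bit0"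
    using Rep_bit0[of i] by (auto simp: pos_def)
  then show "pos ` (UNIV :: 'n bit0 set) \<subseteq> {..<2 * CARD('n)}" by auto
qed simp

lemma pos_less: "pos (i :: 'n::{finite,linorder} bit0) < 2 * CARD('n)"
  using bij_betw_pos by (auto simp: bij_betw_def)

lemma pos_eq_iff [simp]: "pos i = pos j \<longleftrightarrow> i = j"
  using bij_betw_pos by (auto simp: bij_betw_def inj_on_def)

lemma pos_0 [simp]: "pos 0 = 0"
  by (simp add: pos_def zero_bit0_def Abs_bit0_inverse)

lemma set_labels [simp]: "set labels = (UNIV :: ('n::{finite,linorder} \<times> bool) set)"
  by (auto simp: labels_def)

lemma bij_lab: "bij (lab :: 'n::{finite,linorder} bit0 \<Rightarrow> _)"
proof -
  have "bij_betw ((!) labels) {..<2 * CARD('n)} (UNIV :: ('n \<times> bool) set)"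
    by (rule bij_betw_nth) (auto simp: distinct_labels length_labels)
  from bij_betw_trans[OF bij_betw_pos this] show ?thesis
    by (simp add: lab_def[abs_def] o_def)
qed

lemma lab_eq_iff [simp]: "lab i = lab j \<longleftrightarrow> i = j"
  using bij_lab by (auto simp: bij_def inj_def)

definition unlab :: "'n::{finite,linorder} \<times> bool \<Rightarrow> 'n bit0"
  where "unlab = inv_into UNIV lab"

lemma lab_unlab [simp]: "lab (unlab p) = p"
  unfolding unlab_def by (meson bij_lab bij_inv_eq_iff)

lemma unlab_lab [simp]: "unlab (lab i) = i"
  by (metis lab_unlab lab_eq_iff)

lemma set_tl_labels: "set (tl labels) = (UNIV :: ('n::{finite,linorder} \<times> bool) set) - {lab 0}"
proof -
  have ne: "(labels :: ('n \<times> bool) list) \<noteq> []"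
    using length_labels[where 'n = 'n] by (metis card_gt_0_iff finite_class.finite_UNIV length_0_conv
        less_not_refl mult_pos_pos pos2 UNIV_not_empty)
  then obtain p ps where p: "(labels :: ('n \<times> bool) list) = p # ps" by (meson neq_Nil_conv)
  have "lab 0 = p" by (simp add: lab_def p)
  moreover have "p \<notin> set ps" using distinct_labels[where 'n = 'n] p by (metis distinct.simps(2))
  moreover have "insert p (set ps) = UNIV" using p set_labels by (metis list.simps(15))
  ultimately show ?thesis unfolding p by auto
qed

lemma lab_in_tl [simp]: "lab i \<in> set (tl labels) \<longleftrightarrow> i \<noteq> 0"
  by (simp add: set_tl_labels)

lemma unlab_Rep_neq_0 [simp]: "unlab (Rep_tcoord q) \<noteq> 0"
proof
  assume "unlab (Rep_tcoord q) = 0"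
  then have "Rep_tcoord q = lab 0" by (metis lab_unlab)
  then show False using Rep_tcoord[of q] by simp
qed

text \<open>Position 0 belongs to the label that \<open>tcoord\<close> omits. It hosts the
  additional first vector, so the remaining tangents keep their labels.\<close>

lemma nth_Cons_labels:
  fixes i :: "'n::{finite,linorder} bit0"
  shows "(v # map f (tl labels)) ! pos i = (if i = 0 then v else f (lab i))"
proof (cases "i = 0")
  case False
  then have "pos i \<noteq> 0" by (metis pos_0 pos_eq_iff)
  then obtain k where k: "pos i = Suc k" by (cases "pos i") auto
  have "k < length (tl (labels :: ('n \<times> bool) list))"
    using pos_less[of i] by (simp add: k length_labels)
  then show ?thesis
    using False by (simp add: k lab_def nth_tl)
qed simp

lemma vol_form_eq_det:
  "vol_form ws = det (\<chi> i j :: 'n::{finite,linorder} bit0. dx_covector (lab i) (ws ! pos j))"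
proof -
  have "bij_betw pos (UNIV :: 'n bit0 set) {..<length (map dx_covector (labels :: ('n \<times> bool) list))}"
    using bij_betw_pos by (simp add: length_labels)
  from wedge_eq_det[OF this] show ?thesis
    unfolding vol_form_def
    by (simp add: length_labels pos_less lab_def)
qed

text \<open>Passing from real to complex covectors one coordinate at a time costs the factor
  \<open>- 2 * \<i>\<close> per pair of rows. This is the origin of the constant in the
  theorem.\<close>

lemma wedge_dz_eq_vol_form:
  fixes ws :: "'n::{finite,linorder} cvec list"
  shows "wedge (map dz_covector labels) ws = (- 2 * \<i>) ^ CARD('n) * of_real (vol_form ws)"
proof -
  \<comment> \<open>In \<open>M S\<close> the two rows belonging to each \<open>k \<in> S\<close>
    are already complex, the others still real.\<close>
  define M where "M S = (\<chi> i j :: 'n bit0. if fst (lab i) \<in> S then dz_covector (lab i) (ws ! pos j)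
      else of_real (dx_covector (lab i) (ws ! pos j)))" for S
  have M: "det (M S) = (- 2 * \<i>) ^ card S * det (M {})" if "finite S" for S
    using that
  proof induction
    case (insert k S)
    define i where "i = unlab (k, False)"
    define j where "j = unlab (k, True)"
    define a :: "complex ^ 'n bit0" where "a = (\<chi> c. of_real (dx_covector (k, False) (ws ! pos c)))"
    define b :: "complex ^ 'n bit0" where "b = (\<chi> c. of_real (dx_covector (k, True) (ws ! pos c)))"
    have li: "lab i = (k, False)" and lj: "lab j = (k, True)" by (simp_all add: i_def j_def)
    then have ij: "i \<noteq> j" by auto
    have l: "l = i \<or> l = j" if "fst (lab l) = k" for l
    proof -
      from that have "lab l = lab i \<or> lab l = lab j" unfolding li lj by (cases "lab l") auto
      then show ?thesis by simp
    qed
    have "M (insert k S) = (\<chi> l. if l = i then a + \<i> *s b else if l = j then a - \<i> *s b else M S $ l)"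
    proof (intro vec_eq_iff[THEN iffD2] allI)
      fix l c
      show "M (insert k S) $ l $ c = (\<chi> l. if l = i then a + \<i> *s b else if l = j then a - \<i> *s b else M S $ l) $ l $ c"
        using l[of l] ij by (auto simp: M_def li lj a_def b_def complex_eq_iff)
    qed
    moreover have "M S = (\<chi> l. if l = i then a else if l = j then b else M S $ l)"
    proof (intro vec_eq_iff[THEN iffD2] allI)
      fix l c
      show "M S $ l $ c = (\<chi> l. if l = i then a else if l = j then b else M S $ l) $ l $ c"
        using ij insert.hyps by (auto simp: M_def li lj a_def b_def)
    qed
    ultimately have "det (M (insert k S)) = (- 2 * \<i>) * det (M S)"
      using det_rows_pair[OF ij, of a \<i> b "\<lambda>l. M S $ l"] by simp
    then show ?case using insert by simp
  qed simp
  have "bij_betw pos (UNIV :: 'n bit0 set) {..<length (map dz_covector (labels :: ('n \<times> bool) list))}"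
    using bij_betw_pos by (simp add: length_labels)
  from wedge_eq_det[OF this] have "wedge (map dz_covector labels) ws = det (M UNIV)"
    by (simp add: M_def length_labels pos_less lab_def)
  moreover have "det (M {}) = of_real (vol_form ws)"
    unfolding M_def vol_form_eq_det by (simp add: det_def)
  ultimately show ?thesis using M[of UNIV] by simp
qed

section \<open>Forms with one factor omitted\<close>

lemma snd_labels_nth:
  assumes "i < 2 * CARD('n)"
  shows "snd ((labels :: ('n::{finite,linorder} \<times> bool) list) ! i) = odd i"
proof -
  have "snd (concat (map (\<lambda>k. [(k, False), (k, True)]) ks) ! i) = odd i"
    if "i < 2 * length ks" for ks :: "'n list"
    using that
  proof (induction ks arbitrary: i)
    case (Cons k ks)
    show ?case
    proof (cases "i < 2")
      case True
      then show ?thesis by (cases i) (auto simp: less_Suc_eq numeral_2_eq_2)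
    next
      case False
      then obtain l where l: "i = Suc (Suc l)" by (metis add_2_eq_Suc' add.commute le_Suc_ex not_less)
      then show ?thesis using Cons by simp
    qed
  qed simp
  then show ?thesis using assms by (simp add: labels_def)
qed

lemma sum_labels:
  "(\<Sum>i<2 * CARD('n). f ((labels :: ('n::{finite,linorder} \<times> bool) list) ! i)) = (\<Sum>p\<in>UNIV. f p)"
proof -
  have "bij_betw ((!) labels) {..<2 * CARD('n)} (UNIV :: ('n \<times> bool) set)"
    by (rule bij_betw_nth) (auto simp: distinct_labels length_labels)
  then show ?thesis by (rule sum.reindex_bij_betw)
qed

lemma take_drop_labels:
  assumes "i < 2 * CARD('n)"
  shows "take i labels @ drop (Suc i) labels = remove1 (labels ! i) (labels :: ('n::{finite,linorder} \<times> bool) list)"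
proof -
  have "take i xs @ drop (Suc i) xs = remove1 (xs ! i) xs" if "distinct xs" "i < length xs"
    for xs :: "('n \<times> bool) list"
    using that
  proof (induction xs arbitrary: i)
    case (Cons x xs)
    then show ?case by (cases i) (auto simp: nth_mem)
  qed simp
  then show ?thesis using assms by (simp add: distinct_labels length_labels)
qed

text \<open>Labels alternate between x and y, so the Laplace sign \<open>(- 1) ^ i\<close> depends
  only on the second component of the label and the sum can run over labels instead of
  positions.\<close>

lemma wedge_labels_expand:
  fixes ws :: "'n::{finite,linorder} cvec list" and \<alpha> :: "'n \<times> bool \<Rightarrow> 'n cvec \<Rightarrow> 'a::comm_ring_1"
  assumes "length ws = 2 * CARD('n) - 1"
  shows "wedge (map \<alpha> labels) (v # ws) =
    (\<Sum>p\<in>UNIV. (if snd p then - 1 else 1) * \<alpha> p v * wedge (map \<alpha> (remove1 p labels)) ws)"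
proof -
  have len: "length (map \<alpha> (labels :: ('n \<times> bool) list)) = Suc (length ws)"
    using assms by (simp add: length_labels Suc_diff_le)
  have "wedge (map \<alpha> labels) (v # ws) =
      (\<Sum>i<2 * CARD('n). (if snd (labels ! i :: 'n \<times> bool) then - 1 else 1) * \<alpha> (labels ! i) v *
         wedge (map \<alpha> (remove1 (labels ! i) labels)) ws)"
    unfolding wedge_Cons_expand[OF len]
  proof (rule sum.cong)
    show "{..<length (map \<alpha> (labels :: ('n \<times> bool) list))} = {..<2 * CARD('n)}"
      by (simp add: length_labels)
    fix i assume "i \<in> {..<2 * CARD('n)}"
    then have i: "i < 2 * CARD('n)" by simp
    have m: "take i (map \<alpha> labels) @ drop (Suc i) (map \<alpha> labels) = map \<alpha> (remove1 (labels ! i) labels)"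
      using take_drop_labels[OF i] by (simp add: take_map drop_map flip: map_append)
    show "(- 1) ^ i * (map \<alpha> labels ! i) v * wedge (take i (map \<alpha> labels) @ drop (Suc i) (map \<alpha> labels)) ws =
        (if snd (labels ! i :: 'n \<times> bool) then - 1 else 1) * \<alpha> (labels ! i) v *
         wedge (map \<alpha> (remove1 (labels ! i) labels)) ws"
      unfolding m snd_labels_nth[OF i] using i by (simp add: length_labels)
  qed
  also have "\<dots> = (\<Sum>p\<in>UNIV. (if snd p then - 1 else 1) * \<alpha> p v * wedge (map \<alpha> (remove1 p labels)) ws)"
    by (rule sum_labels[where f = "\<lambda>p. (if snd p then - 1 else 1) * \<alpha> p v * wedge (map \<alpha> (remove1 p labels)) ws"])
  finally show ?thesis .
qed

fun dir_vec :: "'n::finite \<times> bool \<Rightarrow> 'n cvec"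
  where
    "dir_vec (k, False) = axis k 1"
  | "dir_vec (k, True) = axis k \<i>"

text \<open>Inserting the directions of x_j and y_j as first vector isolates the two forms attached
  to j. If h omits dz_j and h' omits dz_j^c, the results are h - h' and i(h + h'); solving this
  system gives both formulas.\<close>

lemma hat_form_eq:
  fixes ws :: "'n::{finite,linorder} cvec list"
  assumes "length ws = 2 * CARD('n) - 1"
  shows "hat_form (j, False) ws = (- 2 * \<i>) ^ CARD('n) / 2 *
      (of_real (vol_form (dir_vec (j, False) # ws)) - \<i> * of_real (vol_form (dir_vec (j, True) # ws)))"
    and "hat_form (j, True) ws = (- 2 * \<i>) ^ CARD('n) / 2 *
      (- of_real (vol_form (dir_vec (j, False) # ws)) - \<i> * of_real (vol_form (dir_vec (j, True) # ws)))"
proof -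
  let ?c = "(- 2 * \<i>) ^ CARD('n)" and ?x = "of_real (vol_form (dir_vec (j, False) # ws)) :: complex"
    and ?y = "of_real (vol_form (dir_vec (j, True) # ws)) :: complex"
    and ?h = "\<lambda>k b. hat_form (k, b) ws"
  have e: "?c * of_real (vol_form (v # ws)) = (\<Sum>k\<in>UNIV. v $ k * ?h k False - cnj (v $ k) * ?h k True)" for v
  proof -
    have "?c * of_real (vol_form (v # ws)) =
        (\<Sum>p\<in>UNIV \<times> UNIV. (if snd p then - 1 else 1) * dz_covector p v * hat_form p ws)"
      unfolding wedge_dz_eq_vol_form[symmetric] wedge_labels_expand[OF assms] hat_form_def by simp
    also have "\<dots> = (\<Sum>k\<in>UNIV. \<Sum>b\<in>UNIV. (if b then - 1 else 1) * dz_covector (k, b) v * ?h k b)"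
      unfolding sum.cartesian_product by (rule sum.cong) auto
    also have "\<dots> = (\<Sum>k\<in>UNIV. v $ k * ?h k False - cnj (v $ k) * ?h k True)"
      by (rule sum.cong) (auto simp: UNIV_bool)
    finally show ?thesis .
  qed
  have "?c * ?x = (\<Sum>k\<in>UNIV. if k = j then ?h j False - ?h j True else 0)"
    unfolding e by (rule sum.cong) (auto simp: axis_def)
  then have x: "?c * ?x = ?h j False - ?h j True" by simp
  have "?c * ?y = (\<Sum>k\<in>UNIV. if k = j then \<i> * (?h j False + ?h j True) else 0)"
    unfolding e by (rule sum.cong) (auto simp: axis_def algebra_simps)
  then have y: "?c * ?y = \<i> * (?h j False + ?h j True)" by simp
  have "?c / 2 * (?x - \<i> * ?y) = (?c * ?x - \<i> * (?c * ?y)) / 2"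
    by (simp add: field_simps)
  then show "?h j False = ?c / 2 * (?x - \<i> * ?y)"
    unfolding x y by (simp add: mult.assoc[symmetric])
  have "?c / 2 * (- ?x - \<i> * ?y) = (- (?c * ?x) - \<i> * (?c * ?y)) / 2"
    by (simp add: field_simps)
  then show "?h j True = ?c / 2 * (- ?x - \<i> * ?y)"
    unfolding x y by (simp add: mult.assoc[symmetric])
qed

section \<open>Linear identifications between the coordinate spaces\<close>

definition coord :: "'n::{finite,linorder} cvec \<Rightarrow> real ^ 'n bit0"
  where "coord w = (\<chi> i. dx_covector (lab i) w)"

definition uncoord :: "real ^ 'n bit0 \<Rightarrow> 'n::{finite,linorder} cvec"
  where "uncoord x = (\<chi> k. Complex (x $ unlab (k, False)) (x $ unlab (k, True)))"

text \<open>Coordinate 0 is split off as the real factor, the parameter t along a tube; the other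
  coordinates form the parameter space of a chart.\<close>

definition unjoin :: "real ^ 'n bit0 \<Rightarrow> 'n::{finite,linorder} param \<times> real"
  where "unjoin x = ((\<chi> q. x $ unlab (Rep_tcoord q)), x $ 0)"

definition join :: "'n::{finite,linorder} param \<times> real \<Rightarrow> real ^ 'n bit0"
  where "join z = (\<chi> i. if i = 0 then snd z else fst z $ Abs_tcoord (lab i))"

lemma dx_uncoord: "dx_covector p (uncoord x) = x $ unlab p"
  by (cases p; cases "snd p") (auto simp: uncoord_def)

lemma coord_uncoord [simp]: "coord (uncoord x) = x"
  by (simp add: vec_eq_iff coord_def dx_uncoord)

lemma uncoord_coord [simp]: "uncoord (coord w) = w"
  by (simp add: vec_eq_iff coord_def uncoord_def)

lemma Rep_Abs_tcoord_lab: "i \<noteq> 0 \<Longrightarrow> Rep_tcoord (Abs_tcoord (lab i)) = lab i"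
  by (rule Abs_tcoord_inverse) simp

lemma join_unjoin [simp]: "join (unjoin x) = x"
  by (simp add: vec_eq_iff join_def unjoin_def Rep_Abs_tcoord_lab)

lemma unjoin_join [simp]: "unjoin (join z) = z"
  by (cases z) (simp add: vec_eq_iff join_def unjoin_def Rep_tcoord_inverse)

lemma linear_dx_covector: "linear (dx_covector p)"
  by (cases p; cases "snd p") (auto intro!: linearI)

lemma linear_coord: "linear coord"
  by (rule linearI) (simp_all add: vec_eq_iff coord_def linear_add[OF linear_dx_covector]
      linear_scale[OF linear_dx_covector])

lemma linear_uncoord: "linear uncoord"
  by (rule linearI) (simp_all add: vec_eq_iff uncoord_def complex_eq_iff)

lemma linear_unjoin: "linear unjoin"
  by (rule linearI) (simp_all add: vec_eq_iff unjoin_def)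

lemma linear_join: "linear join"
  by (rule linearI) (simp_all add: vec_eq_iff join_def)

lemma uncoord_axis: "uncoord (axis i 1) = dir_vec (lab i)"
proof -
  obtain k b where kb: "lab i = (k, b)" by (cases "lab i") auto
  then have i: "i = unlab (k, b)" by (metis unlab_lab)
  have u: "unlab p = unlab q \<longleftrightarrow> p = q" for p q :: "'a \<times> bool" by (metis lab_unlab)
  show ?thesis
    unfolding kb i by (cases b) (auto simp: uncoord_def vec_eq_iff axis_def u complex_eq_iff)
qed

lemma unjoin_axis:
  "unjoin (axis i 1) = (if i = 0 then (0, 1) else (axis (Abs_tcoord (lab i)) 1, 0))"
proof -
  have "unlab (Rep_tcoord q) = i \<longleftrightarrow> i \<noteq> 0 \<and> q = Abs_tcoord (lab i)" for q
    by (metis Rep_Abs_tcoord_lab Rep_tcoord_inverse lab_unlab unlab_Rep_neq_0 unlab_lab)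
  then show ?thesis
    by (auto simp: unjoin_def vec_eq_iff axis_def)
qed

lemma dir_vec_Basis: "dir_vec p \<in> Basis"
  by (cases p; cases "snd p") (auto simp: Basis_vec_def Basis_complex_def)

lemma Basis_cvec: "(Basis :: 'n::{finite,linorder} cvec set) = range dir_vec"
proof
  show "(Basis :: 'n cvec set) \<subseteq> range dir_vec"
  proof
    fix b :: "'n cvec" assume "b \<in> Basis"
    then obtain k c where "b = axis k c" "c = 1 \<or> c = \<i>" by (auto simp: Basis_vec_def Basis_complex_def)
    then have "b = dir_vec (k, False) \<or> b = dir_vec (k, True)" by auto
    then show "b \<in> range dir_vec" by blast
  qed
qed (auto simp: dir_vec_Basis)

lemma inj_dir_vec: "inj dir_vec"
proof (rule injI)
  fix p q :: "'a \<times> bool" assume "dir_vec p = dir_vec q"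
  then show "p = q"
    by (cases p; cases q; cases "snd p"; cases "snd q")
      (auto simp: axis_eq_axis complex_eq_iff)
qed

lemma bij_betw_Basis_uncoord: "bij_betw uncoord Basis Basis"
proof -
  have "inj_on uncoord Basis" by (metis coord_uncoord inj_on_inverseI)
  moreover have "uncoord ` Basis = (Basis :: 'a cvec set)"
  proof -
    have "uncoord ` Basis = (\<lambda>i :: 'a bit0. dir_vec (lab i)) ` UNIV"
      by (auto simp: Basis_vec_def uncoord_axis image_iff)
    also have "\<dots> = range dir_vec"
      using bij_lab[where 'n = 'a] by (simp add: bij_def flip: image_image)
    finally show ?thesis by (simp add: Basis_cvec)
  qed
  ultimately show ?thesis by (simp add: bij_betw_def)
qed

text \<open>An injection of one standard basis into the other is onto by counting: 2n vectors on one
  side, (2n - 1) + 1 on the other.\<close>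

lemma bij_betw_Basis_unjoin: "bij_betw unjoin Basis (Basis :: ('n::{finite,linorder} param \<times> real) set)"
proof -
  have inj: "inj_on unjoin Basis" by (metis join_unjoin inj_on_inverseI)
  have sub: "unjoin ` Basis \<subseteq> (Basis :: ('n param \<times> real) set)"
  proof
    fix y :: "'n param \<times> real" assume "y \<in> unjoin ` Basis"
    then obtain i :: "'n bit0" where "y = unjoin (axis i 1)" by (auto simp: Basis_vec_def)
    then show "y \<in> Basis" by (auto simp: unjoin_axis Basis_prod_def Basis_vec_def split: if_splits)
  qed
  have "card (Basis :: ('n param \<times> real) set) = 2 * CARD('n)"
    by (simp add: card_tcoord)
  moreover have "card (unjoin ` (Basis :: (real ^ 'n bit0) set)) = 2 * CARD('n)"
    by (simp add: card_image[OF inj])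
  ultimately have "unjoin ` Basis = (Basis :: ('n param \<times> real) set)"
    by (intro card_subset_eq sub) auto
  with inj show ?thesis by (simp add: bij_betw_def)
qed

section \<open>Change of variables\<close>

lemma linear_borel_measurable: "linear T \<Longrightarrow> T \<in> borel_measurable borel"
  for T :: "'a::euclidean_space \<Rightarrow> 'b::euclidean_space"
  by (intro borel_measurable_continuous_onI linear_continuous_on linear_conv_bounded_linear[THEN iffD1])

text \<open>\<open>T\<close> carries one orthonormal basis to the other, so preimages of boxes are
  boxes with permuted edges, and Lebesgue measure is determined by boxes. This moves integrals
  between Euclidean spaces of different types.\<close>

lemma lborel_distr_Basis:
  fixes T :: "'a::euclidean_space \<Rightarrow> 'b::euclidean_space"
  assumes T: "linear T" and bij: "bij_betw T Basis Basis"
  shows "lborel = distr lborel borel T"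
proof (rule lborel_eqI)
  have meas [measurable]: "T \<in> borel \<rightarrow>\<^sub>M borel"
    using T by (rule linear_borel_measurable)
  have T_inner: "T x \<bullet> T b = x \<bullet> b" if "b \<in> Basis" for x b
  proof -
    have "T x = T (\<Sum>c\<in>Basis. (x \<bullet> c) *\<^sub>R c)" by (simp add: euclidean_representation)
    also have "\<dots> = (\<Sum>c\<in>Basis. (x \<bullet> c) *\<^sub>R T c)"
      by (simp add: linear_sum[OF T] linear_scale[OF T])
    finally have "T x \<bullet> T b = (\<Sum>c\<in>Basis. (x \<bullet> c) * (T c \<bullet> T b))"
      by (simp add: inner_sum_left)
    also have "\<dots> = (\<Sum>c\<in>Basis. if c = b then x \<bullet> b else 0)"
    proof (rule sum.cong[OF refl])
      fix c :: 'a assume c: "c \<in> Basis"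
      have "T c \<bullet> T b = (if T c = T b then 1 else 0)"
        using bij c that by (intro inner_Basis) (auto simp: bij_betw_def)
      moreover have "T c = T b \<longleftrightarrow> c = b"
        using bij c that by (auto simp: bij_betw_def inj_on_def)
      ultimately show "(x \<bullet> c) * (T c \<bullet> T b) = (if c = b then x \<bullet> b else 0)" by simp
    qed
    finally show ?thesis using that by simp
  qed
  fix l u :: 'b
  assume le: "\<And>b. b \<in> Basis \<Longrightarrow> l \<bullet> b \<le> u \<bullet> b"
  define l' where "l' = (\<Sum>b\<in>Basis. (l \<bullet> T b) *\<^sub>R b)"
  define u' where "u' = (\<Sum>b\<in>Basis. (u \<bullet> T b) *\<^sub>R b)"
  have l': "l' \<bullet> b = l \<bullet> T b" and u': "u' \<bullet> b = u \<bullet> T b" if "b \<in> Basis" for b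
    using that by (simp_all add: l'_def u'_def)
  have TB: "T b \<in> Basis" if "b \<in> Basis" for b using that bij by (auto simp: bij_betw_def)
  have BT: "(\<forall>b\<in>Basis. P b) \<longleftrightarrow> (\<forall>b\<in>Basis. P (T b))" for P
    using bij unfolding bij_betw_def by (metis imageE imageI)
  have "T -` box l u = box l' u'"
    by (auto simp: mem_box BT T_inner l' u')
  then have "emeasure (distr lborel borel T) (box l u) = emeasure lborel (box l' u')"
    by (subst emeasure_distr) auto
  also have "\<dots> = (\<Prod>b\<in>Basis. (u' - l') \<bullet> b)"
    using le TB by (subst emeasure_lborel_box_eq) (auto simp: l' u')
  also have "(\<Prod>b\<in>Basis. (u' - l') \<bullet> b) = (\<Prod>b\<in>Basis. (u - l) \<bullet> T b)"
    by (rule prod.cong) (auto simp: inner_diff_left l' u')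
  also have "\<dots> = (\<Prod>b\<in>Basis. (u - l) \<bullet> b)"
    using bij by (rule prod.reindex_bij_betw)
  finally show "emeasure (distr lborel borel T) (box l u) = (\<Prod>b\<in>Basis. (u - l) \<bullet> b)" .
qed simp

lemma lborel_integral_Basis:
  fixes T :: "'a::euclidean_space \<Rightarrow> 'b::euclidean_space" and f :: "'b \<Rightarrow> real"
  assumes T: "linear T" and bij: "bij_betw T Basis Basis" and f: "f \<in> borel_measurable borel"
  shows "integrable lborel (\<lambda>x. f (T x)) \<longleftrightarrow> integrable lborel f"
    and "integral\<^sup>L lborel (\<lambda>x. f (T x)) = integral\<^sup>L lborel f"
proof -
  have meas: "T \<in> lborel \<rightarrow>\<^sub>M borel"
    using linear_borel_measurable[OF T] by simp
  show "integrable lborel (\<lambda>x. f (T x)) \<longleftrightarrow> integrable lborel f"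
    by (subst lborel_distr_Basis[OF T bij]) (rule integrable_distr_eq[OF meas f, symmetric])
  show "integral\<^sup>L lborel (\<lambda>x. f (T x)) = integral\<^sup>L lborel f"
    by (subst lborel_distr_Basis[OF T bij]) (rule integral_distr[OF meas f, symmetric])
qed

section \<open>Jacobians and change of variables\<close>

definition tvecs :: "('n param \<Rightarrow> 'n cvec) \<Rightarrow> 'n::{finite,linorder} cvec list"
  where "tvecs L = map (\<lambda>p. L (axis (Abs_tcoord p) 1)) (tl labels)"

lemma length_tvecs [simp]: "length (tvecs (L :: 'n param \<Rightarrow> 'n::{finite,linorder} cvec)) = 2 * CARD('n) - 1"
  by (simp add: tvecs_def length_labels)

lemma tangents_eq: "tangents \<phi> u = tvecs (frechet_derivative \<phi> (at u))"
  by (simp add: tangents_def tvecs_def)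

lemma nth_Cons_tvecs:
  "(v # tvecs L) ! pos i = (if i = 0 then v else L (axis (Abs_tcoord (lab i)) 1))"
  unfolding tvecs_def by (rule nth_Cons_labels)

text \<open>Up to the identifications \<open>coord\<close> and \<open>unjoin\<close> this is the
  determinant of \<open>L\<close>. Phrasing it through \<open>vol_form\<close> makes the Jacobian of
  a tube the very expression that fixes the orientation in \<open>oriented_chart\<close>.\<close>

definition jac :: "('n param \<times> real \<Rightarrow> 'n::{finite,linorder} cvec) \<Rightarrow> real"
  where "jac L = vol_form (L (0, 1) # tvecs (\<lambda>h. L (h, 0)))"

lemma jac_eq_det:
  fixes L :: "'n::{finite,linorder} param \<times> real \<Rightarrow> 'n cvec"
  shows "jac L = det (matrix (\<lambda>x. coord (L (unjoin x))))"
proof -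
  have "(L (0, 1) # tvecs (\<lambda>h. L (h, 0 :: real))) ! pos j = L (unjoin (axis j 1))" for j :: "'n bit0"
    by (simp add: nth_Cons_tvecs unjoin_axis)
  then show ?thesis
    unfolding jac_def vol_form_eq_det matrix_def by (simp add: coord_def)
qed

lemma continuous_on_vol_form:
  fixes ws :: "'a::topological_space \<Rightarrow> 'n::{finite,linorder} cvec list"
  assumes "\<And>j :: 'n bit0. continuous_on S (\<lambda>x. ws x ! pos j)"
  shows "continuous_on S (\<lambda>x. vol_form (ws x))"
proof -
  have *: "continuous_on S (\<lambda>x. dx_covector p (ws x ! pos j))" for p and j :: "'n bit0"
    by (rule continuous_on_compose2[OF linear_continuous_on[OF linear_conv_bounded_linear[THEN iffD1]] assms])
      (auto intro: linear_dx_covector)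
  then show ?thesis
    unfolding vol_form_eq_det det_def by (simp add: continuous_intros *)
qed

text \<open>Continuity of the derivative is required in each direction separately, which in finite
  dimension is continuity in operator norm. The derivative is an explicit argument because formulas
  for it are computed and then integrated.\<close>

definition C1_on :: "('a::euclidean_space \<Rightarrow> 'b::euclidean_space) \<Rightarrow> ('a \<Rightarrow> 'a \<Rightarrow> 'b) \<Rightarrow> 'a set \<Rightarrow> bool"
  where "C1_on f f' S \<longleftrightarrow> (\<forall>x\<in>S. (f has_derivative f' x) (at x)) \<and> (\<forall>v. continuous_on S (\<lambda>x. f' x v))"

lemma C1_onD: "C1_on f f' S \<Longrightarrow> x \<in> S \<Longrightarrow> (f has_derivative f' x) (at x)"
  and C1_on_cont: "C1_on f f' S \<Longrightarrow> continuous_on S (\<lambda>x. f' x v)"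
  by (auto simp: C1_on_def)

lemma C1_on_subset: "C1_on f f' S \<Longrightarrow> T \<subseteq> S \<Longrightarrow> C1_on f f' T"
  by (auto simp: C1_on_def intro: continuous_on_subset)

lemma C1_on_continuous: "C1_on f f' S \<Longrightarrow> continuous_on S f"
  by (meson C1_onD continuous_at_imp_continuous_on has_derivative_continuous)

lemma C1_on_linear: "C1_on f f' S \<Longrightarrow> x \<in> S \<Longrightarrow> linear (f' x)"
  by (meson C1_onD has_derivative_linear)

lemma C1_on_congD: "C1_on f f' S \<Longrightarrow> (\<And>x. x \<in> S \<Longrightarrow> f' x = g' x) \<Longrightarrow> C1_on f g' S"
  unfolding C1_on_def by (metis (no_types, lifting) continuous_on_cong)

lemma Ck_on_1_iff: "Ck_on 1 f S \<longleftrightarrow> C1_on f (\<lambda>x. frechet_derivative f (at x)) S"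
  by (simp add: C1_on_def frechet_derivative_works)

lemma C1_on_imp_Ck:
  assumes "C1_on f f' S" shows "Ck_on 1 f S"
proof -
  have eq: "frechet_derivative f (at x) = f' x" if "x \<in> S" for x
    by (metis C1_onD[OF assms that] frechet_derivative_at)
  have "C1_on f (\<lambda>x. frechet_derivative f (at x)) S"
    by (rule C1_on_congD[OF assms]) (simp add: eq)
  then show ?thesis by (simp only: Ck_on_1_iff)
qed

lemma continuous_on_vol_form_tvecs:
  assumes "C1_on \<phi> \<phi>' S"
  shows "continuous_on S (\<lambda>u. vol_form (v # tvecs (\<phi>' u)))"
proof (rule continuous_on_vol_form)
  fix j :: "'a bit0"
  show "continuous_on S (\<lambda>u. (v # tvecs (\<phi>' u)) ! pos j)"
    by (cases "j = 0") (simp_all add: nth_Cons_tvecs C1_on_cont[OF assms])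
qed

text \<open>The change of variables theorem on \<open>real ^ 'n bit0\<close> is transported through
  \<open>unjoin\<close> in the source and \<open>uncoord\<close> in the target, both of which
  preserve Lebesgue measure.\<close>

lemma change_of_variables_cvec:
  fixes \<Phi> :: "'n::{finite,linorder} param \<times> real \<Rightarrow> 'n cvec" and f :: "'n cvec \<Rightarrow> real"
  assumes S: "open S" and \<Phi>: "C1_on \<Phi> \<Phi>' S" and inj: "inj_on \<Phi> S"
    and f: "set_integrable lborel (\<Phi> ` S) f"
  shows "set_integrable lborel S (\<lambda>z. \<bar>jac (\<Phi>' z)\<bar> * f (\<Phi> z))" (is ?A)
    and "(LINT z:S|lborel. \<bar>jac (\<Phi>' z)\<bar> * f (\<Phi> z)) = (LINT y:\<Phi> ` S|lborel. f y)" (is ?B)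
proof -
  define F where "F y = indicator (\<Phi> ` S) y * f y" for y
  have F: "integrable lborel F" and Fm: "F \<in> borel_measurable borel"
    using f borel_measurable_integrable[of lborel F]
    by (simp_all add: set_integrable_def F_def[abs_def])
  define H where "H z = indicator S z * (\<bar>jac (\<Phi>' z)\<bar> * f (\<Phi> z))" for z
  \<comment> \<open>Nothing is known about \<Phi> outside \<open>S\<close>. Replacing it by 0 there
    exhibits \<open>H\<close> as a product of Borel functions, and Borel measurability permits the
    return from the completed measure to \<open>lborel\<close>.\<close>
  have Seq: "H z = (indicator S z *\<^sub>R \<bar>jac (\<Phi>' z)\<bar>) * F (if z \<in> S then \<Phi> z else 0)" for z
    by (simp add: H_def F_def indicator_def)
  have "continuous_on S (\<lambda>z. jac (\<Phi>' z))"
    unfolding jac_def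
  proof (rule continuous_on_vol_form)
    fix j :: "'n bit0"
    show "continuous_on S (\<lambda>z. (\<Phi>' z (0, 1) # tvecs (\<lambda>h. \<Phi>' z (h, 0))) ! pos j)"
      by (cases "j = 0") (simp_all add: nth_Cons_tvecs C1_on_cont[OF \<Phi>])
  qed
  then have "(\<lambda>z. indicator S z *\<^sub>R \<bar>jac (\<Phi>' z)\<bar>) \<in> borel_measurable borel"
    using S by (intro borel_measurable_continuous_on_indicator continuous_intros) auto
  moreover have "(\<lambda>z. if z \<in> S then \<Phi> z else 0) \<in> borel_measurable borel"
    using S C1_on_continuous[OF \<Phi>] by (intro borel_measurable_continuous_on_if continuous_intros) auto
  ultimately have Hm: "H \<in> borel_measurable borel"
    unfolding Seq using Fm by (intro borel_measurable_times measurable_compose[OF _ Fm]) auto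
  define G where "G x = coord (\<Phi> (unjoin x))" for x
  define G' where "G' x = (\<lambda>h. coord (\<Phi>' (unjoin x) (unjoin h)))" for x
  define T where "T = unjoin -` S"
  define h :: "real ^ 'n bit0 \<Rightarrow> real ^ 1" where "h y = vec (f (uncoord y))" for y
  have bl: "bounded_linear coord" "bounded_linear unjoin"
    using linear_coord linear_unjoin by (simp_all add: linear_conv_bounded_linear)
  have "open T"
    unfolding T_def by (rule open_vimage[OF S linear_continuous_on[OF bl(2)]])
  have der: "(G has_derivative G' x) (at x within T)" if "x \<in> T" for x
  proof -
    have 1: "(\<Phi> has_derivative \<Phi>' (unjoin x)) (at (unjoin x))"
      using C1_onD[OF \<Phi>] that by (simp add: T_def)
    have 2: "(unjoin has_derivative unjoin) (at x)"
      by (rule bounded_linear_imp_has_derivative) (rule bl)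
    have 3: "((\<lambda>x. \<Phi> (unjoin x)) has_derivative (\<lambda>h. \<Phi>' (unjoin x) (unjoin h))) (at x)"
      using has_derivative_compose[OF 2 1] .
    have "(G has_derivative G' x) (at x)"
      unfolding G_def[abs_def] G'_def
      by (rule bounded_linear.has_derivative[OF bl(1) 3])
    then show ?thesis by (rule has_derivative_at_withinI)
  qed
  have injG: "inj_on G T"
    using inj unfolding inj_on_def G_def T_def by (metis join_unjoin uncoord_coord vimageE)
  have GT: "x \<in> G ` T \<longleftrightarrow> uncoord x \<in> \<Phi> ` S" for x
    unfolding G_def T_def image_iff by (metis coord_uncoord unjoin_join uncoord_coord vimage_eq)
  have T_leb: "T \<in> sets lebesgue"
    using \<open>open T\<close> by auto
  note cov = has_absolute_integral_change_of_variables[OF T_leb der injG, of h]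
  have Gdet: "\<bar>det (matrix (G' x))\<bar> = \<bar>jac (\<Phi>' (unjoin x))\<bar>" for x
    by (simp add: jac_eq_det G'_def)
  have fh: "(\<lambda>x. \<bar>det (matrix (G' x))\<bar> *\<^sub>R h (G x)) = (\<lambda>x. vec (\<bar>jac (\<Phi>' (unjoin x))\<bar> * f (\<Phi> (unjoin x))))"
    by (auto simp: vec_eq_iff h_def Gdet G_def)
  have uncF: "(\<lambda>y. F (uncoord y)) \<in> borel_measurable borel" and unjH: "(\<lambda>x. H (unjoin x)) \<in> borel_measurable borel"
    using Fm Hm linear_borel_measurable[OF linear_uncoord] linear_borel_measurable[OF linear_unjoin]
    by (auto intro: measurable_compose)
  note intF = lborel_integral_Basis[OF linear_uncoord bij_betw_Basis_uncoord Fm]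
  note intH = lborel_integral_Basis[OF linear_unjoin bij_betw_Basis_unjoin Hm]
  have h1: "(\<lambda>y. h y $ 1) = (\<lambda>y. f (uncoord y))" by (simp add: h_def)
  have eqF: "(\<lambda>y. indicator (G ` T) y *\<^sub>R f (uncoord y)) = (\<lambda>y. F (uncoord y))"
    by (auto simp: F_def GT indicator_def)
  have eqH: "(\<lambda>x. indicator T x *\<^sub>R (\<bar>jac (\<Phi>' (unjoin x))\<bar> * f (\<Phi> (unjoin x)))) = (\<lambda>x. H (unjoin x))"
    by (auto simp: H_def T_def indicator_def)
  have absF: "(\<lambda>y. f (uncoord y)) absolutely_integrable_on (G ` T)"
    unfolding set_integrable_def eqF using intF F uncF by (subst integrable_completion) auto
  have LF: "integral (G ` T) (\<lambda>y. f (uncoord y)) = integral\<^sup>L lborel F"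
    unfolding set_lebesgue_integral_eq_integral(2)[OF absF, symmetric] set_lebesgue_integral_def eqF
    using intF uncF by (subst integral_completion) auto
  from absF have "h absolutely_integrable_on (G ` T)"
    unfolding absolutely_integrable_on_1_iff h1 .
  moreover have "integral (G ` T) h = vec (integral\<^sup>L lborel F)"
    unfolding integral_on_1_eq h1 LF ..
  ultimately have "(\<lambda>x. vec (\<bar>jac (\<Phi>' (unjoin x))\<bar> * f (\<Phi> (unjoin x))) :: real ^ 1) absolutely_integrable_on T"
      "integral T (\<lambda>x. vec (\<bar>jac (\<Phi>' (unjoin x))\<bar> * f (\<Phi> (unjoin x))) :: real ^ 1) = vec (integral\<^sup>L lborel F)"
    using cov[of "vec (integral\<^sup>L lborel F)"] unfolding fh by auto
  then have absH: "(\<lambda>x. \<bar>jac (\<Phi>' (unjoin x))\<bar> * f (\<Phi> (unjoin x))) absolutely_integrable_on T"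
    and LH: "integral T (\<lambda>x. \<bar>jac (\<Phi>' (unjoin x))\<bar> * f (\<Phi> (unjoin x))) = integral\<^sup>L lborel F"
    unfolding absolutely_integrable_on_1_iff integral_on_1_eq by (auto simp: vec_eq_iff)
  have iH: "integrable lborel H"
    using absH unfolding set_integrable_def eqH using intH unjH by (subst (asm) integrable_completion) auto
  then show ?A by (simp add: set_integrable_def H_def[abs_def])
  have "integral\<^sup>L lborel H = integral\<^sup>L lborel F"
    using LH unfolding set_lebesgue_integral_eq_integral(2)[OF absH, symmetric] set_lebesgue_integral_def eqH
    using intH unjH by (subst (asm) integral_completion) auto
  then show ?B by (simp add: set_lebesgue_integral_def H_def[abs_def] F_def[abs_def])
qed

section \<open>Tubes: displacing a chart along a constant vector\<close>

lemma has_real_derivative_line: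
  fixes f :: "'a::real_normed_vector \<Rightarrow> real"
  assumes "(f has_derivative f') (at (q + t *\<^sub>R \<nu>))"
  shows "((\<lambda>t. f (q + t *\<^sub>R \<nu>)) has_real_derivative f' \<nu>) (at t)"
proof -
  have "((\<lambda>t. q + t *\<^sub>R \<nu>) has_derivative (\<lambda>s. s *\<^sub>R \<nu>)) (at t)"
    by (auto intro!: derivative_eq_intros)
  from has_derivative_compose[OF this assms] show ?thesis
    unfolding has_field_derivative_def
    by (simp add: linear_scale[OF has_derivative_linear[OF assms]] mult_commute_abs)
qed

lemma C1_on_tube:
  assumes \<phi>: "C1_on \<phi> \<phi>' B"
  shows "C1_on (\<lambda>(u, t). \<phi> u + t *\<^sub>R \<nu>) (\<lambda>z (h, s). \<phi>' (fst z) h + s *\<^sub>R \<nu>) (B \<times> (UNIV :: real set))"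
  unfolding C1_on_def
proof (intro conjI allI ballI)
  fix z :: "'a \<times> real" assume z: "z \<in> B \<times> UNIV"
  have 1: "(\<phi> has_derivative \<phi>' (fst z)) (at (fst z))"
    using z C1_onD[OF \<phi>] by auto
  have "((\<lambda>z. \<phi> (fst z)) has_derivative (\<lambda>h. \<phi>' (fst z) (fst h))) (at z)"
    using has_derivative_compose[OF has_derivative_fst[OF has_derivative_ident] 1] .
  then show "((\<lambda>(u, t). \<phi> u + t *\<^sub>R \<nu>) has_derivative (\<lambda>(h, s). \<phi>' (fst z) h + s *\<^sub>R \<nu>)) (at z)"
    unfolding case_prod_beta by (auto intro!: derivative_eq_intros)
next
  fix v :: "'a \<times> real"
  have "continuous_on (B \<times> UNIV) (\<lambda>z :: 'a \<times> real. \<phi>' (fst z) (fst v))"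
    by (rule continuous_on_compose2[OF C1_on_cont[OF \<phi>] continuous_on_fst[OF continuous_on_id]]) auto
  then show "continuous_on (B \<times> UNIV) (\<lambda>z :: 'a \<times> real. (\<lambda>(h, s). \<phi>' (fst z) h + s *\<^sub>R \<nu>) v)"
    unfolding case_prod_beta by (intro continuous_intros)
qed

text \<open>Invariance of domain: the chart has 2n - 1 parameters and t supplies one more, so source
  and target have equal dimension.\<close>

lemma open_tube_image:
  fixes \<phi> :: "'n::{finite,linorder} param \<Rightarrow> 'n cvec"
  assumes "C1_on \<phi> \<phi>' B" "open B" "inj_on (\<lambda>(u, t). \<phi> u + t *\<^sub>R \<nu>) (B \<times> {a<..<c})"
  shows "open ((\<lambda>(u, t). \<phi> u + t *\<^sub>R \<nu>) ` (B \<times> {a<..<c}))"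
proof (rule invariance_of_domain_gen[OF _ _ assms(3)])
  show "open (B \<times> {a<..<c})" using assms(2) by (intro open_Times) auto
  show "continuous_on (B \<times> {a<..<c}) (\<lambda>(u, t). \<phi> u + t *\<^sub>R \<nu>)"
    by (rule continuous_on_subset[OF C1_on_continuous[OF C1_on_tube[OF assms(1)]]]) auto
  show "DIM('n cvec) \<le> DIM('n param \<times> real)" by (simp add: card_tcoord)
qed

text \<open>Injectivity is asked on the open tube, differentiability of \<open>f\<close> on the
  closed segments, so a tube may end exactly on the boundary of the domain. Fubini reduces the
  volume integral to the segments, of which only the end values survive.\<close>

lemma tube_integral:
  fixes \<phi> :: "'n::{finite,linorder} param \<Rightarrow> 'n cvec" and f :: "'n cvec \<Rightarrow> real"
  assumes B: "open B" and \<phi>: "C1_on \<phi> \<phi>' B" and ac: "a < c"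
    and inj: "inj_on (\<lambda>(u, t). \<phi> u + t *\<^sub>R \<nu>) (B \<times> {a<..<c})"
    and f: "\<And>u t. u \<in> B \<Longrightarrow> t \<in> {a..c} \<Longrightarrow> (f has_derivative f' (\<phi> u + t *\<^sub>R \<nu>)) (at (\<phi> u + t *\<^sub>R \<nu>))"
    and cf: "\<And>u. u \<in> B \<Longrightarrow> continuous_on {a..c} (\<lambda>t. f' (\<phi> u + t *\<^sub>R \<nu>) \<nu>)"
    and int: "set_integrable lborel ((\<lambda>(u, t). \<phi> u + t *\<^sub>R \<nu>) ` (B \<times> {a<..<c})) (\<lambda>x. f' x \<nu>)"
    and J: "\<And>u. u \<in> B \<Longrightarrow> vol_form (\<nu> # tvecs (\<phi>' u)) \<ge> 0"
  shows "(LINT x:(\<lambda>(u, t). \<phi> u + t *\<^sub>R \<nu>) ` (B \<times> {a<..<c})|lborel. f' x \<nu>) =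
    (LINT u:B|lborel. (f (\<phi> u + c *\<^sub>R \<nu>) - f (\<phi> u + a *\<^sub>R \<nu>)) * vol_form (\<nu> # tvecs (\<phi>' u)))"
proof -
  define \<Phi> where "\<Phi> = (\<lambda>(u, t). \<phi> u + t *\<^sub>R \<nu>)"
  define \<Phi>' where "\<Phi>' z = (\<lambda>(h, s). \<phi>' (fst z) h + s *\<^sub>R \<nu>)" for z :: "'n param \<times> real"
  define S where "S = B \<times> {a<..<c}"
  have S: "open S" unfolding S_def using B by (intro open_Times) auto
  have C1: "C1_on \<Phi> \<Phi>' S"
    using C1_on_subset[OF C1_on_tube[OF \<phi>, of \<nu>], of S] unfolding \<Phi>_def \<Phi>'_def S_def by auto
  have jac: "jac (\<Phi>' z) = vol_form (\<nu> # tvecs (\<phi>' (fst z)))" if "z \<in> S" for z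
  proof -
    have "linear (\<phi>' (fst z))" using that C1_on_linear[OF \<phi>] by (auto simp: S_def)
    then show ?thesis by (simp add: jac_def \<Phi>'_def linear_0)
  qed
  define K where "K z = indicator S z * (vol_form (\<nu> # tvecs (\<phi>' (fst z))) * f' (\<Phi> z) \<nu>)" for z
  have eqK: "indicator S z *\<^sub>R (\<bar>jac (\<Phi>' z)\<bar> * f' (\<Phi> z) \<nu>) = K z" for z
    using J[of "fst z"] jac[of z] by (cases "z \<in> S") (auto simp: K_def S_def)
  have inj': "inj_on \<Phi> S" and int': "set_integrable lborel (\<Phi> ` S) (\<lambda>x. f' x \<nu>)"
    using inj int by (simp_all add: \<Phi>_def S_def)
  note cov = change_of_variables_cvec[OF S C1 inj' int']
  have intK: "integrable (lborel \<Otimes>\<^sub>M lborel) K"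
    using cov(1) unfolding set_integrable_def eqK lborel_prod .
  have "(LINT x:\<Phi> ` S|lborel. f' x \<nu>) = (LINT z:S|lborel. \<bar>jac (\<Phi>' z)\<bar> * f' (\<Phi> z) \<nu>)"
    by (rule cov(2)[symmetric])
  also have "\<dots> = integral\<^sup>L (lborel \<Otimes>\<^sub>M lborel) K"
    unfolding set_lebesgue_integral_def eqK lborel_prod ..
  also have "\<dots> = (\<integral>u. (\<integral>t. K (u, t) \<partial>lborel) \<partial>lborel)"
    by (rule lborel_pair.integral_fst'[OF intK, symmetric])
  also have "\<dots> = (\<integral>u. indicator B u *\<^sub>R ((f (\<phi> u + c *\<^sub>R \<nu>) - f (\<phi> u + a *\<^sub>R \<nu>)) * vol_form (\<nu> # tvecs (\<phi>' u))) \<partial>lborel)"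
  proof (rule Bochner_Integration.integral_cong[OF refl])
    fix u :: "'n param"
    show "(\<integral>t. K (u, t) \<partial>lborel) =
      indicator B u *\<^sub>R ((f (\<phi> u + c *\<^sub>R \<nu>) - f (\<phi> u + a *\<^sub>R \<nu>)) * vol_form (\<nu> # tvecs (\<phi>' u)))"
    proof (cases "u \<in> B")
      case True
      let ?J = "vol_form (\<nu> # tvecs (\<phi>' u))"
      have "(\<integral>t. K (u, t) \<partial>lborel) = (\<integral>t. ?J * (indicator {a..c} t *\<^sub>R f' (\<phi> u + t *\<^sub>R \<nu>) \<nu>) \<partial>lborel)"
      \<comment> \<open>Passing from the open to the closed interval changes the integrand at most
        at the two endpoints.\<close>
      proof (rule integral_cong_AE)
        show "(\<lambda>t. K (u, t)) \<in> borel_measurable lborel"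
          using intK by (intro measurable_Pair2[of K lborel lborel]) auto
        show "(\<lambda>t. ?J * (indicator {a..c} t *\<^sub>R f' (\<phi> u + t *\<^sub>R \<nu>) \<nu>)) \<in> borel_measurable lborel"
          using borel_measurable_continuous_on_indicator[OF _ cf[OF True]] by auto
        have "AE t in lborel. t \<noteq> a" "AE t in lborel. t \<noteq> c"
          by (auto intro: AE_lborel_singleton)
        then show "AE t in lborel. K (u, t) = ?J * (indicator {a..c} t *\<^sub>R f' (\<phi> u + t *\<^sub>R \<nu>) \<nu>)"
          by eventually_elim (auto simp: K_def S_def True \<Phi>_def indicator_def)
      qed
      also have "\<dots> = ?J * (\<integral>t. indicator {a..c} t *\<^sub>R f' (\<phi> u + t *\<^sub>R \<nu>) \<nu> \<partial>lborel)"
        by simp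
      also have "(\<integral>t. indicator {a..c} t *\<^sub>R f' (\<phi> u + t *\<^sub>R \<nu>) \<nu> \<partial>lborel) =
          f (\<phi> u + c *\<^sub>R \<nu>) - f (\<phi> u + a *\<^sub>R \<nu>)"
      proof (rule integral_FTC_atLeastAtMost[where F = "\<lambda>t. f (\<phi> u + t *\<^sub>R \<nu>)"])
        fix t assume t: "a \<le> t" "t \<le> c"
        have fd: "(f has_derivative f' (\<phi> u + t *\<^sub>R \<nu>)) (at (\<phi> u + t *\<^sub>R \<nu>))"
          using f[OF True] t by auto
        from has_real_derivative_line[OF fd]
        show "((\<lambda>t. f (\<phi> u + t *\<^sub>R \<nu>)) has_vector_derivative f' (\<phi> u + t *\<^sub>R \<nu>) \<nu>) (at t within {a..c})"
          unfolding has_real_derivative_iff_has_vector_derivative[symmetric]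
          by (rule has_field_derivative_at_within)
      qed (use ac cf[OF True] in auto)
      finally show ?thesis using True by (simp add: mult.commute)
    next
      case False
      then show ?thesis by (simp add: K_def S_def)
    qed
  qed
  finally show ?thesis
    by (simp add: set_lebesgue_integral_def \<Phi>_def S_def)
qed

text \<open>Continuity in each direction gives continuity in operator norm by checking a basis; the
  inverse function theorem is applied in the latter form.\<close>

lemma C1_on_blinfun:
  assumes "C1_on f f' S"
  shows "x \<in> S \<Longrightarrow> blinfun_apply (Blinfun (f' x)) = f' x"
    and "continuous_on S (\<lambda>x. Blinfun (f' x))"
proof -
  have *: "blinfun_apply (Blinfun (f' x)) = f' x" if "x \<in> S" for x
    using that C1_onD[OF assms] by (intro bounded_linear_Blinfun_apply) (auto dest: has_derivative_bounded_linear)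
  then show "x \<in> S \<Longrightarrow> blinfun_apply (Blinfun (f' x)) = f' x" .
  show "continuous_on S (\<lambda>x. Blinfun (f' x))"
    using C1_on_cont[OF assms]
    by (intro continuous_on_blinfun_componentwise) (simp add: * cong: continuous_on_cong)
qed

lemma C1_on_linear_compose:
  assumes "C1_on f f' S" and "linear L"
  shows "C1_on (\<lambda>x. L (f x)) (\<lambda>x h. L (f' x h)) S"
proof -
  have bl: "bounded_linear L" using assms(2) by (simp add: linear_conv_bounded_linear)
  show ?thesis
    unfolding C1_on_def
    using C1_onD[OF assms(1)] C1_on_cont[OF assms(1)] bl
    by (auto intro: bounded_linear.has_derivative bounded_linear.continuous_on)
qed

text \<open>Composing with the left inverse \<open>L\<close> turns \<open>f\<close> into a self-map
  of \<open>'a\<close> whose derivative at \<open>x0\<close> is the identity. Local injectivity of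
  the composition passes to \<open>f\<close>.\<close>

lemma C1_on_local_inj:
  fixes f :: "'a::euclidean_space \<Rightarrow> 'b::euclidean_space"
  assumes "open U" and f: "C1_on f f' U" and "x0 \<in> U" and L: "linear L" "\<And>h. L (f' x0 h) = h"
  obtains N where "open N" "x0 \<in> N" "N \<subseteq> U" "inj_on f N"
proof -
  note F = C1_on_linear_compose[OF f L(1)]
  define G where "G x = Blinfun (\<lambda>h. L (f' x h))" for x
  have G: "blinfun_apply (G x) = (\<lambda>h. L (f' x h))" if "x \<in> U" for x
    unfolding G_def by (rule C1_on_blinfun(1)[OF F that])
  have "id_blinfun o\<^sub>L G x0 = id_blinfun"
    by (rule blinfun_eqI) (simp add: G[OF \<open>x0 \<in> U\<close>] L(2))
  moreover have "continuous_on U G"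
    unfolding G_def by (rule C1_on_blinfun(2)[OF F])
  moreover have "((\<lambda>x. L (f x)) has_derivative blinfun_apply (G x)) (at x)" if "x \<in> U" for x
    unfolding G[OF that] by (rule C1_onD[OF F that])
  ultimately obtain N V g where N: "open N" "N \<subseteq> U" "x0 \<in> N" "homeomorphism N V (\<lambda>x. L (f x)) g"
    using inverse_function_theorem[OF \<open>open U\<close>, of "\<lambda>x. L (f x)" G x0 id_blinfun] \<open>x0 \<in> U\<close> by metis
  have "inj_on f N"
    using N(4) unfolding homeomorphism_def inj_on_def by metis
  with N show ?thesis using that by blast
qed

section \<open>Frames and charts\<close>

lemma linear_vol_form:
  fixes ws :: "'n::{finite,linorder} cvec list"
  assumes "length ws = 2 * CARD('n) - 1"
  shows "linear (\<lambda>v. vol_form (v # ws))"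
  unfolding vol_form_def wedge_labels_expand[OF assms]
  by (rule linearI) (simp_all add: linear_add[OF linear_dx_covector] linear_scale[OF linear_dx_covector]
      algebra_simps sum.distrib sum_distrib_left)

lemma linear_vol_form_tvecs: "linear (\<lambda>v. vol_form (v # tvecs L))"
  by (rule linear_vol_form) simp

text \<open>A tangent vector is a combination of columns that already occur. Hence, with the
  tangents fixed, the volume form measures only the transversal part of its first argument.\<close>

lemma vol_form_tangent:
  fixes L :: "'n::{finite,linorder} param \<Rightarrow> 'n cvec"
  assumes L: "linear L"
  shows "vol_form (L h # tvecs L) = 0"
proof -
  have ax: "vol_form (L (axis q 1) # tvecs L) = 0" for q
  proof -
    define i where "i = unlab (Rep_tcoord q)"
    have i: "i \<noteq> 0" "Abs_tcoord (lab i) = q" by (simp_all add: i_def Rep_tcoord_inverse)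
    show ?thesis
      unfolding vol_form_eq_det
      by (rule Determinants.det_identical_columns[of 0 i]) (use i in \<open>auto simp: column_def nth_Cons_tvecs\<close>)
  qed
  have "h = (\<Sum>q\<in>UNIV. h $ q *\<^sub>R axis q 1)"
    by (simp add: vec_eq_iff axis_def if_distrib cong: if_cong)
  then have "L h = (\<Sum>q\<in>UNIV. h $ q *\<^sub>R L (axis q 1))"
    by (metis (no_types, lifting) L linear_scale linear_sum sum.cong)
  then show ?thesis
    by (simp add: linear_sum[OF linear_vol_form_tvecs] linear_scale[OF linear_vol_form_tvecs] ax)
qed

lemma jac_nz_inverse:
  fixes L :: "'n::{finite,linorder} param \<times> real \<Rightarrow> 'n cvec"
  assumes L: "linear L" and nz: "jac L \<noteq> 0"
  obtains K where "linear K" "\<And>z. K (L z) = z" "\<And>w. L (K w) = w"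
proof -
  define M where "M x = coord (L (unjoin x))" for x
  have M: "linear M"
    unfolding M_def using linear_compose[OF linear_compose[OF linear_unjoin L] linear_coord] by (simp add: o_def)
  have "inj M"
    using nz det_nz_iff_inj[OF M] by (simp add: jac_eq_det M_def[abs_def])
  then obtain M' where M': "linear M'" "\<And>x. M' (M x) = x" "\<And>x. M (M' x) = x"
    using linear_injective_isomorphism[OF M] by auto
  show ?thesis
  proof
    show "linear (\<lambda>w. unjoin (M' (coord w)))"
      using linear_compose[OF linear_compose[OF linear_coord M'(1)] linear_unjoin] by (simp add: o_def)
    show "unjoin (M' (coord (L z))) = z" for z
      using M'(2)[of "join z"] by (simp add: M_def)
    show "L (unjoin (M' (coord w))) = w" for w
    proof -
      have "coord (L (unjoin (M' (coord w)))) = coord w"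
        using M'(3)[of "coord w"] by (simp add: M_def)
      then show ?thesis by (metis uncoord_coord)
    qed
  qed
qed

lemma linear_tube: "linear T \<Longrightarrow> linear (\<lambda>(h, s). T h + s *\<^sub>R \<nu>)"
  by (rule linearI) (auto simp: linear_add linear_scale algebra_simps)

lemma jac_tube: "linear T \<Longrightarrow> jac (\<lambda>(h, s). T h + s *\<^sub>R \<nu>) = vol_form (\<nu> # tvecs T)"
  by (simp add: jac_def linear_0)

text \<open>A rotation taking axis 0 to the direction of \<open>e\<close> has determinant 1; its
  other columns define \<open>T\<close>, and rescaling the first column to \<open>e\<close>
  multiplies the determinant by a positive length.\<close>

lemma frame_exists:
  fixes e :: "'n::{finite,linorder} cvec"
  assumes "e \<noteq> 0"
  obtains T where "linear T" "vol_form (e # tvecs T) > 0"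
proof -
  let ?k = "norm (coord e)"
  have "coord e \<noteq> 0"
    using assms by (metis linear_0 linear_uncoord uncoord_coord)
  then have k: "?k > 0" by simp
  then have "norm (coord e /\<^sub>R ?k) = 1" by simp
  \<comment> \<open>Rotations act transitively on unit vectors from dimension 2 on, and the
    dimension here is 2n.\<close>
  then obtain A :: "real ^ 'n bit0 ^ 'n bit0" where A: "rotation_matrix A" "A *v axis 0 1 = coord e /\<^sub>R ?k"
    by (rule rotation_matrix_exists_basis[rotated]) (auto simp: Suc_le_eq)
  define L where "L z = uncoord (A *v join z)" for z
  define T where "T h = L (h, 0)" for h
  have linL: "linear L"
    unfolding L_def using linear_compose[OF linear_compose[OF linear_join matrix_vector_mul_linear[of A]] linear_uncoord]
    by (simp add: o_def)
  have T: "linear T"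
    unfolding T_def using linear_compose[OF _ linL, of "\<lambda>h. (h, 0)"] by (simp add: o_def linear_iff)
  have "jac L = det A"
    by (simp add: jac_eq_det L_def)
  then have "jac L = 1" using A(1) by (simp add: rotation_matrix_def)
  moreover have "L (0, 1) = e /\<^sub>R ?k"
  proof -
    have "join (0, 1) = (axis 0 1 :: real ^ 'n bit0)"
      by (simp add: join_def vec_eq_iff axis_def)
    then show ?thesis by (simp add: L_def A(2) linear_scale[OF linear_uncoord])
  qed
  ultimately have "vol_form (e /\<^sub>R ?k # tvecs T) = 1"
    by (simp add: jac_def T_def[abs_def])
  then have "vol_form (e # tvecs T) = ?k"
    using k by (simp add: linear_scale[OF linear_vol_form_tvecs] field_simps)
  then show ?thesis using that T k by simp
qed

definition local_equation :: "'a::euclidean_space set \<Rightarrow> 'a set \<Rightarrow> ('a \<Rightarrow> real) \<Rightarrow> ('a \<Rightarrow> 'a \<Rightarrow> real) \<Rightarrow> bool"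
  where "local_equation D R r r' \<longleftrightarrow> open R \<and> C1_on r r' R \<and> (\<forall>q\<in>R. \<exists>v. r' q v \<noteq> 0) \<and>
    (\<forall>q\<in>R. (q \<in> D \<longleftrightarrow> r q < 0) \<and> (q \<in> frontier D \<longleftrightarrow> r q = 0))"

lemma smooth_boundaryD:
  assumes "smooth_boundary D" "p \<in> frontier D"
  obtains R r r' where "p \<in> R" "local_equation D R r r'"
proof -
  from bspec[OF assms(1)[unfolded smooth_boundary_def] assms(2)]
  obtain R and r :: "'a \<Rightarrow> real" where R: "open R" "p \<in> R" "\<forall>m. Ck_on m r R"
    "\<forall>q\<in>R. frechet_derivative r (at q) \<noteq> (\<lambda>v. 0)"
    "D \<inter> R = {q\<in>R. r q < 0}" "frontier D \<inter> R = {q\<in>R. r q = 0}"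
    by (elim exE conjE)
  then have "local_equation D R r (\<lambda>x. frechet_derivative r (at x))"
    unfolding local_equation_def
  proof (intro conjI ballI)
    show "C1_on r (\<lambda>x. frechet_derivative r (at x)) R"
      using R(3)[rule_format, of 1] by (simp only: Ck_on_1_iff)
    show "\<exists>v. frechet_derivative r (at q) v \<noteq> 0" if "q \<in> R" for q
      using R(4) that by (meson ext)
    show "q \<in> D \<longleftrightarrow> r q < 0" "q \<in> frontier D \<longleftrightarrow> r q = 0" if "q \<in> R" for q
      using R(5,6) that by auto
  qed (rule R(1))
  then show ?thesis using that R(2) by blast
qed

text \<open>\<open>r\<close> vanishes at \<open>q\<close> and has positive slope along
  \<open>\<nu>\<close>, so it changes sign there. Where it is positive, a point of \<open>R\<close>
  lies neither in \<open>D\<close> nor on the frontier, hence outside the closure.\<close>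

lemma outward_if_increasing:
  assumes eq: "local_equation D R r r'" and q: "q \<in> R" "q \<in> frontier D" and \<nu>: "r' q \<nu> > 0"
  shows "outward D q \<nu>"
proof -
  have R: "open R" "C1_on r r' R" and rD: "\<And>x. x \<in> R \<Longrightarrow> x \<in> D \<longleftrightarrow> r x < 0"
    "\<And>x. x \<in> R \<Longrightarrow> x \<in> frontier D \<longleftrightarrow> r x = 0"
    using eq by (auto simp: local_equation_def)
  have "(r has_derivative r' q) (at (q + 0 *\<^sub>R \<nu>))" using C1_onD[OF R(2) q(1)] by simp
  note dr = has_real_derivative_line[OF this]
  have r0: "r q = 0" using rD(2) q by blast
  obtain d1 where d1: "d1 > 0" "\<And>h. h > 0 \<Longrightarrow> h < d1 \<Longrightarrow> 0 < r (q + h *\<^sub>R \<nu>)"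
    using has_real_derivative_pos_inc_right[OF dr \<nu>] r0 by auto
  obtain d2 where d2: "d2 > 0" "\<And>h. h > 0 \<Longrightarrow> h < d2 \<Longrightarrow> r (q - h *\<^sub>R \<nu>) < 0"
    using has_real_derivative_pos_inc_left[OF dr \<nu>] r0 by auto
  have "open ((\<lambda>t. q + t *\<^sub>R \<nu>) -` R)"
    using R(1) by (intro open_vimage continuous_intros)
  moreover have "0 \<in> (\<lambda>t. q + t *\<^sub>R \<nu>) -` R" using q(1) by simp
  ultimately obtain d3 where d3: "d3 > 0" "ball 0 d3 \<subseteq> (\<lambda>t. q + t *\<^sub>R \<nu>) -` R"
    by (meson open_contains_ball)
  show ?thesis
    unfolding outward_def
  proof (intro exI[of _ "min d1 (min d2 d3)"] conjI allI impI)
    fix t assume t: "0 < t \<and> t < min d1 (min d2 d3)"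
    have "t \<in> ball 0 d3" "- t \<in> ball 0 d3" using t by auto
    then have "q + t *\<^sub>R \<nu> \<in> R" "q + (- t) *\<^sub>R \<nu> \<in> R" using d3(2) by blast+
    then have tR: "q + t *\<^sub>R \<nu> \<in> R" "q - t *\<^sub>R \<nu> \<in> R" by simp_all
    show "q - t *\<^sub>R \<nu> \<in> D" using rD(1)[OF tR(2)] d2(2)[of t] t by simp
    have "r (q + t *\<^sub>R \<nu>) > 0" using d1(2)[of t] t by simp
    then have "q + t *\<^sub>R \<nu> \<notin> D" "q + t *\<^sub>R \<nu> \<notin> frontier D"
      using rD[OF tR(1)] by auto
    then show "q + t *\<^sub>R \<nu> \<notin> closure D"
      using interior_subset[of D] by (auto simp: frontier_def)
  qed (use d1(1) d2(1) d3(1) in simp)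
qed

lemma oriented_chartD:
  assumes "oriented_chart D U \<phi>"
  shows "open U" "C1_on \<phi> (\<lambda>u. frechet_derivative \<phi> (at u)) U" "inj_on \<phi> U"
    "\<And>u. u \<in> U \<Longrightarrow> \<phi> u \<in> frontier D"
    "\<And>u. u \<in> U \<Longrightarrow> \<exists>\<nu>. outward D (\<phi> u) \<nu> \<and> vol_form (\<nu> # tangents \<phi> u) > 0"
proof -
  show "open U" "C1_on \<phi> (\<lambda>u. frechet_derivative \<phi> (at u)) U"
     "\<And>u. u \<in> U \<Longrightarrow> \<exists>\<nu>. outward D (\<phi> u) \<nu> \<and> vol_form (\<nu> # tangents \<phi> u) > 0"
    using assms unfolding oriented_chart_def Ck_on_1_iff by auto
  obtain \<psi> where "homeomorphism U (\<phi> ` U) \<phi> \<psi>"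
    using assms unfolding oriented_chart_def by auto
  then show "inj_on \<phi> U"
    unfolding homeomorphism_def by (metis inj_on_inverseI)
  show "\<And>u. u \<in> U \<Longrightarrow> \<phi> u \<in> frontier D"
    using assms openin_imp_subset unfolding oriented_chart_def by blast
qed

text \<open>
  Both sides are linear functionals of \<open>\<nu>\<close> which vanish on the tangent space, so they are
  proportional; the outward vector fixes the sign.
\<close>
lemma normal_derivative_eq_vol_form:
  fixes D :: "'n::{finite,linorder} cvec set"
  assumes chart: "oriented_chart D U \<phi>" and u: "u \<in> U" "\<phi> u \<in> R" and eq: "local_equation D R r r'"
  obtains \<kappa> where "\<kappa> > 0" "\<And>\<nu>. r' (\<phi> u) \<nu> = \<kappa> * vol_form (\<nu> # tangents \<phi> u)"
proof -
  note ch = oriented_chartD[OF chart]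
  let ?L = "frechet_derivative \<phi> (at u)" and ?p = "\<phi> u"
  obtain \<nu> where \<nu>: "outward D ?p \<nu>" "vol_form (\<nu> # tangents \<phi> u) > 0"
    using ch(5)[OF u(1)] by blast
  have L: "linear ?L" by (rule C1_on_linear[OF ch(2) u(1)])
  have der\<phi>: "(\<phi> has_derivative ?L) (at u)" by (rule C1_onD[OF ch(2) u(1)])
  have R: "open R" "C1_on r r' R" using eq by (auto simp: local_equation_def)
  have derr: "(r has_derivative r' ?p) (at ?p)" by (rule C1_onD[OF R(2) u(2)])
  have lr: "linear (r' ?p)" using derr by (rule has_derivative_linear)
  have tang: "r' ?p (?L h) = 0" for h
  proof -
    have "((\<lambda>u. r (\<phi> u)) has_derivative (\<lambda>h. r' ?p (?L h))) (at u)"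
      by (rule has_derivative_compose[OF der\<phi> derr])
    \<comment> \<open>The chart stays on the boundary, where \<open>r\<close> is zero, so
      \<open>r\<close> composed with \<open>\<phi>\<close> is constant near
      \<open>u\<close>.\<close>
    moreover have "((\<lambda>u. r (\<phi> u)) has_derivative (\<lambda>h. 0)) (at u)"
    proof (rule has_derivative_transform_within_open[OF has_derivative_const[of 0]])
      show "open (U \<inter> \<phi> -` R)"
        using ch(1) R(1) C1_on_continuous[OF ch(2)] by (simp add: continuous_open_preimage)
      show "u \<in> U \<inter> \<phi> -` R" using u by simp
      show "0 = r (\<phi> x)" if "x \<in> U \<inter> \<phi> -` R" for x
        using that ch(4) eq by (auto simp: local_equation_def)
    qed
    ultimately have "(\<lambda>h. r' ?p (?L h)) = (\<lambda>h. 0)" by (rule has_derivative_unique)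
    then show ?thesis by meson
  qed
  have vtang: "vol_form (?L h # tangents \<phi> u) = 0" for h
    unfolding tangents_eq by (rule vol_form_tangent[OF L])
  have lv: "linear (\<lambda>v. vol_form (v # tangents \<phi> u))"
    unfolding tangents_eq by (rule linear_vol_form_tvecs)
  define A where "A = (\<lambda>(h, s). ?L h + s *\<^sub>R \<nu>)"
  obtain K where K: "\<And>w. A (K w) = w"
    using jac_nz_inverse[of A] linear_tube[OF L] jac_tube[OF L, of \<nu>] \<nu>(2)
    unfolding A_def tangents_eq by (metis less_irrefl)
  have decomp: "r' ?p w = snd (K w) * r' ?p \<nu>"
    "vol_form (w # tangents \<phi> u) = snd (K w) * vol_form (\<nu> # tangents \<phi> u)" for w
  proof -
    have w: "w = ?L (fst (K w)) + snd (K w) *\<^sub>R \<nu>"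
      using K[of w] by (simp add: A_def case_prod_beta)
    show "r' ?p w = snd (K w) * r' ?p \<nu>"
      by (subst w) (simp add: linear_add[OF lr] linear_scale[OF lr] tang)
    show "vol_form (w # tangents \<phi> u) = snd (K w) * vol_form (\<nu> # tangents \<phi> u)"
      by (subst w) (simp add: linear_add[OF lv] linear_scale[OF lv] vtang)
  qed
  have nz: "r' ?p \<nu> \<noteq> 0"
    using eq u(2) decomp(1) unfolding local_equation_def by (metis mult_zero_right)
  \<comment> \<open>Otherwise \<open>\<nu>\<close> and \<open>- \<nu>\<close> would both be outward,
    and small positive multiples of \<open>\<nu>\<close> would lead into \<open>D\<close> and out of
    its closure at once.\<close>
  have "\<not> r' ?p \<nu> < 0"
  proof
    assume "r' ?p \<nu> < 0"
    then have "outward D ?p (- \<nu>)"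
      using linear_neg[OF lr] by (intro outward_if_increasing[OF eq u(2) ch(4)[OF u(1)]]) simp
    then obtain d where d: "d > 0" "\<And>t. 0 < t \<Longrightarrow> t < d \<Longrightarrow> ?p + t *\<^sub>R \<nu> \<in> D"
      unfolding outward_def by auto
    obtain \<epsilon> where e: "\<epsilon> > 0" "\<And>t. 0 < t \<Longrightarrow> t < \<epsilon> \<Longrightarrow> ?p + t *\<^sub>R \<nu> \<notin> closure D"
      using \<nu>(1) unfolding outward_def by blast
    have "0 < min d \<epsilon> / 2" "min d \<epsilon> / 2 < d" "min d \<epsilon> / 2 < \<epsilon>" using d(1) e(1) by auto
    then show False using d(2) e(2) closure_subset by blast
  qed
  with nz have pos: "r' ?p \<nu> > 0" by simp
  show ?thesis
  proof
    show "r' ?p \<nu> / vol_form (\<nu> # tangents \<phi> u) > 0" using pos \<nu>(2) by simp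
    show "r' ?p w = r' ?p \<nu> / vol_form (\<nu> # tangents \<phi> u) * vol_form (w # tangents \<phi> u)" for w
      using \<nu>(2) by (simp add: decomp(1)[of w] decomp(2)[of w])
  qed
qed

section \<open>The divergence theorem\<close>

lemma set_integrable_C1_closure:
  fixes f :: "'a::euclidean_space \<Rightarrow> 'b::euclidean_space"
  assumes "bounded D" "closure D \<subseteq> V" "continuous_on V f" "A \<in> sets borel" "A \<subseteq> D"
  shows "set_integrable lborel A f"
proof -
  have "compact (closure D)" using assms(1) by simp
  then have "set_integrable lborel (closure D) f"
    unfolding set_integrable_def
    by (rule borel_integrable_compact) (rule continuous_on_subset[OF assms(3,2)])
  then show ?thesis
    by (rule set_integrable_subset) (use assms(4,5) closure_subset in auto)
qed

lemma derivative_zero_off_support: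
  assumes "C1_on f f' V" "open V" "closed K" "\<And>x. x \<in> V - K \<Longrightarrow> f x = 0" "x \<in> V - K"
  shows "f' x v = 0"
proof -
  have "(f has_derivative (\<lambda>h. 0)) (at x)"
    by (rule has_derivative_transform_within_open[OF has_derivative_const[of 0], of "V - K"])
      (use assms in auto)
  moreover have "(f has_derivative f' x) (at x)"
    using assms by (auto intro: C1_onD)
  ultimately have "f' x = (\<lambda>h. 0)" by (rule has_derivative_unique[rotated])
  then show ?thesis by simp
qed

text \<open>The component along \<open>e\<close> of the vector-valued area element, weighted by
  \<open>F\<close>. Fixing \<open>e\<close> splits the divergence theorem into one scalar identity
  per direction.\<close>

definition flux :: "'n param set \<Rightarrow> ('n param \<Rightarrow> 'n cvec) \<Rightarrow> 'n cvec \<Rightarrow> ('n::{finite,linorder} cvec \<Rightarrow> real) \<Rightarrow> real"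
  where "flux U \<phi> e F = (LINT u:U|lborel. F (\<phi> u) * vol_form (e # tangents \<phi> u))"

text \<open>The compact set \<open>K\<close> may cross the frontier of \<open>D\<close>, so
  \<open>f\<close> need not vanish on the boundary; it vanishes off \<open>K\<close> on a full
  neighbourhood \<open>V\<close> of the closure.\<close>

definition test_fun :: "'a::euclidean_space set \<Rightarrow> 'a set \<Rightarrow> ('a \<Rightarrow> real) \<Rightarrow> ('a \<Rightarrow> 'a \<Rightarrow> real) \<Rightarrow> bool"
  where "test_fun D W f f' \<longleftrightarrow> (\<exists>V K. open V \<and> closure D \<subseteq> V \<and> C1_on f f' V \<and> compact K \<and> K \<subseteq> W \<and>
    (\<forall>x\<in>V - K. f x = 0))"

lemma test_fun_mono: "test_fun D W f f' \<Longrightarrow> W \<subseteq> W' \<Longrightarrow> test_fun D W' f f'"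
  unfolding test_fun_def by blast

text \<open>The inverse of the chart is continuous, so the part of the boundary inside
  \<open>K\<close> pulls back to a compact subset of \<open>U\<close>, off which the integrand is
  zero. This controls charts that behave badly near the edge of \<open>U\<close>.\<close>

lemma flux_integrable:
  fixes D :: "'n::{finite,linorder} cvec set"
  assumes chart: "oriented_chart D U \<phi>" and "bounded D"
    and F: "continuous_on (frontier D) F" and K: "closed K" "K \<inter> frontier D \<subseteq> \<phi> ` U"
    and F0: "\<And>p. p \<in> frontier D - K \<Longrightarrow> F p = 0"
  shows "set_integrable lborel U (\<lambda>u. F (\<phi> u) * vol_form (e # tangents \<phi> u))"
proof -
  note ch = oriented_chartD[OF chart]
  obtain \<psi> where hom: "homeomorphism U (\<phi> ` U) \<phi> \<psi>"
    using chart unfolding oriented_chart_def by auto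
  define C where "C = \<psi> ` (K \<inter> frontier D)"
  have "compact (K \<inter> frontier D)"
    using K \<open>bounded D\<close> by (intro closed_Int_compact compact_frontier_bounded)
  moreover have "continuous_on (K \<inter> frontier D) \<psi>"
    by (rule continuous_on_subset[OF _ K(2)]) (use hom in \<open>simp add: homeomorphism_def\<close>)
  ultimately have "compact C" unfolding C_def by (rule compact_continuous_image[rotated])
  have CU: "C \<subseteq> U" using image_mono[OF K(2), of \<psi>] hom unfolding C_def homeomorphism_def by simp
  let ?f = "\<lambda>u. F (\<phi> u) * vol_form (e # tangents \<phi> u)"
  have "continuous_on C ?f"
  proof (intro continuous_on_mult)
    show "continuous_on C (\<lambda>u. F (\<phi> u))"
      by (rule continuous_on_compose2[OF F continuous_on_subset[OF C1_on_continuous[OF ch(2)] CU]])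
        (use ch(4) CU in auto)
    show "continuous_on C (\<lambda>u. vol_form (e # tangents \<phi> u))"
      unfolding tangents_eq
      by (rule continuous_on_subset[OF continuous_on_vol_form_tvecs[OF ch(2)] CU])
  qed
  then have "integrable lborel (\<lambda>u. indicator C u *\<^sub>R ?f u)"
    by (rule borel_integrable_compact[OF \<open>compact C\<close>])
  moreover have "indicator C u *\<^sub>R ?f u = indicator U u *\<^sub>R ?f u" for u
  proof (cases "u \<in> U - C")
    case True
    have "\<phi> u \<notin> K"
    proof
      assume "\<phi> u \<in> K"
      then have "\<psi> (\<phi> u) \<in> C" using True ch(4) by (auto simp: C_def)
      then show False using True hom by (auto simp: homeomorphism_def)
    qed
    then show ?thesis using True F0 ch(4) by simp
  qed (use CU in \<open>auto simp: indicator_def\<close>)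
  ultimately show ?thesis unfolding set_integrable_def by (simp only:)
qed

lemma flux_linear:
  fixes D :: "'n::{finite,linorder} cvec set"
  assumes "oriented_chart D U \<phi>" "bounded D" "continuous_on (frontier D) F" "closed K" "K \<inter> frontier D \<subseteq> \<phi> ` U"
    "\<And>p. p \<in> frontier D - K \<Longrightarrow> F p = 0"
  shows "flux U \<phi> (a + c *\<^sub>R b) F = flux U \<phi> a F + c * flux U \<phi> b F"
proof -
  note int = flux_integrable[OF assms]
  have "flux U \<phi> (a + c *\<^sub>R b) F = (LINT u:U|lborel. F (\<phi> u) * vol_form (a # tangents \<phi> u) +
      c * (F (\<phi> u) * vol_form (b # tangents \<phi> u)))"
    unfolding flux_def tangents_eq
    by (simp add: linear_add[OF linear_vol_form_tvecs] linear_scale[OF linear_vol_form_tvecs] algebra_simps)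
  also have "\<dots> = (LINT u:U|lborel. F (\<phi> u) * vol_form (a # tangents \<phi> u)) +
     (LINT u:U|lborel. c * (F (\<phi> u) * vol_form (b # tangents \<phi> u)))"
    by (rule set_integral_add(2)[OF int set_integrable_mult_right]) (use int in auto)
  finally show ?thesis by (simp add: flux_def)
qed

text \<open>Serves two situations: \<open>c = 0\<close>, when the tube crosses the boundary and
  \<open>D\<close> is its lower half, and \<open>c = \<delta>\<close>, when the tube lies inside
  \<open>D\<close>. The lower end never contributes, being off the support of
  \<open>f\<close>.\<close>

lemma tube_test_fun:
  fixes \<phi> :: "'n::{finite,linorder} param \<Rightarrow> 'n cvec" and \<nu> :: "'n cvec"
  defines "\<Phi> \<equiv> \<lambda>(u, t). \<phi> u + t *\<^sub>R \<nu>"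
  assumes D: "open D" "bounded D" and \<phi>: "C1_on \<phi> \<phi>' B" "open B" and c: "-\<delta> < c" "c \<le> \<delta>"
    and inj: "inj_on \<Phi> (B \<times> {-\<delta>..\<delta>})" and J: "\<And>u. u \<in> B \<Longrightarrow> vol_form (\<nu> # tvecs (\<phi>' u)) \<ge> 0"
    and cl: "\<And>u t. u \<in> B \<Longrightarrow> t \<in> {-\<delta>..c} \<Longrightarrow> \<phi> u + t *\<^sub>R \<nu> \<in> closure D"
    and DW: "D \<inter> \<Phi> ` (B \<times> {-\<delta><..<\<delta>}) = \<Phi> ` (B \<times> {-\<delta><..<c})"
    and tf: "test_fun D (\<Phi> ` (B \<times> {-\<delta><..<\<delta>})) f f'"
  shows "(LINT x:D|lborel. f' x \<nu>) = (LINT u:B|lborel. f (\<phi> u + c *\<^sub>R \<nu>) * vol_form (\<nu> # tvecs (\<phi>' u)))"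
    and "c = \<delta> \<Longrightarrow> u \<in> B \<Longrightarrow> f (\<phi> u + c *\<^sub>R \<nu>) = 0"
proof -
  define W where "W = \<Phi> ` (B \<times> {-\<delta><..<\<delta>})"
  define W0 where "W0 = \<Phi> ` (B \<times> {-\<delta><..<c})"
  obtain V S where V: "open V" "closure D \<subseteq> V" and f: "C1_on f f' V" and S: "compact S" "S \<subseteq> W"
    and f0: "\<And>x. x \<in> V - S \<Longrightarrow> f x = 0"
    using tf unfolding test_fun_def W_def by auto
  have inV: "\<phi> u + t *\<^sub>R \<nu> \<in> V" if "u \<in> B" "t \<in> {-\<delta>..c}" for u t
    using cl[OF that] V(2) by blast
  have injo: "inj_on \<Phi> (B \<times> {-\<delta><..<c})" by (rule inj_on_subset[OF inj]) (use c in auto)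
  then have "open W0"
    using open_tube_image[OF \<phi>] unfolding W0_def \<Phi>_def by blast
  have DW': "W0 = D \<inter> W" using DW by (simp add: W_def W0_def)
  \<comment> \<open>Injectivity on the closed tube keeps its two ends outside the open tube
    \<open>W\<close>, which contains the support. The end \<open>t = \<delta>\<close> is reached
    only when \<open>c = \<delta>\<close>.\<close>
  have end0: "f (\<phi> u + t *\<^sub>R \<nu>) = 0" if "u \<in> B" "t \<in> {-\<delta>..c}" "t = -\<delta> \<or> t = \<delta>" for u t
  proof -
    have "\<phi> u + t *\<^sub>R \<nu> \<notin> W"
    proof
      assume "\<phi> u + t *\<^sub>R \<nu> \<in> W"
      then obtain z where z: "z \<in> B \<times> {-\<delta><..<\<delta>}" "\<Phi> (u, t) = \<Phi> z"
        unfolding W_def by (auto simp: \<Phi>_def)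
      then have "(u, t) = z" using that c by (intro inj_onD[OF inj]) auto
      then show False using z(1) that(3) by auto
    qed
    then show ?thesis using S(2) inV[OF that(1,2)] by (intro f0) auto
  qed
  show "f (\<phi> u + c *\<^sub>R \<nu>) = 0" if "c = \<delta>" "u \<in> B" for u
    using end0[OF that(2)] that(1) c by auto
  have "indicator D x *\<^sub>R f' x \<nu> = indicator W0 x *\<^sub>R f' x \<nu>" for x
    using derivative_zero_off_support[OF f V(1) compact_imp_closed[OF S(1)] f0, of x \<nu>] V(2) closure_subset[of D] S(2)
    by (cases "x \<in> D"; cases "x \<in> W") (auto simp: DW')
  then have "(LINT x:D|lborel. f' x \<nu>) = (LINT x:W0|lborel. f' x \<nu>)"
    unfolding set_lebesgue_integral_def by (simp only:)
  also have "\<dots> = (LINT u:B|lborel. (f (\<phi> u + c *\<^sub>R \<nu>) - f (\<phi> u + (-\<delta>) *\<^sub>R \<nu>)) * vol_form (\<nu> # tvecs (\<phi>' u)))"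
    unfolding W0_def \<Phi>_def
  proof (rule tube_integral[OF \<phi>(2,1) c(1)])
    show "inj_on (\<lambda>(u, t). \<phi> u + t *\<^sub>R \<nu>) (B \<times> {-\<delta><..<c})" using injo unfolding \<Phi>_def .
    show "(f has_derivative f' (\<phi> u + t *\<^sub>R \<nu>)) (at (\<phi> u + t *\<^sub>R \<nu>))" if "u \<in> B" "t \<in> {-\<delta>..c}" for u t
      by (rule C1_onD[OF f inV[OF that]])
    show "continuous_on {-\<delta>..c} (\<lambda>t. f' (\<phi> u + t *\<^sub>R \<nu>) \<nu>)" if "u \<in> B" for u
      by (rule continuous_on_compose2[OF C1_on_cont[OF f]]) (use inV that in \<open>auto intro!: continuous_intros\<close>)
    show "set_integrable lborel ((\<lambda>(u, t). \<phi> u + t *\<^sub>R \<nu>) ` (B \<times> {-\<delta><..<c})) (\<lambda>x. f' x \<nu>)"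
      using set_integrable_C1_closure[OF D(2) V(2) C1_on_cont[OF f], of W0] DW' \<open>open W0\<close>
      unfolding W0_def \<Phi>_def by auto
  qed (rule J)
  also have "\<dots> = (LINT u:B|lborel. f (\<phi> u + c *\<^sub>R \<nu>) * vol_form (\<nu> # tvecs (\<phi>' u)))"
  proof (rule set_lebesgue_integral_cong)
    show "\<forall>u. u \<in> B \<longrightarrow> (f (\<phi> u + c *\<^sub>R \<nu>) - f (\<phi> u + (-\<delta>) *\<^sub>R \<nu>)) * vol_form (\<nu> # tvecs (\<phi>' u)) =
        f (\<phi> u + c *\<^sub>R \<nu>) * vol_form (\<nu> # tvecs (\<phi>' u))"
      using end0[of _ "-\<delta>"] c by simp
  qed (use \<phi>(2) in simp)
  finally show "(LINT x:D|lborel. f' x \<nu>) = (LINT u:B|lborel. f (\<phi> u + c *\<^sub>R \<nu>) * vol_form (\<nu> # tvecs (\<phi>' u)))" .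
qed

text \<open>The tube is so small that \<open>r\<close> increases strictly along each of its
  segments. Hence the sign of \<open>t\<close> decides the side of the boundary: \<open>D\<close>
  meets the tube in the half \<open>t < 0\<close>, and the frontier meets it inside the
  chart.\<close>

lemma boundary_tube:
  fixes D :: "'n::{finite,linorder} cvec set"
  assumes chart: "oriented_chart D U \<phi>" and D: "open D" "bounded D"
    and u0: "u0 \<in> U" "\<phi> u0 \<in> R" and eq: "local_equation D R r r'"
    and \<nu>: "vol_form (\<nu> # tangents \<phi> u0) > 0"
  obtains W where "open W" "\<phi> u0 \<in> W" "W \<inter> frontier D \<subseteq> \<phi> ` U"
    "\<And>f f'. test_fun D W f f' \<Longrightarrow> (LINT x:D|lborel. f' x \<nu>) = flux U \<phi> \<nu> f"
proof -
  note ch = oriented_chartD[OF chart]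
  let ?\<phi>' = "\<lambda>u. frechet_derivative \<phi> (at u)"
  have lin: "linear (?\<phi>' u)" if "u \<in> U" for u by (rule C1_on_linear[OF ch(2) that])
  define \<Phi> where "\<Phi> = (\<lambda>(u, t). \<phi> u + t *\<^sub>R \<nu>)"
  define \<Phi>' where "\<Phi>' = (\<lambda>(z :: 'n param \<times> real) (h, s). ?\<phi>' (fst z) h + s *\<^sub>R \<nu>)"
  have \<Phi>: "C1_on \<Phi> \<Phi>' (U \<times> (UNIV :: real set))"
    unfolding \<Phi>_def \<Phi>'_def by (rule C1_on_tube[OF ch(2)])
  have R: "open R" "C1_on r r' R" and rD: "\<And>q. q \<in> R \<Longrightarrow> q \<in> D \<longleftrightarrow> r q < 0"
    "\<And>q. q \<in> R \<Longrightarrow> q \<in> frontier D \<longleftrightarrow> r q = 0"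
    using eq by (auto simp: local_equation_def)
  have oUU: "open (U \<times> (UNIV :: real set))" using ch(1) by (intro open_Times) auto
  obtain \<kappa> where \<kappa>: "\<kappa> > 0" "\<And>\<nu>. r' (\<phi> u0) \<nu> = \<kappa> * vol_form (\<nu> # tangents \<phi> u0)"
    by (rule normal_derivative_eq_vol_form[OF chart u0 eq]) blast
  have L: "\<Phi>' (u0, 0) = (\<lambda>(h, s). ?\<phi>' u0 h + s *\<^sub>R \<nu>)" by (simp add: \<Phi>'_def)
  have "jac (\<Phi>' (u0, 0)) = vol_form (\<nu> # tangents \<phi> u0)"
    unfolding L tangents_eq by (rule jac_tube[OF lin[OF u0(1)]])
  then obtain K where K: "linear K" "\<And>z. K (\<Phi>' (u0, 0) z) = z"
    using jac_nz_inverse[of "\<Phi>' (u0, 0)"] linear_tube[OF lin[OF u0(1)], of \<nu>] \<nu> unfolding L by (metis less_irrefl)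
  obtain N where N: "open N" "(u0, 0) \<in> N" "N \<subseteq> U \<times> UNIV" "inj_on \<Phi> N"
    using C1_on_local_inj[OF oUU \<Phi> _ K] u0(1) by auto
  define R1 where "R1 = R \<inter> (\<lambda>x. r' x \<nu>) -` {0<..}"
  have oR1: "open R1"
    unfolding R1_def using continuous_open_preimage[OF C1_on_cont[OF R(2)] R(1)] by simp
  define U1 where "U1 = U \<inter> (\<lambda>u. vol_form (\<nu> # tangents \<phi> u)) -` {0<..}"
  have oU1: "open U1"
    unfolding U1_def tangents_eq
    using continuous_open_preimage[OF continuous_on_vol_form_tvecs[OF ch(2)] ch(1)] by simp
  \<comment> \<open>\<open>N\<close> gives injectivity, \<open>R1\<close> the growth of
    \<open>r\<close> along \<open>\<nu>\<close>, \<open>U1\<close> the sign of the Jacobian; a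
    product neighbourhood satisfying all three becomes the tube.\<close>
  define N1 where "N1 = (N \<inter> \<Phi> -` R1) \<inter> (U1 \<times> UNIV)"
  have "continuous_on N \<Phi>" using C1_on_continuous[OF \<Phi>] N(3) by (rule continuous_on_subset)
  then have "open N1"
    unfolding N1_def using N(1) oR1 oU1 by (intro open_Int open_Times continuous_open_preimage) auto
  moreover have "(u0, 0) \<in> N1"
    using N(2) u0 \<nu> \<kappa> by (auto simp: N1_def R1_def U1_def \<Phi>_def)
  ultimately obtain B C where B: "open B" "u0 \<in> B" "open C" "0 \<in> C" "B \<times> C \<subseteq> N1"
    unfolding open_prod_def by auto
  obtain \<delta> where \<delta>: "\<delta> > 0" "cball 0 \<delta> \<subseteq> C"
    using B(3,4) open_contains_cball by blast
  have C: "t \<in> C" if "-\<delta> \<le> t" "t \<le> \<delta>" for t using \<delta>(2) that by (auto simp: subset_iff)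
  have BU: "u \<in> U" "vol_form (\<nu> # tangents \<phi> u) > 0" if "u \<in> B" for u
    using B(4,5) that by (auto simp: N1_def U1_def)
  have inR: "\<phi> u + t *\<^sub>R \<nu> \<in> R" "r' (\<phi> u + t *\<^sub>R \<nu>) \<nu> > 0"
    if "u \<in> B" "-\<delta> \<le> t" "t \<le> \<delta>" for u t
  proof -
    have "(u, t) \<in> N1" using B(5) C[of t] that by auto
    then show "\<phi> u + t *\<^sub>R \<nu> \<in> R" "r' (\<phi> u + t *\<^sub>R \<nu>) \<nu> > 0"
      by (auto simp: N1_def R1_def \<Phi>_def)
  qed
  have inj: "inj_on \<Phi> (B \<times> {-\<delta>..\<delta>})"
    using N(4) by (rule inj_on_subset) (use B(5) C in \<open>auto simp: N1_def\<close>)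
  have r0: "r (\<phi> u) = 0" if "u \<in> B" for u
    using inR(1)[OF that, of 0] \<delta>(1) rD(2) ch(4) BU(1)[OF that] by auto
  have mono: "r (\<phi> u + s *\<^sub>R \<nu>) < r (\<phi> u + t *\<^sub>R \<nu>)"
    if u: "u \<in> B" and st: "-\<delta> \<le> s" "s < t" "t \<le> \<delta>" for u s t
  proof (rule DERIV_pos_imp_increasing[OF st(2)])
    fix x assume x: "s \<le> x" "x \<le> t"
    let ?q = "\<phi> u + x *\<^sub>R \<nu>"
    have q: "?q \<in> R" "r' ?q \<nu> > 0" using inR[OF u] x st by auto
    have derr: "(r has_derivative r' ?q) (at ?q)" by (rule C1_onD[OF R(2) q(1)])
    have "((\<lambda>t. r (\<phi> u + t *\<^sub>R \<nu>)) has_real_derivative r' ?q \<nu>) (at x)"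
      by (rule has_real_derivative_line[OF derr])
    then show "\<exists>y. ((\<lambda>t. r (\<phi> u + t *\<^sub>R \<nu>)) has_real_derivative y) (at x) \<and> y > 0"
      using q(2) by blast
  qed
  have neg: "r (\<phi> u + t *\<^sub>R \<nu>) < 0" if "u \<in> B" "-\<delta> \<le> t" "t < 0" for u t
    using mono[OF that(1), of t 0] that r0 \<delta>(1) by simp
  have pos: "r (\<phi> u + t *\<^sub>R \<nu>) > 0" if "u \<in> B" "0 < t" "t \<le> \<delta>" for u t
    using mono[OF that(1), of 0 t] that r0 \<delta>(1) by simp
  define W where "W = \<Phi> ` (B \<times> {-\<delta><..<\<delta>})"
  define W0 where "W0 = \<Phi> ` (B \<times> {-\<delta><..<0})"
  have \<phi>B: "C1_on \<phi> ?\<phi>' B" by (rule C1_on_subset[OF ch(2)]) (use BU in auto)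
  have "inj_on (\<lambda>(u, t). \<phi> u + t *\<^sub>R \<nu>) (B \<times> {-\<delta><..<\<delta>})"
    using inj unfolding \<Phi>_def by (rule inj_on_subset) auto
  then have "open W"
    unfolding W_def \<Phi>_def by (rule open_tube_image[OF \<phi>B B(1)])
  have W0: "W0 = D \<inter> W"
  proof
    show "W0 \<subseteq> D \<inter> W"
    proof safe
      fix x assume "x \<in> W0"
      then obtain u t where x: "x = \<phi> u + t *\<^sub>R \<nu>" "u \<in> B" "-\<delta> < t" "t < 0"
        by (auto simp: W0_def \<Phi>_def)
      then show "x \<in> D" using neg[of u t] rD(1) inR(1)[of u t] \<delta>(1) by auto
      show "x \<in> W" using x \<delta>(1) unfolding W_def \<Phi>_def by (auto intro!: image_eqI[of _ _ "(u, t)"])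
    qed
    show "D \<inter> W \<subseteq> W0"
    proof safe
      fix x assume "x \<in> D" "x \<in> W"
      then obtain u t where x: "x = \<phi> u + t *\<^sub>R \<nu>" "u \<in> B" "-\<delta> < t" "t < \<delta>"
        by (auto simp: W_def \<Phi>_def)
      then have "r x < 0" using rD(1) inR(1)[of u t] \<open>x \<in> D\<close> by auto
      then have "t < 0" using pos[of u t] r0[of u] x by (cases t "0 :: real" rule: linorder_cases) auto
      then show "x \<in> W0" using x unfolding W0_def \<Phi>_def by (auto intro!: image_eqI[of _ _ "(u, t)"])
    qed
  qed
  have Wfr: "\<exists>u\<in>B. x = \<phi> u" if xW: "x \<in> W" and xf: "x \<in> frontier D" for x
  proof -
    obtain u t where x: "x = \<phi> u + t *\<^sub>R \<nu>" "u \<in> B" "-\<delta> < t" "t < \<delta>"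
      using xW by (auto simp: W_def \<Phi>_def)
    have "r x = 0" using rD(2) inR(1)[of u t] x xf by auto
    then have "t = 0" using pos[of u t] neg[of u t] x by (cases t "0 :: real" rule: linorder_cases) auto
    then show ?thesis using x by auto
  qed
  show ?thesis
  proof
    show "open W" by fact
    show "\<phi> u0 \<in> W" using B(2) \<delta>(1) unfolding W_def \<Phi>_def by (auto intro!: image_eqI[of _ _ "(u0, 0)"])
    show "W \<inter> frontier D \<subseteq> \<phi> ` U" using Wfr BU(1) by blast
    fix f f' assume "test_fun D W f f'"
    then obtain V S where V: "open V" "closure D \<subseteq> V" and f: "C1_on f f' V" and S: "compact S" "S \<subseteq> W"
      and f0: "\<And>x. x \<in> V - S \<Longrightarrow> f x = 0"
      unfolding test_fun_def by auto
    have cl: "\<phi> u + t *\<^sub>R \<nu> \<in> closure D" if "u \<in> B" "t \<in> {-\<delta>..0}" for u t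
    proof (cases "t = 0")
      case True
      then show ?thesis using ch(4)[OF BU(1)[OF that(1)]] by (simp add: frontier_def)
    next
      case False
      then have "\<phi> u + t *\<^sub>R \<nu> \<in> D" using rD(1)[OF inR(1)] neg[of u t] that \<delta>(1) by auto
      then show ?thesis using closure_subset by blast
    qed
    have "(LINT x:D|lborel. f' x \<nu>) = (LINT u:B|lborel. f (\<phi> u + 0 *\<^sub>R \<nu>) * vol_form (\<nu> # tvecs (?\<phi>' u)))"
    proof (rule tube_test_fun(1)[OF D \<phi>B B(1), where \<delta> = \<delta>])
      show "vol_form (\<nu> # tvecs (?\<phi>' u)) \<ge> 0" if "u \<in> B" for u
        using BU(2)[OF that] by (simp add: tangents_eq)
    qed (use \<delta>(1) inj W0 cl \<open>test_fun D W f f'\<close> in \<open>auto simp: W_def W0_def \<Phi>_def\<close>)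
    \<comment> \<open>The integral extends from \<open>B\<close> to \<open>U\<close>: the frontier
      meets \<open>W\<close> only in the image of \<open>B\<close>, so by injectivity of the chart
      the rest of \<open>U\<close> lands off the support of \<open>f\<close>.\<close>
    also have "\<dots> = flux U \<phi> \<nu> f"
    proof -
      have "indicator B u *\<^sub>R (f (\<phi> u + 0 *\<^sub>R \<nu>) * vol_form (\<nu> # tvecs (?\<phi>' u))) =
          indicator U u *\<^sub>R (f (\<phi> u) * vol_form (\<nu> # tangents \<phi> u))" for u
      proof (cases "u \<in> U - B")
        case True
        have "\<phi> u \<notin> W"
        proof
          assume "\<phi> u \<in> W"
          then obtain u' where "u' \<in> B" "\<phi> u = \<phi> u'" using Wfr ch(4) True by blast
          then have "u = u'" using ch(3) True BU(1) by (auto dest: inj_onD)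
          then show False using True \<open>u' \<in> B\<close> by simp
        qed
        moreover have "\<phi> u \<in> V" using ch(4)[of u] True V(2) by (auto simp: frontier_def)
        ultimately have "f (\<phi> u) = 0" using S(2) by (intro f0) auto
        then show ?thesis using True by simp
      next
        case False
        then have "u \<in> B \<longleftrightarrow> u \<in> U" using BU(1) by blast
        then show ?thesis by (simp add: tangents_eq indicator_def)
      qed
      then show ?thesis unfolding flux_def set_lebesgue_integral_def by (simp only:)
    qed
    finally show "(LINT x:D|lborel. f' x \<nu>) = flux U \<phi> \<nu> f" .
  qed
qed

text \<open>Any direction is a linear combination of two directions pointing outwards.\<close>
lemma boundary_local:
  fixes D :: "'n::{finite,linorder} cvec set"
  assumes chart: "oriented_chart D U \<phi>" and D: "open D" "bounded D" "smooth_boundary D" and u0: "u0 \<in> U"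
  obtains W where "open W" "\<phi> u0 \<in> W" "W \<inter> frontier D \<subseteq> \<phi> ` U"
    "\<And>f f'. test_fun D W f f' \<Longrightarrow> (LINT x:D|lborel. f' x e) = flux U \<phi> e f"
proof -
  note ch = oriented_chartD[OF chart]
  obtain R r r' where R: "\<phi> u0 \<in> R" "local_equation D R r r'"
    by (rule smooth_boundaryD[OF D(3) ch(4)[OF u0]]) blast
  obtain \<nu> where \<nu>: "vol_form (\<nu> # tangents \<phi> u0) > 0" using ch(5)[OF u0] by blast
  \<comment> \<open>If v is the value of the volume form at \<open>e\<close>, its value at
    \<open>e + c *\<^sub>R \<nu>\<close> is v + |v| + 1 > 0, so this direction admits a tube as
    well.\<close>
  define c where "c = (\<bar>vol_form (e # tangents \<phi> u0)\<bar> + 1) / vol_form (\<nu> # tangents \<phi> u0)"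
  have "vol_form ((e + c *\<^sub>R \<nu>) # tangents \<phi> u0) > 0"
    using \<nu> unfolding tangents_eq c_def
    by (simp add: linear_add[OF linear_vol_form_tvecs] linear_scale[OF linear_vol_form_tvecs])
  then obtain W1 where W1: "open W1" "\<phi> u0 \<in> W1" "W1 \<inter> frontier D \<subseteq> \<phi> ` U"
    "\<And>f f'. test_fun D W1 f f' \<Longrightarrow> (LINT x:D|lborel. f' x (e + c *\<^sub>R \<nu>)) = flux U \<phi> (e + c *\<^sub>R \<nu>) f"
    by (rule boundary_tube[OF chart D(1,2) u0 R]) blast
  obtain W2 where W2: "open W2" "\<phi> u0 \<in> W2"
    "\<And>f f'. test_fun D W2 f f' \<Longrightarrow> (LINT x:D|lborel. f' x \<nu>) = flux U \<phi> \<nu> f"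
    by (rule boundary_tube[OF chart D(1,2) u0 R \<nu>]) blast
  show ?thesis
  proof
    show "open (W1 \<inter> W2)" using W1(1) W2(1) by blast
    show "\<phi> u0 \<in> W1 \<inter> W2" using W1(2) W2(2) by blast
    show "W1 \<inter> W2 \<inter> frontier D \<subseteq> \<phi> ` U" using W1(3) by blast
    fix f f' assume tf: "test_fun D (W1 \<inter> W2) f f'"
    then obtain V S where V: "open V" "closure D \<subseteq> V" and f: "C1_on f f' V" and S: "compact S" "S \<subseteq> W1 \<inter> W2"
      and f0: "\<And>x. x \<in> V - S \<Longrightarrow> f x = 0"
      unfolding test_fun_def by auto
    have int: "set_integrable lborel D (\<lambda>x. f' x v)" for v
      using set_integrable_C1_closure[OF D(2) V(2) C1_on_cont[OF f]] D(1) by auto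
    have DV: "D \<subseteq> V" using V(2) closure_subset by blast
    have "(LINT x:D|lborel. f' x (e + c *\<^sub>R \<nu>)) = (LINT x:D|lborel. f' x e + c * f' x \<nu>)"
    proof (rule set_lebesgue_integral_cong)
      show "D \<in> sets lborel" using D(1) by simp
      show "\<forall>x. x \<in> D \<longrightarrow> f' x (e + c *\<^sub>R \<nu>) = f' x e + c * f' x \<nu>"
        using C1_on_linear[OF f] DV by (auto simp: linear_add linear_scale)
    qed
    also have "\<dots> = (LINT x:D|lborel. f' x e) + c * (LINT x:D|lborel. f' x \<nu>)"
      using int by (subst set_integral_add(2)) auto
    finally have 1: "(LINT x:D|lborel. f' x (e + c *\<^sub>R \<nu>)) = (LINT x:D|lborel. f' x e) + c * (LINT x:D|lborel. f' x \<nu>)" .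
    have fr: "frontier D \<subseteq> V" using V(2) by (auto simp: frontier_def)
    have "flux U \<phi> (e + c *\<^sub>R \<nu>) f = flux U \<phi> e f + c * flux U \<phi> \<nu> f"
      by (rule flux_linear[OF chart D(2) continuous_on_subset[OF C1_on_continuous[OF f] fr] compact_imp_closed[OF S(1)]])
        (use S(2) W1(3) f0 fr in auto)
    with 1 W1(4)[OF test_fun_mono[OF tf]] W2(3)[OF test_fun_mono[OF tf]]
    show "(LINT x:D|lborel. f' x e) = flux U \<phi> e f" by simp
  qed
qed

text \<open>A straight tube in direction \<open>e\<close> inside \<open>D\<close> contains the
  support of \<open>f\<close>, so \<open>f\<close> vanishes at both ends of every segment. The case
  \<open>e = 0\<close> is separate because no frame can start with it.\<close>

lemma interior_local:
  fixes D :: "'n::{finite,linorder} cvec set"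
  assumes D: "open D" "bounded D" and p: "p \<in> D"
  obtains W where "open W" "p \<in> W" "W \<subseteq> D" "\<And>f f'. test_fun D W f f' \<Longrightarrow> (LINT x:D|lborel. f' x e) = 0"
proof (cases "e = 0")
  case True
  have "(LINT x:D|lborel. f' x e) = 0" if "test_fun D D f f'" for f f'
  proof -
    obtain V where "closure D \<subseteq> V" "C1_on f f' V"
      using \<open>test_fun D D f f'\<close> unfolding test_fun_def by auto
    then have "indicator D x *\<^sub>R f' x e = 0" for x
      using C1_on_linear[of f f' V x] closure_subset[of D] True by (cases "x \<in> D") (auto simp: linear_0)
    then show ?thesis unfolding set_lebesgue_integral_def by (simp only: Bochner_Integration.integral_zero)
  qed
  then show ?thesis using that[of D] D(1) p by blast
next
  case False
  obtain T where T: "linear T" "vol_form (e # tvecs T) > 0"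
    by (rule frame_exists[OF False])
  have blT: "bounded_linear T" using T(1) by (simp add: linear_conv_bounded_linear)
  define \<phi> where "\<phi> u = p + T u" for u
  have \<phi>: "C1_on \<phi> (\<lambda>_. T) UNIV"
    unfolding \<phi>_def C1_on_def using blT
    by (auto intro!: derivative_eq_intros bounded_linear_imp_has_derivative)
  define \<Phi> where "\<Phi> = (\<lambda>(u, t). \<phi> u + t *\<^sub>R e)"
  have \<Phi>: "C1_on \<Phi> (\<lambda>z (h, s). T h + s *\<^sub>R e) (UNIV \<times> (UNIV :: real set))"
    unfolding \<Phi>_def by (rule C1_on_tube[OF \<phi>])
  define A where "A = (\<lambda>(h, s :: real). T h + s *\<^sub>R e)"
  have linA: "linear A" unfolding A_def by (rule linear_tube[OF T(1)])
  have "jac A \<noteq> 0" unfolding A_def jac_tube[OF T(1)] using T(2) by simp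
  then obtain K where K: "\<And>z. K (A z) = z" using jac_nz_inverse[OF linA] by metis
  have "\<Phi> z = p + A z" for z by (simp add: \<Phi>_def A_def \<phi>_def case_prod_beta add.assoc)
  then have inj: "inj \<Phi>" by (metis K add_left_cancel injI)
  have "continuous_on UNIV \<Phi>" using C1_on_continuous[OF \<Phi>] by simp
  then have "open (\<Phi> -` D)" using D(1) by (simp add: open_vimage)
  moreover have "(0, 0) \<in> \<Phi> -` D" using p by (simp add: \<Phi>_def \<phi>_def linear_0[OF T(1)])
  ultimately obtain B C where B: "open B" "0 \<in> B" "open C" "0 \<in> C" "B \<times> C \<subseteq> \<Phi> -` D"
    unfolding open_prod_def by (metis mem_Sigma_iff)
  obtain \<delta> where \<delta>: "\<delta> > 0" "cball 0 \<delta> \<subseteq> C"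
    using B(3,4) open_contains_cball by blast
  have inD: "\<phi> u + t *\<^sub>R e \<in> D" if "u \<in> B" "-\<delta> \<le> t" "t \<le> \<delta>" for u t
    using B(5) \<delta>(2) that by (auto simp: \<Phi>_def subset_iff)
  define W where "W = \<Phi> ` (B \<times> {-\<delta><..<\<delta>})"
  have WD: "W \<subseteq> D" using inD by (auto simp: W_def \<Phi>_def)
  have "inj_on (\<lambda>(u, t). \<phi> u + t *\<^sub>R e) (B \<times> {-\<delta><..<\<delta>})"
    using inj unfolding \<Phi>_def by (rule inj_on_subset) auto
  then have "open W"
    unfolding W_def \<Phi>_def by (rule open_tube_image[OF C1_on_subset[OF \<phi> subset_UNIV] B(1)])
  show ?thesis
  proof
    show "open W" "W \<subseteq> D" by fact+
    show "p \<in> W" using B(2) \<delta>(1) linear_0[OF T(1)] unfolding W_def \<Phi>_def \<phi>_def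
      by (auto intro!: image_eqI[of _ _ "(0, 0)"])
    fix f f' assume tf: "test_fun D W f f'"
    have cl: "\<phi> u + t *\<^sub>R e \<in> closure D" if "u \<in> B" "t \<in> {-\<delta>..\<delta>}" for u t
      using inD[of u t] that closure_subset by auto
    note tube = tube_test_fun[OF D C1_on_subset[OF \<phi> subset_UNIV] B(1), where \<delta> = \<delta> and c = \<delta> and \<nu> = e,
        OF _ _ _ _ cl, folded \<Phi>_def, folded W_def, OF _ _ _ _ _ _ _ tf]
    have prems: "- \<delta> < \<delta>" "\<delta> \<le> \<delta>" "inj_on \<Phi> (B \<times> {-\<delta>..\<delta>})" "vol_form (e # tvecs T) \<ge> 0" "D \<inter> W = W"
      using \<delta>(1) inj T(2) WD by (auto intro: inj_on_subset)
    have "(LINT x:D|lborel. f' x e) = (LINT u:B|lborel. f (\<phi> u + \<delta> *\<^sub>R e) * vol_form (e # tvecs T))"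
      by (rule tube(1)) (use prems in auto)
    also have "\<dots> = (LINT u:B|lborel. 0)"
      by (rule set_lebesgue_integral_cong) (use B(1) tube(2) prems in auto)
    also have "\<dots> = 0" by simp
    finally show "(LINT x:D|lborel. f' x e) = 0" .
  qed
qed

section \<open>Calculus of continuously differentiable functions\<close>

lemma C1_on_bilinear:
  assumes "bounded_bilinear prd" "C1_on f f' S" "C1_on g g' S"
  shows "C1_on (\<lambda>x. prd (f x) (g x)) (\<lambda>x h. prd (f x) (g' x h) + prd (f' x h) (g x)) S"
  unfolding C1_on_def
proof (intro conjI allI ballI)
  show "((\<lambda>x. prd (f x) (g x)) has_derivative (\<lambda>h. prd (f x) (g' x h) + prd (f' x h) (g x))) (at x)"
    if "x \<in> S" for x
    by (rule bounded_bilinear.FDERIV[OF assms(1)]) (use that assms C1_onD in auto)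
  show "continuous_on S (\<lambda>x. prd (f x) (g' x h) + prd (f' x h) (g x))" for h
    by (intro continuous_on_add bounded_bilinear.continuous_on[OF assms(1)] C1_on_continuous C1_on_cont)
      (use assms in auto)
qed

lemma C1_on_add:
  "C1_on f f' S \<Longrightarrow> C1_on g g' S \<Longrightarrow> C1_on (\<lambda>x. f x + g x) (\<lambda>x h. f' x h + g' x h) S"
  unfolding C1_on_def by (auto intro: has_derivative_add continuous_on_add)

lemma C1_on_const: "C1_on (\<lambda>x. c) (\<lambda>x h. 0) S"
  unfolding C1_on_def by auto

lemma C1_on_sum:
  assumes "finite I" "\<And>i. i \<in> I \<Longrightarrow> C1_on (f i) (f' i) S"
  shows "C1_on (\<lambda>x. \<Sum>i\<in>I. f i x) (\<lambda>x h. \<Sum>i\<in>I. f' i x h) S"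
  using assms by (induction I) (auto intro: C1_on_const C1_on_add)

lemma C1_on_mult:
  fixes f g :: "'a::euclidean_space \<Rightarrow> real"
  shows "C1_on f f' S \<Longrightarrow> C1_on g g' S \<Longrightarrow> C1_on (\<lambda>x. f x * g x) (\<lambda>x h. f x * g' x h + f' x h * g x) S"
  by (rule C1_on_bilinear[OF bounded_bilinear_mult])

lemma C1_on_compose_real:
  fixes q :: "'a::euclidean_space \<Rightarrow> real"
  assumes q: "C1_on q q' S" and \<sigma>: "\<And>x. x \<in> S \<Longrightarrow> (\<sigma> has_real_derivative \<sigma>' (q x)) (at (q x))"
    and c: "continuous_on (q ` S) \<sigma>'"
  shows "C1_on (\<lambda>x. \<sigma> (q x)) (\<lambda>x h. \<sigma>' (q x) * q' x h) S"
  unfolding C1_on_def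
proof (intro conjI allI ballI)
  show "((\<lambda>x. \<sigma> (q x)) has_derivative (\<lambda>h. \<sigma>' (q x) * q' x h)) (at x)" if "x \<in> S" for x
    using has_derivative_compose[OF C1_onD[OF q that] \<sigma>[OF that, unfolded has_field_derivative_def]] .
  show "continuous_on S (\<lambda>x. \<sigma>' (q x) * q' x h)" for h
    by (intro continuous_on_mult C1_on_cont[OF q] continuous_on_compose2[OF c C1_on_continuous[OF q]]) auto
qed

lemma C1_on_linear_fun: "bounded_linear f \<Longrightarrow> C1_on f (\<lambda>x. f) S"
  unfolding C1_on_def by (auto intro: bounded_linear_imp_has_derivative)

lemma C1_on_norm_square: "C1_on (\<lambda>x. (x - p) \<bullet> (x - p)) (\<lambda>x h. 2 * ((x - p) \<bullet> h)) S"
  for p :: "'a::euclidean_space"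
  unfolding C1_on_def
  by (auto intro!: derivative_eq_intros continuous_intros simp: inner_commute)

lemma real_polynomial_function_C1:
  assumes "real_polynomial_function P"
  shows "\<exists>P'. C1_on P P' UNIV"
  using assms by induction (blast intro: C1_on_linear_fun C1_on_const C1_on_add C1_on_mult)+

subsection \<open>Localisation\<close>

lemma DERIV_max_0_square: "((\<lambda>q. (max 0 q)\<^sup>2) has_real_derivative 2 * max 0 q) (at q)"
proof -
  consider "q > 0" | "q < 0" | "q = 0" by linarith
  then show ?thesis
  proof cases
    case 1
    have "((\<lambda>q. q\<^sup>2) has_real_derivative 2 * max 0 q) (at q)"
      using 1 by (auto intro!: derivative_eq_intros)
    then show ?thesis
      by (rule has_field_derivative_transform_within_open[of _ _ _ "{0<..}"]) (use 1 in auto)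
  next
    case 2
    have "((\<lambda>q. 0) has_real_derivative 2 * max 0 q) (at q)"
      using 2 by (auto intro!: derivative_eq_intros)
    then show ?thesis
      by (rule has_field_derivative_transform_within_open[of _ _ _ "{..<0}"]) (use 2 in auto)
  next
    case 3
    have "((\<lambda>h :: real. (max 0 h)\<^sup>2 / h) \<longlongrightarrow> 0) (at 0)"
    proof (rule Lim_null_comparison)
      show "\<forall>\<^sub>F h in at 0. norm ((max 0 h)\<^sup>2 / h) \<le> \<bar>h :: real\<bar>"
        by (rule always_eventually) (auto simp: max_def power2_eq_square)
      show "((\<lambda>h. \<bar>h\<bar>) \<longlongrightarrow> 0) (at (0 :: real))"
        by (auto intro!: tendsto_eq_intros)
    qed
    then show ?thesis using 3 by (simp add: DERIV_def)
  qed
qed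

text \<open>Squaring makes the positive part continuously differentiable, and one derivative is what
  \<open>C1_on\<close> asks for. For \<open>s > 0\<close> the function is positive exactly on the
  open ball.\<close>

definition bump :: "'a::euclidean_space \<Rightarrow> real \<Rightarrow> 'a \<Rightarrow> real"
  where "bump p s x = (max 0 (s\<^sup>2 - (x - p) \<bullet> (x - p)))\<^sup>2"

definition bump' :: "'a::euclidean_space \<Rightarrow> real \<Rightarrow> 'a \<Rightarrow> 'a \<Rightarrow> real"
  where "bump' p s x h = 2 * max 0 (s\<^sup>2 - (x - p) \<bullet> (x - p)) * - (2 * ((x - p) \<bullet> h))"

lemma C1_on_bump: "C1_on (bump p s) (bump' p s) S"
proof -
  have "C1_on (\<lambda>x. s\<^sup>2 - (x - p) \<bullet> (x - p)) (\<lambda>x h. - (2 * ((x - p) \<bullet> h))) S"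
    unfolding C1_on_def by (auto intro!: derivative_eq_intros continuous_intros simp: inner_commute)
  then show ?thesis
    unfolding bump_def[abs_def] bump'_def[abs_def]
    by (rule C1_on_compose_real[where \<sigma>' = "\<lambda>q. 2 * max 0 q"])
      (intro DERIV_max_0_square continuous_intros)+
qed

lemma bump_nonneg: "bump p s x \<ge> 0"
  by (simp add: bump_def)

lemma bump_pos_iff:
  assumes "s > 0" shows "bump p s x > 0 \<longleftrightarrow> x \<in> ball p s"
proof -
  have "(x - p) \<bullet> (x - p) = (dist p x)\<^sup>2"
    by (simp add: dist_norm power2_norm_eq_inner[symmetric] norm_minus_commute)
  moreover have "(dist p x)\<^sup>2 < s\<^sup>2 \<longleftrightarrow> dist p x < s"
    using assms by (metis abs_of_nonneg less_eq_real_def power2_less_imp_less power_strict_mono zero_le_dist zero_less_numeral)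
  ultimately show ?thesis
    by (auto simp: bump_def max_def not_less)
qed

lemma bump_eq_0: "s > 0 \<Longrightarrow> x \<notin> cball p s \<Longrightarrow> bump p s x = 0"
  using bump_pos_iff[of s p x] bump_nonneg[of p s x] by auto

text \<open>Dividing by the positive sum yields partitions of unity: over the closure of a domain to
  localise a field, over its frontier to build an atlas.\<close>

lemma finite_bump_cover:
  fixes C :: "'a::euclidean_space set"
  assumes "compact C" and s: "\<And>p. p \<in> C \<Longrightarrow> s p > 0"
  obtains P where "finite P" "P \<subseteq> C" "\<And>x. x \<in> C \<Longrightarrow> (\<Sum>p\<in>P. bump p (s p) x) > 0"
proof -
  have cov: "C \<subseteq> (\<Union>p\<in>C. ball p (s p))"
    by (rule subsetI, rule UN_I) (use s in auto)
  obtain P where P: "P \<subseteq> C" "finite P" "C \<subseteq> (\<Union>p\<in>P. ball p (s p))"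
    by (rule compactE_image[OF assms(1) _ cov]) auto
  have "(\<Sum>p\<in>P. bump p (s p) x) > 0" if x: "x \<in> C" for x
  proof -
    obtain p where p: "p \<in> P" "x \<in> ball p (s p)" using P(3) x by blast
    then have "bump p (s p) x > 0" using bump_pos_iff s P(1) by blast
    then show ?thesis using p P(2) bump_nonneg by (intro sum_pos2[of P p]) auto
  qed
  with P show ?thesis using that by blast
qed

lemma flux_sum:
  assumes "\<And>j. j \<in> J \<Longrightarrow> set_integrable lborel U (\<lambda>u. F j (\<phi> u) * vol_form (e # tangents \<phi> u))"
  shows "flux U \<phi> e (\<lambda>x. \<Sum>j\<in>J. F j x) = (\<Sum>j\<in>J. flux U \<phi> e (F j))"
proof -
  have "flux U \<phi> e (\<lambda>x. \<Sum>j\<in>J. F j x) =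
     (\<integral>u. (\<Sum>j\<in>J. indicator U u *\<^sub>R (F j (\<phi> u) * vol_form (e # tangents \<phi> u))) \<partial>lborel)"
    unfolding flux_def set_lebesgue_integral_def by (simp add: sum_distrib_left sum_distrib_right)
  also have "\<dots> = (\<Sum>j\<in>J. flux U \<phi> e (F j))"
    unfolding flux_def set_lebesgue_integral_def
    by (rule Bochner_Integration.integral_sum) (use assms in \<open>simp add: set_integrable_def\<close>)
  finally show ?thesis .
qed

lemma flux_cong:
  assumes "oriented_chart D U \<phi>" "\<And>x. x \<in> frontier D \<Longrightarrow> F x = G x"
  shows "flux U \<phi> e F = flux U \<phi> e G"
proof -
  have "indicator U u *\<^sub>R (F (\<phi> u) * vol_form (e # tangents \<phi> u)) =
      indicator U u *\<^sub>R (G (\<phi> u) * vol_form (e # tangents \<phi> u))" for u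
    using assms(2) oriented_chartD(4)[OF assms(1)] by (cases "u \<in> U") auto
  then show ?thesis unfolding flux_def set_lebesgue_integral_def by (simp only:)
qed

lemma flux_0: "flux U \<phi> e (\<lambda>x. 0) = 0"
  by (simp add: flux_def set_lebesgue_integral_def)

text \<open>
  A product of a bump with a continuous function is a uniform limit of test functions by
  the Stone-Weierstrass theorem.
\<close>
lemma flux_continuous_eq:
  fixes D :: "'n::{finite,linorder} cvec set"
  assumes D: "bounded D" and ch1: "oriented_chart D U1 \<phi>1" and ch2: "oriented_chart D U2 \<phi>2"
    and H: "\<And>f f'. test_fun D W f f' \<Longrightarrow> flux U1 \<phi>1 e f = flux U2 \<phi>2 e f"
    and s: "s > 0" "cball p s \<subseteq> W"
    and im: "W \<inter> frontier D \<subseteq> \<phi>1 ` U1" "W \<inter> frontier D \<subseteq> \<phi>2 ` U2"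
    and F: "continuous_on (frontier D) F"
  shows "flux U1 \<phi>1 e (\<lambda>x. bump p s x * F x) = flux U2 \<phi>2 e (\<lambda>x. bump p s x * F x)"
proof -
  let ?b = "bump p s" and ?v = "\<lambda>\<phi> u. vol_form (e # tangents \<phi> u)"
    and ?f = "\<lambda>U \<phi> F. flux U \<phi> e (\<lambda>x. bump p s x * F x)"
  have b: "continuous_on (frontier D) (bump p s)"
    by (rule C1_on_continuous[OF C1_on_bump])
  have b0: "bump p s x = 0" if "x \<notin> cball p s" for x by (rule bump_eq_0[OF s(1) that])
  have im': "cball p s \<inter> frontier D \<subseteq> \<phi>1 ` U1" "cball p s \<inter> frontier D \<subseteq> \<phi>2 ` U2"
    using im s(2) by auto
  \<comment> \<open>The mass of the bump against the area element of a chart: a uniform error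
    \<epsilon> in the continuous factor changes the flux by at most \<epsilon> times this
    mass.\<close>
  define M where "M U \<phi> = (LINT u:U|lborel. \<bar>?b (\<phi> u) * ?v \<phi> u\<bar>)" for U \<phi>
  have est: "\<bar>?f U \<phi> F - ?f U \<phi> P\<bar> \<le> \<epsilon> * M U \<phi>"
    if ch: "oriented_chart D U \<phi>" and im: "cball p s \<inter> frontier D \<subseteq> \<phi> ` U"
      and P: "continuous_on (frontier D) P" and eps: "\<And>x. x \<in> frontier D \<Longrightarrow> \<bar>F x - P x\<bar> \<le> \<epsilon>" for U \<phi> P \<epsilon>
  proof -
    note int = flux_integrable[OF ch D _ closed_cball im]
    have i1: "set_integrable lborel U (\<lambda>u. (?b (\<phi> u) * F (\<phi> u)) * ?v \<phi> u)"
      by (rule int) (use b0 b F in \<open>auto intro!: continuous_intros\<close>)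
    have i2: "set_integrable lborel U (\<lambda>u. (?b (\<phi> u) * P (\<phi> u)) * ?v \<phi> u)"
      by (rule int) (use b0 b P in \<open>auto intro!: continuous_intros\<close>)
    have i3: "set_integrable lborel U (\<lambda>u. \<bar>?b (\<phi> u) * ?v \<phi> u\<bar>)"
      by (rule set_integrable_abs, rule int) (use b0 b in auto)
    have i4: "set_integrable lborel U (\<lambda>u. (?b (\<phi> u) * F (\<phi> u)) * ?v \<phi> u -
        (?b (\<phi> u) * P (\<phi> u)) * ?v \<phi> u)"
      by (rule set_integral_diff(1)[OF i1 i2])
    have "\<bar>?f U \<phi> F - ?f U \<phi> P\<bar> =
      \<bar>LINT u:U|lborel. (?b (\<phi> u) * F (\<phi> u)) * ?v \<phi> u -
        (?b (\<phi> u) * P (\<phi> u)) * ?v \<phi> u\<bar>"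
      unfolding flux_def using set_integral_diff(2)[OF i1 i2] by simp
    also have "\<dots> \<le> (LINT u:U|lborel. \<bar>(?b (\<phi> u) * F (\<phi> u)) * ?v \<phi> u -
        (?b (\<phi> u) * P (\<phi> u)) * ?v \<phi> u\<bar>)"
      using set_integral_norm_bound[OF i4] by simp
    also have "\<dots> \<le> (LINT u:U|lborel. \<epsilon> * \<bar>?b (\<phi> u) * ?v \<phi> u\<bar>)"
    proof (rule set_integral_mono)
      show "set_integrable lborel U (\<lambda>u. \<bar>(?b (\<phi> u) * F (\<phi> u)) * ?v \<phi> u -
        (?b (\<phi> u) * P (\<phi> u)) * ?v \<phi> u\<bar>)"
        using i4 by (rule set_integrable_abs)
      show "set_integrable lborel U (\<lambda>u. \<epsilon> * \<bar>?b (\<phi> u) * ?v \<phi> u\<bar>)"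
        using i3 by simp
      fix u assume u: "u \<in> U"
      have "\<bar>(?b (\<phi> u) * F (\<phi> u)) * ?v \<phi> u -
          (?b (\<phi> u) * P (\<phi> u)) * ?v \<phi> u\<bar> =
        \<bar>F (\<phi> u) - P (\<phi> u)\<bar> * \<bar>?b (\<phi> u) * ?v \<phi> u\<bar>"
        unfolding abs_mult[symmetric] by (simp add: algebra_simps)
      also have "\<dots> \<le> \<epsilon> * \<bar>?b (\<phi> u) * ?v \<phi> u\<bar>"
        by (intro mult_right_mono eps oriented_chartD(4)[OF ch u]) auto
      finally show "\<bar>(?b (\<phi> u) * F (\<phi> u)) * ?v \<phi> u -
          (?b (\<phi> u) * P (\<phi> u)) * ?v \<phi> u\<bar>
        \<le> \<epsilon> * \<bar>?b (\<phi> u) * ?v \<phi> u\<bar>" .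
    qed
    also have "\<dots> = \<epsilon> * M U \<phi>" by (simp add: M_def)
    finally show ?thesis .
  qed
  let ?d = "?f U1 \<phi>1 F - ?f U2 \<phi>2 F"
  have bound: "\<bar>?d\<bar> \<le> \<epsilon> * (M U1 \<phi>1 + M U2 \<phi>2)" if "\<epsilon> > 0" for \<epsilon>
  proof -
    have "compact (frontier D)" using D by (rule compact_frontier_bounded)
    then obtain P :: "'n cvec \<Rightarrow> real" where P: "polynomial_function P" "\<And>x. x \<in> frontier D \<Longrightarrow> norm (F x - P x) < \<epsilon>"
      using Stone_Weierstrass_polynomial_function[OF _ F \<open>\<epsilon> > 0\<close>] by blast
    obtain P' where P': "C1_on P P' UNIV"
      using real_polynomial_function_C1 P(1) by (auto simp: real_polynomial_function_eq)
    have "test_fun D W (\<lambda>x. bump p s x * P x) (\<lambda>x h. bump p s x * P' x h + bump' p s x h * P x)"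
      unfolding test_fun_def using C1_on_mult[OF C1_on_bump P'] s b0
      by (intro exI[of _ UNIV] exI[of _ "cball p s"]) auto
    from H[OF this] have eq: "?f U1 \<phi>1 P = ?f U2 \<phi>2 P" .
    have Pc: "continuous_on (frontier D) P"
      using C1_on_continuous[OF P'] by (rule continuous_on_subset) simp
    have eps: "\<bar>F x - P x\<bar> \<le> \<epsilon>" if "x \<in> frontier D" for x using P(2)[OF that] by simp
    show ?thesis
      using est[OF ch1 im'(1) Pc eps] est[OF ch2 im'(2) Pc eps] unfolding eq by (simp add: algebra_simps)
  qed
  have "?d = 0"
  proof (rule ccontr)
    assume nz: "?d \<noteq> 0"
    \<comment> \<open>The summand 1 keeps \<open>m\<close> positive even if both masses
      vanish.\<close>
    define m where "m = \<bar>M U1 \<phi>1 + M U2 \<phi>2\<bar> + 1"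
    have m: "m > 0" by (simp add: m_def)
    have "\<bar>?d\<bar> \<le> \<bar>?d\<bar> / (2 * m) * (M U1 \<phi>1 + M U2 \<phi>2)"
      by (rule bound) (use nz m in auto)
    also have "\<dots> \<le> \<bar>?d\<bar> / (2 * m) * m"
      by (intro mult_left_mono) (use m in \<open>auto simp: m_def\<close>)
    also have "\<dots> < \<bar>?d\<bar>" using m nz by simp
    finally show False by simp
  qed
  then show ?thesis by simp
qed

section \<open>From single charts to an atlas\<close>

lemma oriented_atlasD:
  assumes "oriented_atlas D N U \<phi> \<rho>"
  shows "\<And>i. i < N \<Longrightarrow> oriented_chart D (U i) (\<phi> i)"
    "\<And>i. i < N \<Longrightarrow> continuous_on (frontier D) (\<rho> i)"
    "\<And>i. i < N \<Longrightarrow> closure {p\<in>frontier D. \<rho> i p \<noteq> 0} \<subseteq> \<phi> i ` U i"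
    "\<And>p. p \<in> frontier D \<Longrightarrow> (\<Sum>i<N. \<rho> i p) = 1"
  using assms unfolding oriented_atlas_def by auto

lemma atlas_flux_integrable:
  fixes D :: "'n::{finite,linorder} cvec set"
  assumes at: "oriented_atlas D N U \<phi> \<rho>" "i < N" and D: "bounded D" and F: "continuous_on (frontier D) F"
  shows "set_integrable lborel (U i) (\<lambda>u. (\<rho> i (\<phi> i u) * F (\<phi> i u)) * vol_form (e # tangents (\<phi> i) u))"
proof (rule flux_integrable[OF oriented_atlasD(1)[OF at] D, where K = "closure {p\<in>frontier D. \<rho> i p \<noteq> 0}"])
  show "continuous_on (frontier D) (\<lambda>x. \<rho> i x * F x)"
    by (intro continuous_on_mult oriented_atlasD(2)[OF at] F)
  show "closure {p \<in> frontier D. \<rho> i p \<noteq> 0} \<inter> frontier D \<subseteq> \<phi> i ` U i"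
    using oriented_atlasD(3)[OF at] by blast
  show "\<rho> i p * F p = 0" if "p \<in> frontier D - closure {p \<in> frontier D. \<rho> i p \<noteq> 0}" for p
    using that closure_subset[of "{p \<in> frontier D. \<rho> i p \<noteq> 0}"] by auto
qed simp

text \<open>Near a frontier point only the charts through \<open>p\<close> matter. Their fluxes
  agree on test functions, hence on continuous multiples of the bump, so every partition function
  can be moved into one chart \<open>k\<close>, where they add up to 1. The radius \<open>s\<close>
  is chosen before \<open>h\<close>, because \<open>h\<close> will be the field divided by a sum of
  bumps with these radii.\<close>

lemma atlas_local:
  fixes D :: "'n::{finite,linorder} cvec set"
  assumes at: "oriented_atlas D N U \<phi> \<rho>" and D: "open D" "bounded D" "smooth_boundary D"
    and p: "p \<in> closure D"
  shows "\<exists>s>0. \<forall>V h h'. open V \<longrightarrow> closure D \<subseteq> V \<longrightarrow> C1_on h h' V \<longrightarrow>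
    (LINT x:D|lborel. bump p s x * h' x e + bump' p s x e * h x) =
    (\<Sum>i<N. flux (U i) (\<phi> i) e (\<lambda>x. \<rho> i x * (bump p s x * h x)))"
proof -
  let ?f = "\<lambda>i s h. flux (U i) (\<phi> i) e (\<lambda>x. \<rho> i x * (bump p s x * h x))"
    and ?d = "\<lambda>s h h' x. bump p s x * h' x e + bump' p s x e * h x"
  have tf: "test_fun D W (\<lambda>x. bump p s x * h x) (\<lambda>x v. bump p s x * h' x v + bump' p s x v * h x)"
    if "open V" "closure D \<subseteq> V" "C1_on h h' V" "s > 0" "cball p s \<subseteq> W" for V h h' s W
    unfolding test_fun_def
    by (rule exI[of _ V], rule exI[of _ "cball p s"])
      (use that C1_on_mult[OF C1_on_bump that(3)] bump_eq_0[OF that(4)] in auto)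
  show ?thesis
  proof (cases "p \<in> D")
    case True
    obtain W where W: "open W" "p \<in> W" "W \<subseteq> D" "\<And>f f'. test_fun D W f f' \<Longrightarrow> (LINT x:D|lborel. f' x e) = 0"
      by (rule interior_local[OF D(1,2) True]) blast
    obtain s where s: "s > 0" "cball p s \<subseteq> W" using W(1,2) open_contains_cball by blast
    \<comment> \<open>The bump lives inside the open set \<open>D\<close>, hence vanishes on the
      frontier.\<close>
    have "(\<Sum>i<N. ?f i s h) = 0" for h
    proof (rule sum.neutral, safe)
      fix i assume i: "i < N"
      have "?f i s h = flux (U i) (\<phi> i) e (\<lambda>x. 0)"
      proof (rule flux_cong[OF oriented_atlasD(1)[OF at i]])
        fix x assume "x \<in> frontier D"
        then have "x \<notin> D" using D(1) by (simp add: frontier_def interior_open)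
        then have "bump p s x = 0" using s W(3) by (intro bump_eq_0) auto
        then show "\<rho> i x * (bump p s x * h x) = 0" by simp
      qed
      then show "?f i s h = 0" by (simp add: flux_0)
    qed
    moreover have "(LINT x:D|lborel. ?d s h h' x) = 0"
      if "open V" "closure D \<subseteq> V" "C1_on h h' V" for V h h'
      using W(4)[OF tf[OF that s]] .
    ultimately show ?thesis using s(1) by auto
  next
    case False
    then have pf: "p \<in> frontier D" using p D(1) by (simp add: frontier_def interior_open)
    define supp where "supp i = closure {x\<in>frontier D. \<rho> i x \<noteq> 0}" for i
    have supp: "\<rho> i x = 0" if "x \<in> frontier D" "x \<notin> supp i" for x i
      using that closure_subset[of "{x\<in>frontier D. \<rho> i x \<noteq> 0}"] unfolding supp_def by auto
    define I where "I = {i. i < N \<and> p \<in> \<phi> i ` U i}"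
    have finI: "finite I" by (simp add: I_def)
    have "\<exists>W. open W \<and> p \<in> W \<and> W \<inter> frontier D \<subseteq> \<phi> i ` U i \<and>
        (\<forall>f f'. test_fun D W f f' \<longrightarrow> (LINT x:D|lborel. f' x e) = flux (U i) (\<phi> i) e f)" if iI: "i \<in> I" for i
    proof -
      obtain u where u: "i < N" "u \<in> U i" "p = \<phi> i u" using iI by (auto simp: I_def)
      show ?thesis
        by (rule boundary_local[OF oriented_atlasD(1)[OF at u(1)] D u(2), of e]) (use u(3) in blast)
    qed
    then obtain W where W: "\<And>i. i \<in> I \<Longrightarrow> open (W i)" "\<And>i. i \<in> I \<Longrightarrow> p \<in> W i"
      "\<And>i. i \<in> I \<Longrightarrow> W i \<inter> frontier D \<subseteq> \<phi> i ` U i"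
      "\<And>i f f'. i \<in> I \<Longrightarrow> test_fun D (W i) f f' \<Longrightarrow> (LINT x:D|lborel. f' x e) = flux (U i) (\<phi> i) e f"
      by metis
    \<comment> \<open>For a chart not through \<open>p\<close> the closed support of its partition
      function misses \<open>p\<close>, so a neighbourhood of \<open>p\<close> is free of
      it.\<close>
    define W0 where "W0 = (\<Inter>i\<in>I. W i) \<inter> (\<Inter>i\<in>{..<N} - I. - supp i)"
    have "open W0"
      unfolding W0_def using W(1) finI by (intro open_Int open_INT) (auto simp: supp_def)
    moreover have "p \<in> W0"
    proof -
      have "p \<notin> supp i" if "i \<in> {..<N} - I" for i
        using that oriented_atlasD(3)[OF at, of i] unfolding supp_def I_def by blast
      then show ?thesis unfolding W0_def using W(2) by blast
    qed
    ultimately obtain s where s: "s > 0" "cball p s \<subseteq> W0" using open_contains_cball by blast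
    have b0: "bump p s x = 0" if "x \<notin> W0" for x using s that by (intro bump_eq_0) auto
    \<comment> \<open>This selects the chart into which all others will be moved.\<close>
    have "\<exists>i<N. \<rho> i p \<noteq> 0"
    proof (rule ccontr)
      assume "\<not> (\<exists>i<N. \<rho> i p \<noteq> 0)"
      then have "(\<Sum>i<N. \<rho> i p) = 0" by simp
      then show False using oriented_atlasD(4)[OF at pf] by simp
    qed
    then obtain k where k: "k < N" "\<rho> k p \<noteq> 0" by blast
    then have "p \<in> supp k" using supp pf by blast
    then have kI: "k \<in> I" using oriented_atlasD(3)[OF at k(1)] k(1) by (auto simp: I_def supp_def)
    have "(LINT x:D|lborel. ?d s h h' x) =
      (\<Sum>i<N. ?f i s h)"
      if V: "open V" "closure D \<subseteq> V" "C1_on h h' V" for V h h'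
    proof -
      have hc: "continuous_on (frontier D) h"
        using C1_on_continuous[OF V(3)] by (rule continuous_on_subset) (use V(2) in \<open>auto simp: frontier_def\<close>)
      have ch: "oriented_chart D (U i) (\<phi> i)" if "i \<in> I" for i
        using oriented_atlasD(1)[OF at] that by (auto simp: I_def)
      have \<rho>c: "continuous_on (frontier D) (\<rho> i)" if "i \<in> I" for i
        using oriented_atlasD(2)[OF at] that by (auto simp: I_def)
      have W0_sub: "W0 \<subseteq> W i" if "i \<in> I" for i using that by (auto simp: W0_def)
      have int: "set_integrable lborel (U k) (\<lambda>u. (bump p s (\<phi> k u) * (\<rho> i (\<phi> k u) * h (\<phi> k u))) * vol_form (e # tangents (\<phi> k) u))"
        if "i \<in> I" for i
      proof (rule flux_integrable[OF ch[OF kI] D(2) _ closed_cball])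
        show "continuous_on (frontier D) (\<lambda>x. bump p s x * (\<rho> i x * h x))"
          by (intro continuous_on_mult \<rho>c[OF that] hc C1_on_continuous[OF C1_on_bump])
        show "cball p s \<inter> frontier D \<subseteq> \<phi> k ` U k" using s(2) W(3)[OF kI] W0_sub[OF kI] by blast
      qed (use bump_eq_0[OF s(1)] in auto)
      let ?g = "\<lambda>i. flux (U k) (\<phi> k) e (\<lambda>x. bump p s x * (\<rho> i x * h x))"
      have "(\<Sum>i<N. ?f i s h) = (\<Sum>i\<in>I. ?f i s h)"
      proof (rule sum.mono_neutral_right)
        show "\<forall>i\<in>{..<N} - I. ?f i s h = 0"
        proof
          fix i assume i: "i \<in> {..<N} - I"
          have "?f i s h = flux (U i) (\<phi> i) e (\<lambda>x. 0)"
          proof (rule flux_cong)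
            show "oriented_chart D (U i) (\<phi> i)" using i oriented_atlasD(1)[OF at] by auto
            fix x assume x: "x \<in> frontier D"
            show "\<rho> i x * (bump p s x * h x) = 0"
            proof (cases "x \<in> W0")
              case True
              then have "\<rho> i x = 0" using supp[OF x] i unfolding W0_def by blast
              then show ?thesis by simp
            qed (simp add: b0)
          qed
          then show "?f i s h = 0" by (simp add: flux_0)
        qed
      qed (auto simp: I_def)
      also have "\<dots> = (\<Sum>i\<in>I. ?g i)"
      proof (rule sum.cong[OF refl])
        fix i assume i: "i \<in> I"
        have "?f i s h =
          flux (U i) (\<phi> i) e (\<lambda>x. bump p s x * (\<rho> i x * h x))"
          by (simp add: mult_ac)
        also have "\<dots> = ?g i"
        proof (rule flux_continuous_eq[OF D(2) ch[OF i] ch[OF kI] _ s])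
          show "flux (U i) (\<phi> i) e f = flux (U k) (\<phi> k) e f" if "test_fun D W0 f f'" for f f'
            using W(4)[OF i test_fun_mono[OF that W0_sub[OF i]]] W(4)[OF kI test_fun_mono[OF that W0_sub[OF kI]]]
            by simp
          show "W0 \<inter> frontier D \<subseteq> \<phi> i ` U i" "W0 \<inter> frontier D \<subseteq> \<phi> k ` U k"
            using W(3)[OF i] W0_sub[OF i] W(3)[OF kI] W0_sub[OF kI] by blast+
          show "continuous_on (frontier D) (\<lambda>x. \<rho> i x * h x)"
            by (intro continuous_on_mult \<rho>c[OF i] hc)
        qed
        finally show "?f i s h =
          ?g i" .
      qed
      also have "\<dots> = flux (U k) (\<phi> k) e (\<lambda>x. \<Sum>i\<in>I. bump p s x * (\<rho> i x * h x))"
        by (rule flux_sum[symmetric]) (rule int)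
      also have "\<dots> = flux (U k) (\<phi> k) e (\<lambda>x. bump p s x * h x)"
      proof (rule flux_cong[OF ch[OF kI]])
        fix x assume x: "x \<in> frontier D"
        show "(\<Sum>i\<in>I. bump p s x * (\<rho> i x * h x)) = bump p s x * h x"
        proof (cases "x \<in> W0")
          case True
          have "(\<Sum>i\<in>I. \<rho> i x) = (\<Sum>i<N. \<rho> i x)"
          proof (rule sum.mono_neutral_left)
            show "\<forall>i\<in>{..<N} - I. \<rho> i x = 0" using supp[OF x] True unfolding W0_def by blast
          qed (auto simp: I_def)
          then have "(\<Sum>i\<in>I. \<rho> i x) = 1" using oriented_atlasD(4)[OF at x] by simp
          then show ?thesis by (simp flip: sum_distrib_left sum_distrib_right)
        qed (simp add: b0)
      qed
      also have "\<dots> = (LINT x:D|lborel. ?d s h h' x)"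
        using W(4)[OF kI tf[OF V s(1)]] s(2) W0_sub[OF kI] by auto
      finally show ?thesis ..
    qed
    then show ?thesis using s(1) by blast
  qed
qed

text \<open>With \<open>B\<close> the sum of bumps and \<open>h = f / B\<close>, the product rule
  makes the local identities for \<open>h\<close> add up to the identity for
  \<open>f\<close>.\<close>

lemma divergence_theorem_real:
  fixes D :: "'n::{finite,linorder} cvec set" and f :: "'n cvec \<Rightarrow> real"
  assumes at: "oriented_atlas D N U \<phi> \<rho>" and D: "open D" "bounded D" "smooth_boundary D"
    and V: "open V" "closure D \<subseteq> V" and f: "C1_on f f' V"
  shows "(LINT x:D|lborel. f' x e) = (\<Sum>i<N. flux (U i) (\<phi> i) e (\<lambda>x. \<rho> i x * f x))"
proof -
  have "\<forall>p\<in>closure D. \<exists>s>0. \<forall>V h h'. open V \<longrightarrow> closure D \<subseteq> V \<longrightarrow> C1_on h h' V \<longrightarrow>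
      (LINT x:D|lborel. bump p s x * h' x e + bump' p s x e * h x) =
      (\<Sum>i<N. flux (U i) (\<phi> i) e (\<lambda>x. \<rho> i x * (bump p s x * h x)))"
    using atlas_local[OF at D] by blast
  from bchoice[OF this] obtain s where s0: "\<forall>p\<in>closure D. s p > 0 \<and>
     (\<forall>V h h'. open V \<longrightarrow> closure D \<subseteq> V \<longrightarrow> C1_on h h' V \<longrightarrow>
      (LINT x:D|lborel. bump p (s p) x * h' x e + bump' p (s p) x e * h x) =
      (\<Sum>i<N. flux (U i) (\<phi> i) e (\<lambda>x. \<rho> i x * (bump p (s p) x * h x))))"
    by (elim exE)
  have s: "\<And>p. p \<in> closure D \<Longrightarrow> s p > 0"
    "\<And>p V h h'. p \<in> closure D \<Longrightarrow> open V \<Longrightarrow> closure D \<subseteq> V \<Longrightarrow> C1_on h h' V \<Longrightarrow>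
      (LINT x:D|lborel. bump p (s p) x * h' x e + bump' p (s p) x e * h x) =
      (\<Sum>i<N. flux (U i) (\<phi> i) e (\<lambda>x. \<rho> i x * (bump p (s p) x * h x)))"
    using s0 by auto
  have "compact (closure D)" using D(2) by simp
  then obtain P where P: "finite P" "P \<subseteq> closure D" "\<And>x. x \<in> closure D \<Longrightarrow> (\<Sum>p\<in>P. bump p (s p) x) > 0"
    by (rule finite_bump_cover[where s = s]) (use s(1) in auto)
  define B where "B x = (\<Sum>p\<in>P. bump p (s p) x)" for x
  define B' where "B' x v = (\<Sum>p\<in>P. bump' p (s p) x v)" for x v
  have B: "C1_on B B' S" for S
    unfolding B_def[abs_def] B'_def[abs_def] by (rule C1_on_sum[OF P(1) C1_on_bump])
  have Bpos: "B x > 0" if "x \<in> closure D" for x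
    using P(3)[OF that] by (simp add: B_def)
  \<comment> \<open>\<open>B\<close> is positive on the closure of \<open>D\<close>, hence on a
    neighbourhood of it, where division by \<open>B\<close> stays differentiable.\<close>
  define V' where "V' = V \<inter> B -` {0<..}"
  have V': "open V'" "closure D \<subseteq> V'"
    unfolding V'_def using V Bpos C1_on_continuous[OF B[of V]]
    by (auto intro!: continuous_open_preimage)
  define h where "h x = inverse (B x) * f x" for x
  define h' where "h' x v = inverse (B x) * f' x v + (- (inverse (B x) ^ 2) * B' x v) * f x" for x v
  have "C1_on (\<lambda>x. inverse (B x)) (\<lambda>x v. - (inverse (B x) ^ 2) * B' x v) V'"
  proof (rule C1_on_compose_real[OF B])
    show "(inverse has_real_derivative - (inverse (B x) ^ 2)) (at (B x))" if "x \<in> V'" for x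
      using that DERIV_inverse[of "B x"] by (auto simp: V'_def numeral_2_eq_2)
    show "continuous_on (B ` V') (\<lambda>y. - (inverse y ^ 2))"
      by (intro continuous_intros) (auto simp: V'_def)
  qed
  from C1_on_mult[OF this C1_on_subset[OF f]] have h: "C1_on h h' V'"
    unfolding h_def[abs_def] h'_def[abs_def] by (simp add: V'_def)
  \<comment> \<open>The product rule for \<open>B * (f / B)\<close>: here \<open>b\<close>,
    \<open>v\<close> stand for \<open>B\<close> and its derivative, \<open>w\<close>,
    \<open>u\<close> for \<open>f\<close> and its derivative.\<close>
  have quot: "b * (inverse b * u + (- (inverse b ^ 2) * v) * w) + v * (inverse b * w) = u"
    if "b \<noteq> 0" for b u v w :: real
    using that by (simp add: field_simps power2_eq_square)
  let ?f = "\<lambda>i p. flux (U i) (\<phi> i) e (\<lambda>x. \<rho> i x * (bump p (s p) x * h x))"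
    and ?d = "\<lambda>p x. bump p (s p) x * h' x e + bump' p (s p) x e * h x"
  have DV': "D \<subseteq> V'" "frontier D \<subseteq> V'" using V'(2) closure_subset by (auto simp: frontier_def)
  have intp: "set_integrable lborel D (\<lambda>x. ?d p x)" for p
    using set_integrable_C1_closure[OF D(2) V'(2) C1_on_cont[OF C1_on_mult[OF C1_on_bump h]]] D(1) by auto
  have "(LINT x:D|lborel. f' x e) =
      (LINT x:D|lborel. (\<Sum>p\<in>P. ?d p x))"
  proof (rule set_lebesgue_integral_cong)
    show "D \<in> sets lborel" using D(1) by simp
    show "\<forall>x. x \<in> D \<longrightarrow> f' x e = (\<Sum>p\<in>P. ?d p x)"
    proof safe
      fix x assume "x \<in> D"
      then have nz: "B x \<noteq> 0" using DV' by (auto simp: V'_def)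
      have "(\<Sum>p\<in>P. ?d p x) = B x * h' x e + B' x e * h x"
        by (simp add: B_def B'_def sum.distrib sum_distrib_right)
      also have "\<dots> = f' x e"
        using quot[OF nz] by (simp only: h_def h'_def)
      finally show "f' x e = (\<Sum>p\<in>P. ?d p x)" ..
    qed
  qed
  also have "\<dots> = (\<Sum>p\<in>P. LINT x:D|lborel. ?d p x)"
    unfolding set_lebesgue_integral_def scaleR_sum_right
    by (rule Bochner_Integration.integral_sum) (use intp in \<open>simp add: set_integrable_def\<close>)
  also have "\<dots> = (\<Sum>p\<in>P. \<Sum>i<N. ?f i p)"
    using s(2)[OF _ V' h] P(2) by (intro sum.cong refl) auto
  also have "\<dots> = (\<Sum>i<N. \<Sum>p\<in>P. ?f i p)"
    by (rule sum.swap)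
  also have "\<dots> = (\<Sum>i<N. flux (U i) (\<phi> i) e (\<lambda>x. \<rho> i x * f x))"
  proof (rule sum.cong[OF refl])
    fix i assume "i \<in> {..<N}"
    then have i: "i < N" by simp
    have "(\<Sum>p\<in>P. ?f i p) =
        flux (U i) (\<phi> i) e (\<lambda>x. \<Sum>p\<in>P. \<rho> i x * (bump p (s p) x * h x))"
      by (rule flux_sum[symmetric], rule atlas_flux_integrable[OF at i D(2)])
        (rule continuous_on_subset[OF C1_on_continuous[OF C1_on_mult[OF C1_on_bump h]] DV'(2)])
    also have "\<dots> = flux (U i) (\<phi> i) e (\<lambda>x. \<rho> i x * f x)"
    proof (rule flux_cong[OF oriented_atlasD(1)[OF at i]])
      fix x assume "x \<in> frontier D"
      then have nz: "B x \<noteq> 0" using DV' by (auto simp: V'_def)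
      have "(\<Sum>p\<in>P. \<rho> i x * (bump p (s p) x * h x)) = \<rho> i x * (B x * h x)"
        by (simp add: B_def sum_distrib_left sum_distrib_right)
      also have "\<dots> = \<rho> i x * f x" using nz by (simp add: h_def)
      finally show "(\<Sum>p\<in>P. \<rho> i x * (bump p (s p) x * h x)) = \<rho> i x * f x" .
    qed
    finally show "(\<Sum>p\<in>P. ?f i p) =
      flux (U i) (\<phi> i) e (\<lambda>x. \<rho> i x * f x)" .
  qed
  finally show ?thesis .
qed

lemma divergence_theorem:
  fixes D :: "'n::{finite,linorder} cvec set" and f :: "'n cvec \<Rightarrow> 'b::euclidean_space"
  assumes at: "oriented_atlas D N U \<phi> \<rho>" and D: "open D" "bounded D" "smooth_boundary D"
    and V: "open V" "closure D \<subseteq> V" and f: "C1_on f f' V"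
  shows "i < N \<Longrightarrow> (\<lambda>u. \<rho> i (\<phi> i u) *\<^sub>R vol_form (e # tangents (\<phi> i) u) *\<^sub>R f (\<phi> i u)) integrable_on U i"
    and "(\<Sum>i<N. integral (U i) (\<lambda>u. \<rho> i (\<phi> i u) *\<^sub>R vol_form (e # tangents (\<phi> i) u) *\<^sub>R f (\<phi> i u))) =
      integral D (\<lambda>x. f' x e)"
    and "(\<lambda>x. f' x e) integrable_on D"
proof -
  let ?g = "\<lambda>i u. \<rho> i (\<phi> i u) *\<^sub>R vol_form (e # tangents (\<phi> i) u) *\<^sub>R f (\<phi> i u)"
  have frV: "frontier D \<subseteq> V" using V(2) by (auto simp: frontier_def)
  have fb: "C1_on (\<lambda>x. f x \<bullet> b) (\<lambda>x h. f' x h \<bullet> b) V" for b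
    by (rule C1_on_linear_compose[OF f]) (simp add: linear_iff inner_add_left)
  have fbc: "continuous_on (frontier D) (\<lambda>x. f x \<bullet> b)" for b
    by (rule continuous_on_subset[OF C1_on_continuous[OF fb] frV])
  have g_inner: "?g i u \<bullet> b = (\<rho> i (\<phi> i u) * (f (\<phi> i u) \<bullet> b)) * vol_form (e # tangents (\<phi> i) u)" for i u b
    by (simp add: mult_ac)
  note int = atlas_flux_integrable[OF at _ D(2) fbc]
  have gb: "(\<lambda>u. ?g i u \<bullet> b) integrable_on U i" "integral (U i) (\<lambda>u. ?g i u \<bullet> b) = flux (U i) (\<phi> i) e (\<lambda>x. \<rho> i x * (f x \<bullet> b))"
    if "i < N" for i b
    using set_borel_integral_eq_integral[OF int[OF that]] unfolding g_inner flux_def by auto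
  show gi: "?g i integrable_on U i" if "i < N" for i
    using gb(1)[OF that] by (subst integrable_componentwise_iff) blast
  have fi: "set_integrable lborel D (\<lambda>x. f' x e)"
    by (rule set_integrable_C1_closure[OF D(2) V(2) C1_on_cont[OF f]]) (use D(1) in auto)
  have fbi: "set_integrable lborel D (\<lambda>x. f' x e \<bullet> b)" for b
    by (rule set_integrable_C1_closure[OF D(2) V(2) C1_on_cont[OF fb]]) (use D(1) in auto)
  show fio: "(\<lambda>x. f' x e) integrable_on D"
    by (rule set_borel_integral_eq_integral(1)[OF fi])
  show "(\<Sum>i<N. integral (U i) (?g i)) = integral D (\<lambda>x. f' x e)"
  proof (rule euclidean_eqI)
    fix b :: 'b assume b: "b \<in> Basis"
    have "(\<Sum>i<N. integral (U i) (?g i)) \<bullet> b = (\<Sum>i<N. integral (U i) (\<lambda>u. ?g i u \<bullet> b))"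
      unfolding inner_sum_left by (rule sum.cong[OF refl], rule integral_component_eq[symmetric]) (use gi in auto)
    also have "\<dots> = (\<Sum>i<N. flux (U i) (\<phi> i) e (\<lambda>x. \<rho> i x * (f x \<bullet> b)))"
      using gb(2) by simp
    also have "\<dots> = (LINT x:D|lborel. f' x e \<bullet> b)"
      by (rule divergence_theorem_real[OF at D V fb, symmetric])
    also have "\<dots> = integral D (\<lambda>x. f' x e \<bullet> b)"
      by (rule set_borel_integral_eq_integral(2)[OF fbi])
    also have "\<dots> = integral D (\<lambda>x. f' x e) \<bullet> b"
      by (rule integral_component_eq[OF fio])
    finally show "(\<Sum>i<N. integral (U i) (?g i)) \<bullet> b = integral D (\<lambda>x. f' x e) \<bullet> b" .
  qed
qed

section \<open>Existence of an oriented atlas\<close>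

text \<open>Adding multiples of \<open>\<nu>\<close> to the tangents is precomposition with the
  shear that sends (h, s) to (h, c h + s), whose matrix is triangular with ones on the
  diagonal.\<close>

lemma vol_form_shear:
  fixes c :: "'n::{finite,linorder} param \<Rightarrow> real"
  assumes T: "linear T" and c: "linear c"
  shows "vol_form (\<nu> # tvecs (\<lambda>h. T h + c h *\<^sub>R \<nu>)) = vol_form (\<nu> # tvecs T)"
proof -
  define A where "A = (\<lambda>(h, s). T h + s *\<^sub>R \<nu>)"
  define B where "B = (\<lambda>(h, s). (h, c h + s))"
  have linA: "linear A" unfolding A_def by (rule linear_tube[OF T])
  have linB: "linear B"
    unfolding B_def by (rule linearI) (auto simp: linear_add[OF c] linear_scale[OF c] algebra_simps)
  define MA where "MA x = coord (A (unjoin x))" for x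
  define MB where "MB x = join (B (unjoin x))" for x
  have lin: "linear MA" "linear MB"
    unfolding MA_def MB_def
    using linear_compose[OF linear_compose[OF linear_unjoin linA] linear_coord]
      linear_compose[OF linear_compose[OF linear_unjoin linB] linear_join] by (simp_all add: o_def)
  have entry: "matrix MB $ i $ j = (if i = j then 1 else 0)" if "i \<noteq> 0" for i j
  proof -
    have "Abs_tcoord (lab i) = Abs_tcoord (lab j) \<longleftrightarrow> i = j" if "j \<noteq> 0"
      by (metis Rep_Abs_tcoord_lab \<open>i \<noteq> 0\<close> lab_eq_iff that)
    then show ?thesis
      using that by (cases "j = 0") (simp_all add: matrix_def MB_def B_def join_def unjoin_axis, simp add: axis_def)
  qed
  \<comment> \<open>Only row 0 has off-diagonal entries, and 0 is the least index, so the matrix is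
    upper triangular.\<close>
  have "det (matrix MB) = prod (\<lambda>i. matrix MB $ i $ i) UNIV"
  proof (rule det_upperdiagonal)
    fix i j :: "'n bit0" assume ji: "j < i"
    have "\<not> j < (0 :: 'n bit0)"
      using Rep_bit0[of j] by (simp add: less_bit0_def bit0.Rep_0)
    then have "i \<noteq> 0" using ji by auto
    then show "matrix MB $ i $ j = 0" using ji by (simp add: entry)
  qed
  moreover have "matrix MB $ i $ i = 1" for i
    by (cases "i = 0") (auto simp: entry, auto simp: matrix_def MB_def B_def join_def unjoin_axis linear_0[OF c])
  ultimately have "det (matrix MB) = 1" by simp
  moreover have "(\<lambda>x. coord ((A \<circ> B) (unjoin x))) = MA \<circ> MB"
    by (auto simp: MA_def MB_def)
  ultimately have "jac (A \<circ> B) = jac A"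
    unfolding jac_eq_det using matrix_compose[OF lin(2,1)] by (simp add: det_mul MA_def[abs_def])
  moreover have "jac (A \<circ> B) = vol_form (\<nu> # tvecs (\<lambda>h. T h + c h *\<^sub>R \<nu>))"
    by (simp add: jac_def A_def B_def linear_0[OF T] linear_0[OF c])
  ultimately show ?thesis by (simp add: A_def jac_tube[OF T])
qed

text \<open>Near \<open>p\<close> the boundary is a graph over the plane of \<open>T\<close>. In the
  frame \<open>A\<close> the map \<open>H\<close> straightens it, and the local inverse at
  \<open>(u, 0)\<close> gives the height \<open>\<tau> u\<close>. The tangents of the graph are
  those of \<open>T\<close> sheared along \<open>\<nu>\<close>, so the orientation is inherited from
  the frame.\<close>

lemma chart_exists:
  fixes D :: "'n::{finite,linorder} cvec set"
  assumes D: "smooth_boundary D" and p: "p \<in> frontier D"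
  obtains U \<phi> where "oriented_chart D U \<phi>" "p \<in> \<phi> ` U"
proof -
  obtain R r r' where R: "p \<in> R" and eq: "local_equation D R r r'"
    by (rule smooth_boundaryD[OF D p]) blast
  have R1: "open R" "C1_on r r' R" and rD: "\<And>q. q \<in> R \<Longrightarrow> q \<in> D \<longleftrightarrow> r q < 0"
    "\<And>q. q \<in> R \<Longrightarrow> q \<in> frontier D \<longleftrightarrow> r q = 0" and nz: "\<exists>v. r' p v \<noteq> 0"
    using eq R by (auto simp: local_equation_def)
  have linr: "linear (r' q)" if "q \<in> R" for q by (rule C1_on_linear[OF R1(2) that])
  obtain v where v: "r' p v \<noteq> 0" using nz by blast
  \<comment> \<open>The sign makes \<open>r\<close> grow along \<open>\<nu>\<close>, so that
    \<open>\<nu>\<close> points outwards.\<close>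
  define \<nu> where "\<nu> = (if r' p v > 0 then v else - v)"
  have \<nu>: "r' p \<nu> > 0" using v linear_neg[OF linr[OF R]] by (auto simp: \<nu>_def)
  then have "\<nu> \<noteq> 0" using linear_0[OF linr[OF R]] by auto
  then obtain T where T: "linear T" "vol_form (\<nu> # tvecs T) > 0" by (rule frame_exists)
  define A where "A = (\<lambda>(h, s :: real). T h + s *\<^sub>R \<nu>)"
  have linA: "linear A" unfolding A_def by (rule linear_tube[OF T(1)])
  have blA: "bounded_linear A" using linA by (simp add: linear_conv_bounded_linear)
  have "jac A \<noteq> 0" unfolding A_def jac_tube[OF T(1)] using T(2) by simp
  then obtain K where K: "linear K" "\<And>z. K (A z) = z" "\<And>w. A (K w) = w"
    using jac_nz_inverse[OF linA] by metis
  have blK: "bounded_linear K" using K(1) by (simp add: linear_conv_bounded_linear)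
  define R' where "R' = R \<inter> (\<lambda>x. r' x \<nu>) -` {0<..}"
  have oR': "open R'"
    unfolding R'_def using continuous_open_preimage[OF C1_on_cont[OF R1(2)] R1(1)] by simp
  define S where "S = (\<lambda>z. p + A z) -` R'"
  have "continuous_on UNIV (\<lambda>z. p + A z)"
    by (intro continuous_intros linear_continuous_on blA)
  then have oS: "open S" unfolding S_def using oR' by (simp add: open_vimage)
  have S0: "0 \<in> S" using R \<nu> by (simp add: S_def R'_def linear_0[OF linA])
  have SR: "p + A z \<in> R" "r' (p + A z) \<nu> > 0" if "z \<in> S" for z
    using that by (auto simp: S_def R'_def)
  define H where "H z = (fst z, r (p + A z))" for z
  define H' where "H' z h = (fst h, r' (p + A z) (A h))" for z h
  have H: "C1_on H H' S"
    unfolding C1_on_def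
  proof (intro conjI allI ballI)
    fix z assume z: "z \<in> S"
    have 1: "((\<lambda>z. p + A z) has_derivative A) (at z)"
      using bounded_linear_imp_has_derivative[OF blA] by (auto intro!: derivative_eq_intros)
    have "((\<lambda>z. r (p + A z)) has_derivative (\<lambda>h. r' (p + A z) (A h))) (at z)"
      by (rule has_derivative_compose[OF 1 C1_onD[OF R1(2) SR(1)[OF z]]])
    then show "(H has_derivative H' z) (at z)"
      unfolding H_def[abs_def] H'_def
      by (intro has_derivative_Pair has_derivative_fst has_derivative_ident)
  next
    fix h
    have "continuous_on S (\<lambda>z. r' (p + A z) (A h))"
      by (rule continuous_on_compose2[OF C1_on_cont[OF R1(2)]
            continuous_on_subset[OF \<open>continuous_on UNIV (\<lambda>z. p + A z)\<close>]]) (use SR in auto)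
    then show "continuous_on S (\<lambda>z. H' z h)"
      unfolding H'_def by (intro continuous_intros)
  qed
  \<comment> \<open>The left inverse of \<open>H' 0\<close>: the height is recovered by removing the
    contribution of \<open>T\<close> to the derivative of \<open>r\<close> and dividing by the slope
    of \<open>r\<close> along \<open>\<nu>\<close>.\<close>
  define L where "L y = (fst y, (snd y - r' p (T (fst y))) / r' p \<nu>)" for y
  have "linear L"
    by (rule linearI) (simp_all add: L_def linear_add[OF linr[OF R]] linear_scale[OF linr[OF R]]
        linear_add[OF T(1)] linear_scale[OF T(1)] add_divide_distrib diff_divide_distrib algebra_simps)
  then have blL: "bounded_linear L" by (simp add: linear_conv_bounded_linear)
  have LH: "L (H' 0 h) = h" for h
  proof -
    have "A 0 = 0" by (rule linear_0[OF linA])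
    moreover have "A h = T (fst h) + snd h *\<^sub>R \<nu>" by (simp add: A_def case_prod_beta)
    ultimately show ?thesis
      using \<nu> by (simp add: L_def H'_def linear_add[OF linr[OF R]] linear_scale[OF linr[OF R]])
  qed
  have Hb: "blinfun_apply (Blinfun (H' z)) = H' z" if "z \<in> S" for z
    by (rule C1_on_blinfun(1)[OF H that])
  have "Blinfun L o\<^sub>L Blinfun (H' 0) = id_blinfun"
    by (rule blinfun_eqI) (simp add: Hb[OF S0] bounded_linear_Blinfun_apply[OF blL] LH)
  moreover have "(H has_derivative blinfun_apply (Blinfun (H' z))) (at z)" if "z \<in> S" for z
    unfolding Hb[OF that] by (rule C1_onD[OF H that])
  ultimately obtain N V g g' where N: "open N" "N \<subseteq> S" "0 \<in> N" and V: "open V" "H 0 \<in> V"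
    and hom: "homeomorphism N V H g" and g': "\<And>y. y \<in> V \<Longrightarrow> (g has_derivative g' y) (at y)"
    using inverse_function_theorem[OF oS _ C1_on_blinfun(2)[OF H] S0] by metis
  have gH: "g (H z) = z" "H z \<in> V" if "z \<in> N" for z using hom that by (auto simp: homeomorphism_def)
  have Hg: "H (g y) = y" "g y \<in> N" if "y \<in> V" for y using hom that by (auto simp: homeomorphism_def)
  define U where "U = (\<lambda>u. (u, 0)) -` V"
  define \<tau> where "\<tau> u = snd (g (u, 0))" for u
  define \<phi> where "\<phi> u = p + (T u + \<tau> u *\<^sub>R \<nu>)" for u
  have oU: "open U" unfolding U_def using V(1) by (intro open_vimage continuous_intros)
  have gu: "g (u, 0) = (u, \<tau> u)" if "u \<in> U" for u
    using Hg(1)[of "(u, 0)"] that by (simp add: U_def \<tau>_def H_def prod_eq_iff)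
  have \<phi>A: "\<phi> u = p + A (g (u, 0))" if "u \<in> U" for u
    unfolding gu[OF that] by (simp add: \<phi>_def A_def)
  have \<phi>S: "\<phi> u \<in> R" "r' (\<phi> u) \<nu> > 0" "r (\<phi> u) = 0" if "u \<in> U" for u
  proof -
    have gN: "g (u, 0) \<in> N" using Hg(2) that by (simp add: U_def)
    show "\<phi> u \<in> R" "r' (\<phi> u) \<nu> > 0"
      unfolding \<phi>A[OF that] by (rule SR[OF subsetD[OF N(2) gN]])+
    have "H (g (u, 0)) = (u, 0)" using Hg(1) that by (simp add: U_def)
    then show "r (\<phi> u) = 0" unfolding \<phi>A[OF that] by (simp add: H_def)
  qed
  have \<phi>fr: "\<phi> u \<in> frontier D" if "u \<in> U" for u
    using \<phi>S[OF that] rD(2) by blast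
  \<comment> \<open>The slope of the graph, found by implicit differentiation of
    \<open>r (\<phi> u) = 0\<close>. Its continuity in \<open>u\<close> can be read off from that of
    the derivative of \<open>r\<close>.\<close>
  define c where "c u h = - r' (\<phi> u) (T h) / r' (\<phi> u) \<nu>" for u h
  have linc: "linear (c u)" if "u \<in> U" for u
    unfolding c_def by (rule linearI) (simp_all add: linear_add[OF linr[OF \<phi>S(1)[OF that]]] linear_scale[OF linr[OF \<phi>S(1)[OF that]]]
        linear_add[OF T(1)] linear_scale[OF T(1)] add_divide_distrib diff_divide_distrib)
  have blT: "bounded_linear T" using T(1) by (simp add: linear_conv_bounded_linear)
  have der\<phi>: "(\<phi> has_derivative (\<lambda>h. T h + c u h *\<^sub>R \<nu>)) (at u)" if u: "u \<in> U" for u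
  proof -
    have "((\<lambda>u. (u, 0)) has_derivative (\<lambda>h. (h, 0))) (at u)"
      by (intro has_derivative_Pair has_derivative_ident has_derivative_const)
    from has_derivative_compose[OF this g'] u
    have "((\<lambda>u. g (u, 0)) has_derivative (\<lambda>h. g' (u, 0) (h, 0))) (at u)" by (simp add: U_def)
    then have \<tau>': "(\<tau> has_derivative (\<lambda>h. snd (g' (u, 0) (h, 0)))) (at u)"
      unfolding \<tau>_def[abs_def] by (rule has_derivative_snd)
    have d\<phi>: "(\<phi> has_derivative (\<lambda>h. T h + snd (g' (u, 0) (h, 0)) *\<^sub>R \<nu>)) (at u)"
      unfolding \<phi>_def[abs_def]
      by (rule derivative_eq_intros refl bounded_linear_imp_has_derivative[OF blT] \<tau>')+ simp
    have "((\<lambda>u. r (\<phi> u)) has_derivative (\<lambda>h. r' (\<phi> u) (T h + snd (g' (u, 0) (h, 0)) *\<^sub>R \<nu>))) (at u)"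
      by (rule has_derivative_compose[OF d\<phi> C1_onD[OF R1(2) \<phi>S(1)[OF u]]])
    moreover have "((\<lambda>u. r (\<phi> u)) has_derivative (\<lambda>h. 0)) (at u)"
      by (rule has_derivative_transform_within_open[OF has_derivative_const[of 0] oU u]) (simp add: \<phi>S(3))
    ultimately have "(\<lambda>h. r' (\<phi> u) (T h + snd (g' (u, 0) (h, 0)) *\<^sub>R \<nu>)) = (\<lambda>h. 0)"
      by (rule has_derivative_unique)
    from fun_cong[OF this] have e: "r' (\<phi> u) (T h) + snd (g' (u, 0) (h, 0)) * r' (\<phi> u) \<nu> = 0" for h
      by (simp add: linear_add[OF linr[OF \<phi>S(1)[OF u]]] linear_scale[OF linr[OF \<phi>S(1)[OF u]]])
    have "snd (g' (u, 0) (h, 0)) = c u h" for h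
    proof -
      have "- r' (\<phi> u) (T h) = snd (g' (u, 0) (h, 0)) * r' (\<phi> u) \<nu>" using e[of h] by linarith
      then show ?thesis unfolding c_def using \<phi>S(2)[OF u] by (simp only:) simp
    qed
    then show ?thesis using d\<phi> by simp
  qed
  have \<phi>c: "continuous_on U \<phi>"
    using der\<phi> by (meson continuous_at_imp_continuous_on has_derivative_continuous)
  have C1\<phi>: "C1_on \<phi> (\<lambda>u h. T h + c u h *\<^sub>R \<nu>) U"
    unfolding C1_on_def
  proof (intro conjI allI ballI)
    fix h
    have "continuous_on U (\<lambda>u. r' (\<phi> u) w)" for w
      by (rule continuous_on_compose2[OF C1_on_cont[OF R1(2)] \<phi>c]) (use \<phi>S(1) in auto)
    then show "continuous_on U (\<lambda>u. T h + c u h *\<^sub>R \<nu>)"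
      unfolding c_def using \<phi>S(2) by (intro continuous_intros) (auto, force)
  qed (rule der\<phi>)
  show ?thesis
  proof
    show "p \<in> \<phi> ` U"
    proof -
      have "r p = 0" using rD(2)[OF R] p by simp
      then have H0: "H 0 = (0, 0)" by (simp add: H_def linear_0[OF linA])
      then have "0 \<in> U" using V(2) by (simp add: U_def)
      moreover have "\<phi> 0 = p"
        using gH(1)[OF N(3)] H0 \<open>0 \<in> U\<close> by (simp add: \<phi>A linear_0[OF linA])
      ultimately show ?thesis by blast
    qed
    show "oriented_chart D U \<phi>"
      unfolding oriented_chart_def
    proof (intro conjI ballI)
      show "open U" by fact
      show "Ck_on 1 \<phi> U" by (rule C1_on_imp_Ck[OF C1\<phi>])
      define \<psi> where "\<psi> x = fst (K (x - p))" for x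
      have \<psi>\<phi>: "\<psi> (\<phi> u) = u" if "u \<in> U" for u
        using that by (simp add: \<psi>_def \<phi>A K(2) gu)
      have "continuous_on (\<phi> ` U) \<psi>"
        unfolding \<psi>_def
        by (intro continuous_on_fst continuous_on_compose2[OF linear_continuous_on[OF blK]] continuous_intros) auto
      then have "homeomorphism U (\<phi> ` U) \<phi> \<psi>"
        using \<phi>c \<psi>\<phi> unfolding homeomorphism_def by (auto simp: image_image)
      then show "\<exists>\<psi>. homeomorphism U (\<phi> ` U) \<phi> \<psi>" by blast
      \<comment> \<open>The image is cut out of the frontier by an open condition, hence relatively
        open.\<close>
      have im: "\<phi> ` U = frontier D \<inter> (\<lambda>x. K (x - p)) -` N"
      proof (intro equalityI subsetI)
        fix x assume "x \<in> \<phi> ` U"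
        then obtain u where u: "u \<in> U" "x = \<phi> u" by blast
        then have "K (x - p) = g (u, 0)" by (simp add: \<phi>A K(2))
        then show "x \<in> frontier D \<inter> (\<lambda>x. K (x - p)) -` N"
          using u \<phi>fr Hg(2)[of "(u, 0)"] by (simp add: U_def)
      next
        fix x assume x: "x \<in> frontier D \<inter> (\<lambda>x. K (x - p)) -` N"
        define z where "z = K (x - p)"
        have z: "z \<in> N" "x = p + A z" using x by (auto simp: z_def K(3))
        then have "r x = 0" using SR(1)[of z] N(2) rD(2) x by auto
        then have Hz: "H z = (fst z, 0)" using z by (simp add: H_def)
        then have "fst z \<in> U" using gH(2)[OF z(1)] by (simp add: U_def)
        moreover have "\<phi> (fst z) = x"
          using gH(1)[OF z(1)] Hz z(2) \<open>fst z \<in> U\<close> by (simp add: \<phi>A)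
        ultimately show "x \<in> \<phi> ` U" by blast
      qed
      have "open ((\<lambda>x. K (x - p)) -` N)"
        by (rule open_vimage[OF N(1)])
          (intro continuous_on_compose2[OF linear_continuous_on[OF blK]] continuous_intros, auto)
      then show "openin (top_of_set (frontier D)) (\<phi> ` U)"
        unfolding im by (rule openin_open_Int)
      fix u assume u: "u \<in> U"
      let ?q = "\<phi> u"
      have "frechet_derivative \<phi> (at u) = (\<lambda>h. T h + c u h *\<^sub>R \<nu>)"
        using frechet_derivative_at[OF der\<phi>[OF u]] by simp
      then have vol: "vol_form (\<nu> # tangents \<phi> u) > 0"
        unfolding tangents_eq using vol_form_shear[OF T(1) linc[OF u]] T(2) by simp
      have "outward D ?q \<nu>"
        by (rule outward_if_increasing[OF eq \<phi>S(1)[OF u] \<phi>fr[OF u] \<phi>S(2)[OF u]])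
      then show "\<exists>\<nu>. outward D ?q \<nu> \<and> vol_form (\<nu> # tangents \<phi> u) > 0" using vol by blast
    qed
  qed
qed

text \<open>The partition consists of normalised bumps. Their closed balls meet the frontier inside
  chart images, so the closures of the supports stay there too.\<close>

lemma atlas_exists:
  fixes D :: "'n::{finite,linorder} cvec set"
  assumes D: "bounded D" "smooth_boundary D"
  shows "\<exists>N U \<phi> \<rho>. oriented_atlas D N U \<phi> \<rho>"
proof -
  \<comment> \<open>The triple \<open>a\<close> packs radius, parameter domain and chart for a
    single choice.\<close>
  have "\<forall>p\<in>frontier D. \<exists>a. oriented_chart D (fst (snd a)) (snd (snd a)) \<and> fst a > 0 \<and>
      cball p (fst a) \<inter> frontier D \<subseteq> snd (snd a) ` fst (snd a)"
  proof
    fix p assume p: "p \<in> frontier D"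
    obtain U \<phi> where ch: "oriented_chart D U \<phi>" "p \<in> \<phi> ` U"
      by (rule chart_exists[OF D(2) p]) blast
    then obtain W where W: "open W" "\<phi> ` U = frontier D \<inter> W"
      unfolding oriented_chart_def openin_open by blast
    then obtain s where "s > 0" "cball p s \<subseteq> W" using ch(2) open_contains_cball by blast
    then have "oriented_chart D (fst (snd (s, U, \<phi>))) (snd (snd (s, U, \<phi>))) \<and> fst (s, U, \<phi>) > 0 \<and>
      cball p (fst (s, U, \<phi>)) \<inter> frontier D \<subseteq> snd (snd (s, U, \<phi>)) ` fst (snd (s, U, \<phi>))"
      using ch(1) W(2) by auto
    then show "\<exists>a. oriented_chart D (fst (snd a)) (snd (snd a)) \<and> fst a > 0 \<and>
      cball p (fst a) \<inter> frontier D \<subseteq> snd (snd a) ` fst (snd a)" by blast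
  qed
  from bchoice[OF this] obtain a where a: "\<forall>p\<in>frontier D. oriented_chart D (fst (snd (a p))) (snd (snd (a p))) \<and> fst (a p) > 0 \<and>
      cball p (fst (a p)) \<inter> frontier D \<subseteq> snd (snd (a p)) ` fst (snd (a p))"
    by (elim exE)
  define s where "s p = fst (a p)" for p
  define UU where "UU p = fst (snd (a p))" for p
  define ph where "ph p = snd (snd (a p))" for p
  have ch: "oriented_chart D (UU p) (ph p)" "s p > 0" "cball p (s p) \<inter> frontier D \<subseteq> ph p ` UU p"
    if "p \<in> frontier D" for p using a that by (auto simp: s_def UU_def ph_def)
  have "compact (frontier D)" using D(1) by (rule compact_frontier_bounded)
  then obtain P where P: "finite P" "P \<subseteq> frontier D" "\<And>x. x \<in> frontier D \<Longrightarrow> (\<Sum>p\<in>P. bump p (s p) x) > 0"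
    by (rule finite_bump_cover[where s = s]) (use ch(2) in auto)
  obtain q where q: "bij_betw q {..<card P} P"
    using ex_bij_betw_nat_finite[OF P(1)] by (auto simp: lessThan_atLeast0)
  have qP: "q i \<in> P" if "i < card P" for i using q that by (auto simp: bij_betw_def)
  define B where "B x = (\<Sum>p\<in>P. bump p (s p) x)" for x
  have Bpos: "B x > 0" if "x \<in> frontier D" for x
    using P(3)[OF that] by (simp add: B_def)
  have Bc: "continuous_on (frontier D) B"
    unfolding B_def[abs_def] by (intro continuous_on_sum C1_on_continuous[OF C1_on_bump])
  define \<rho> where "\<rho> i x = bump (q i) (s (q i)) x / B x" for i x
  have "oriented_atlas D (card P) (\<lambda>i. UU (q i)) (\<lambda>i. ph (q i)) \<rho>"
    unfolding oriented_atlas_def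
  proof (intro conjI allI impI ballI)
    fix i assume i: "i < card P"
    note qfr = subsetD[OF P(2) qP[OF i]]
    show "oriented_chart D (UU (q i)) (ph (q i))" by (rule ch(1)[OF qfr])
    show "continuous_on (frontier D) (\<rho> i)"
      unfolding \<rho>_def[abs_def]
      by (intro continuous_on_divide C1_on_continuous[OF C1_on_bump] Bc) (use Bpos in force)
    show "\<rho> i p \<ge> 0" if "p \<in> frontier D" for p
      unfolding \<rho>_def using Bpos[OF that] bump_nonneg[of "q i" "s (q i)" p] by simp
    have "{p \<in> frontier D. \<rho> i p \<noteq> 0} \<subseteq> cball (q i) (s (q i)) \<inter> frontier D"
    proof
      fix x assume x: "x \<in> {p \<in> frontier D. \<rho> i p \<noteq> 0}"
      then have "bump (q i) (s (q i)) x \<noteq> 0" by (auto simp: \<rho>_def)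
      then have "x \<in> cball (q i) (s (q i))" using bump_eq_0[OF ch(2)[OF qfr]] by blast
      then show "x \<in> cball (q i) (s (q i)) \<inter> frontier D" using x by blast
    qed
    then have "closure {p \<in> frontier D. \<rho> i p \<noteq> 0} \<subseteq> cball (q i) (s (q i)) \<inter> frontier D"
      by (intro closure_minimal) auto
    then show "closure {p \<in> frontier D. \<rho> i p \<noteq> 0} \<subseteq> ph (q i) ` UU (q i)"
      using ch(3)[OF qfr] by blast
  next
    fix x assume x: "x \<in> frontier D"
    have "(\<Sum>i<card P. \<rho> i x) = (\<Sum>i<card P. bump (q i) (s (q i)) x) / B x"
      by (simp add: \<rho>_def sum_divide_distrib)
    also have "(\<Sum>i<card P. bump (q i) (s (q i)) x) = B x"
      unfolding B_def by (rule sum.reindex_bij_betw[OF q])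
    finally show "(\<Sum>i<card P. \<rho> i x) = 1" using Bpos[OF x] by simp
  qed
  then show ?thesis by blast
qed

text \<open>Every atlas yields the volume integral and some atlas exists, so the description denotes
  it. The form has to agree with the fields \<open>F\<close> on the frontier only; inside
  \<open>D\<close> the fields are free, which admits the regularised kernels.\<close>

lemma boundary_integral_eq:
  fixes D :: "'n::{finite,linorder} cvec set" and F :: "'n \<times> bool \<Rightarrow> 'n cvec \<Rightarrow> 'b::euclidean_space"
  assumes D: "open D" "bounded D" "smooth_boundary D"
    and V: "open V" "closure D \<subseteq> V" and F: "\<And>q. C1_on (F q) (F' q) V"
    and \<omega>: "\<And>Y ws. Y \<in> frontier D \<Longrightarrow> length ws = 2 * CARD('n) - 1 \<Longrightarrow>
      \<omega> Y ws = (\<Sum>q\<in>UNIV. vol_form (dir_vec q # ws) *\<^sub>R F q Y)"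
  shows "boundary_integral D \<omega> = integral D (\<lambda>x. \<Sum>q\<in>UNIV. F' q x (dir_vec q))"
proof -
  define I where "I = integral D (\<lambda>x. \<Sum>q\<in>UNIV. F' q x (dir_vec q))"
  have I: "(\<Sum>i<N. integral (U i) (\<lambda>u. \<rho> i (\<phi> i u) *\<^sub>R \<omega> (\<phi> i u) (tangents (\<phi> i) u))) = I"
    if at: "oriented_atlas D N U \<phi> \<rho>" for N U \<phi> \<rho>
  proof -
    let ?t = "\<lambda>i q u. \<rho> i (\<phi> i u) *\<^sub>R vol_form (dir_vec q # tangents (\<phi> i) u) *\<^sub>R F q (\<phi> i u)"
    note div = divergence_theorem[OF at D V F]
    have "(\<Sum>i<N. integral (U i) (\<lambda>u. \<rho> i (\<phi> i u) *\<^sub>R \<omega> (\<phi> i u) (tangents (\<phi> i) u))) =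
      (\<Sum>i<N. \<Sum>q\<in>UNIV. integral (U i) (\<lambda>u. ?t i q u))"
    proof (rule sum.cong[OF refl])
      fix i assume "i \<in> {..<N}"
      then have i: "i < N" by simp
      have "integral (U i) (\<lambda>u. \<rho> i (\<phi> i u) *\<^sub>R \<omega> (\<phi> i u) (tangents (\<phi> i) u)) =
        integral (U i) (\<lambda>u. \<Sum>q\<in>UNIV. ?t i q u)"
      proof (rule Henstock_Kurzweil_Integration.integral_cong)
        fix u assume "u \<in> U i"
        then have "\<phi> i u \<in> frontier D" by (rule oriented_chartD(4)[OF oriented_atlasD(1)[OF at i]])
        moreover have "length (tangents (\<phi> i) u) = 2 * CARD('n) - 1" unfolding tangents_eq by simp
        ultimately show "\<rho> i (\<phi> i u) *\<^sub>R \<omega> (\<phi> i u) (tangents (\<phi> i) u) =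
          (\<Sum>q\<in>UNIV. ?t i q u)"
          by (simp only: \<omega> scaleR_sum_right)
      qed
      also have "\<dots> = (\<Sum>q\<in>UNIV. integral (U i) (\<lambda>u. ?t i q u))"
        by (rule integral_sum) (use div(1)[OF i] in auto)
      finally show "integral (U i) (\<lambda>u. \<rho> i (\<phi> i u) *\<^sub>R \<omega> (\<phi> i u) (tangents (\<phi> i) u)) =
        (\<Sum>q\<in>UNIV. integral (U i) (\<lambda>u. ?t i q u))" .
    qed
    also have "\<dots> = (\<Sum>q\<in>UNIV. integral D (\<lambda>x. F' q x (dir_vec q)))"
      by (rule trans[OF sum.swap sum.cong[OF refl div(2)]])
    also have "\<dots> = I"
      unfolding I_def by (rule integral_sum[symmetric]) (use div(3) in auto)
    finally show ?thesis .
  qed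
  obtain N U \<phi> \<rho> where at: "oriented_atlas D N U \<phi> \<rho>"
    using atlas_exists[OF D(2,3)] by blast
  show ?thesis
    unfolding boundary_integral_def I_def[symmetric]
  proof (rule the_equality)
    show "\<exists>N U \<phi> \<rho>. oriented_atlas D N U \<phi> \<rho> \<and>
      I = (\<Sum>i<N. integral (U i) (\<lambda>u. \<rho> i (\<phi> i u) *\<^sub>R \<omega> (\<phi> i u) (tangents (\<phi> i) u)))"
      by (intro exI conjI) (rule at, rule I[OF at, symmetric])
    fix J assume "\<exists>N U \<phi> \<rho>. oriented_atlas D N U \<phi> \<rho> \<and>
      J = (\<Sum>i<N. integral (U i) (\<lambda>u. \<rho> i (\<phi> i u) *\<^sub>R \<omega> (\<phi> i u) (tangents (\<phi> i) u)))"
    then show "J = I" by (elim exE conjE) (erule trans, erule I)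
  qed
qed

section \<open>The Witt basis\<close>

lemma bounded_bilinear_cliff: "bounded_bilinear ((\<star>) :: 'n::{finite,linorder} clifford \<Rightarrow> _)"
  unfolding bilinear_conv_bounded_bilinear[symmetric] bilinear_def
  by (auto intro!: linearI simp: vec_eq_iff cliff_mult_def algebra_simps sum.distrib scaleR_sum_right)

lemmas cliff_simps =
  bounded_bilinear.add_left[OF bounded_bilinear_cliff]
  bounded_bilinear.add_right[OF bounded_bilinear_cliff]
  bounded_bilinear.minus_left[OF bounded_bilinear_cliff]
  bounded_bilinear.minus_right[OF bounded_bilinear_cliff]
  bounded_bilinear.diff_left[OF bounded_bilinear_cliff]
  bounded_bilinear.diff_right[OF bounded_bilinear_cliff]
  bounded_bilinear.scaleR_left[OF bounded_bilinear_cliff]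
  bounded_bilinear.scaleR_right[OF bounded_bilinear_cliff]
  bounded_bilinear.zero_left[OF bounded_bilinear_cliff]
  bounded_bilinear.zero_right[OF bounded_bilinear_cliff]

lemmas cliff_sum =
  bounded_bilinear.sum_left[OF bounded_bilinear_cliff]
  bounded_bilinear.sum_right[OF bounded_bilinear_cliff]

lemma cliff_smult_left: "(c *s a) \<star> b = c *s (a \<star> b)" for a b :: "'n::{finite,linorder} clifford"
  by (simp add: vec_eq_iff cliff_mult_def sum_distrib_left mult_ac)

lemma cliff_smult_right: "a \<star> (c *s b) = c *s (a \<star> b)" for a b :: "'n::{finite,linorder} clifford"
  by (simp add: vec_eq_iff cliff_mult_def sum_distrib_left mult_ac)

lemma scaleR_eq_smult: "r *\<^sub>R a = complex_of_real r *s a" for a :: "complex ^ 'k"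
  by (simp add: vec_eq_iff scaleR_conv_of_real[where 'a = complex])

lemma smult_sum_right: "c *s (\<Sum>i\<in>I. f i) = (\<Sum>i\<in>I. c *s f i)" for f :: "_ \<Rightarrow> complex ^ 'k"
  by (simp add: vec_eq_iff sum_distrib_left)

lemma smult_scaleR: "c *s (r *\<^sub>R a) = r *\<^sub>R (c *s a)" for a :: "complex ^ 'k"
  by (simp add: vec_eq_iff)

text \<open>The anticommutator: by bilinearity, relations between Hermitian vector variables reduce
  to relations between generators.\<close>

definition anti :: "'n::{finite,linorder} clifford \<Rightarrow> 'n clifford \<Rightarrow> 'n clifford"
  where "anti a b = a \<star> b + b \<star> a"

lemma anti_add_left: "anti (a + b) c = anti a c + anti b c"
  and anti_add_right: "anti c (a + b) = anti c a + anti c b"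
  and anti_smult_left: "anti (r *s a) c = r *s anti a c"
  and anti_smult_right: "anti c (r *s a) = r *s anti c a"
  by (simp_all add: anti_def cliff_simps cliff_smult_left cliff_smult_right vector_add_ldistrib)

lemma anti_sum:
  "anti (\<Sum>i\<in>I. f i) (\<Sum>j\<in>J. g j) = (\<Sum>i\<in>I. \<Sum>j\<in>J. anti (f i) (g j))"
  unfolding anti_def cliff_sum sum.distrib by (simp add: sum.swap[of _ J I])

lemma anti_gen: "anti (cliff_gen p) (cliff_gen q) = (if p = q then - 2 else 0) *s cliff_one"
  unfolding anti_def by (rule cliff_gen_anticommute)

lemma witt_f_eq: "witt_f k = (- 1 / 2) *s cliff_gen (k, False) + (\<i> / 2) *s cliff_gen (k, True)"
  by (simp add: witt_f_def vec_eq_iff algebra_simps)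

lemma witt_fd_eq: "witt_fd k = (1 / 2) *s cliff_gen (k, False) + (\<i> / 2) *s cliff_gen (k, True)"
  by (simp add: witt_fd_def vec_eq_iff algebra_simps)

text \<open>The Grassmann and duality relations of the Witt basis.\<close>

lemma anti_witt:
  "anti (witt_f j) (witt_f k) = 0"
  "anti (witt_fd j) (witt_fd k) = 0"
  "anti (witt_f j) (witt_fd k) = (if j = k then 1 else 0) *s cliff_one"
  unfolding witt_f_eq witt_fd_eq anti_add_left anti_add_right anti_smult_left anti_smult_right anti_gen
  by (cases "j = k", simp_all add: vec_eq_iff)+

lemma anti_self_0: "anti a a = 0 \<Longrightarrow> a \<star> a = 0"
  by (simp add: anti_def vec_eq_iff)

lemma hvec_hvec: "hvec z \<star> hvec z = 0"
  by (rule anti_self_0)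
    (simp add: hvec_def anti_sum anti_smult_left anti_smult_right anti_witt)

lemma hvec_d_hvec_d: "hvec_d z \<star> hvec_d z = 0"
  by (rule anti_self_0)
    (simp add: hvec_d_def anti_sum anti_smult_left anti_smult_right anti_witt)

lemma hvec_hvec_d: "hvec z \<star> hvec_d z + hvec_d z \<star> hvec z = (z \<bullet> z) *\<^sub>R cliff_one"
proof -
  have "hvec z \<star> hvec_d z + hvec_d z \<star> hvec z = anti (hvec z) (hvec_d z)"
    by (simp add: anti_def)
  also have "\<dots> = (\<Sum>j\<in>UNIV. \<Sum>k\<in>UNIV. if j = k then (z $ j * cnj (z $ j)) *s cliff_one else 0)"
    unfolding hvec_def hvec_d_def anti_sum
    by (intro sum.cong refl) (simp add: anti_smult_left anti_smult_right anti_witt vector_smult_assoc mult.commute)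
  also have "\<dots> = (\<Sum>j\<in>UNIV. (z $ j * cnj (z $ j)) *s cliff_one)"
    by simp
  also have "\<dots> = (\<Sum>j\<in>UNIV. z $ j \<bullet> z $ j) *\<^sub>R cliff_one"
  proof -
    have "z $ j * cnj (z $ j) = of_real (z $ j \<bullet> z $ j)" for j
      by (simp add: complex_mult_cnj inner_complex_def power2_eq_square)
    then show ?thesis
      unfolding scaleR_eq_smult by (simp add: vec_eq_iff sum_distrib_right)
  qed
  finally show ?thesis by (simp add: inner_vec_def)
qed

lemma linear_hvec: "linear hvec" "linear hvec_d"
  by (rule linearI; simp add: hvec_def hvec_d_def vec_eq_iff algebra_simps sum.distrib sum_distrib_left scaleR_sum_right)+

lemma sum_UNIV_bool: "(\<Sum>q\<in>UNIV. f q) = (\<Sum>k\<in>UNIV. f (k, False) + f (k, True))"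
  for f :: "'n::finite \<times> bool \<Rightarrow> 'b::comm_monoid_add"
proof -
  have "(\<Sum>q\<in>UNIV. f q) = (\<Sum>q\<in>UNIV \<times> UNIV. f q)" by simp
  also have "\<dots> = (\<Sum>k\<in>UNIV. \<Sum>b\<in>UNIV. f (k, b))" by (simp add: sum.cartesian_product)
  finally show ?thesis by (simp add: UNIV_bool add.commute)
qed

section \<open>The Hermitian forms in real coordinates\<close>

text \<open>The Clifford coefficient of a real direction. The same coefficients describe
  \<open>dirac_z\<close> and, up to the factor (-2i)^n, \<open>dsigma\<close>; \<open>wzd\<close>
  does this for \<open>dirac_zd\<close> and \<open>dsigma_d\<close>. Hence taking divergences of the
  forms produces the Dirac operators.\<close>

fun wz :: "'n::{finite,linorder} \<times> bool \<Rightarrow> 'n clifford"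
  where
    "wz (k, False) = (1 / 2) *s witt_fd k"
  | "wz (k, True) = (- \<i> / 2) *s witt_fd k"

fun wzd :: "'n::{finite,linorder} \<times> bool \<Rightarrow> 'n clifford"
  where
    "wzd (k, False) = (1 / 2) *s witt_f k"
  | "wzd (k, True) = (\<i> / 2) *s witt_f k"

lemma dsigma_eq:
  fixes ws :: "'n::{finite,linorder} cvec list"
  assumes "length ws = 2 * CARD('n) - 1"
  shows "dsigma ws = (- 2 * \<i>) ^ CARD('n) *s (\<Sum>q\<in>UNIV. vol_form (dir_vec q # ws) *\<^sub>R wz q)"
    and "dsigma_d ws = (- 2 * \<i>) ^ CARD('n) *s (\<Sum>q\<in>UNIV. vol_form (dir_vec q # ws) *\<^sub>R wzd q)"
proof -
  let ?c = "(- 2 * \<i>) ^ CARD('n)"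
  have 1: "hat_form (j, False) ws *s witt_fd j = ?c *s (vol_form (dir_vec (j, False) # ws) *\<^sub>R wz (j, False) +
      vol_form (dir_vec (j, True) # ws) *\<^sub>R wz (j, True))" for j
    unfolding hat_form_eq[OF assms] scaleR_eq_smult wz.simps vec_eq_iff
    by (simp add: algebra_simps)
  have 2: "- (hat_form (j, True) ws *s witt_f j) = ?c *s (vol_form (dir_vec (j, False) # ws) *\<^sub>R wzd (j, False) +
      vol_form (dir_vec (j, True) # ws) *\<^sub>R wzd (j, True))" for j
    unfolding hat_form_eq[OF assms] scaleR_eq_smult wzd.simps vec_eq_iff
    by (simp add: algebra_simps)
  show "dsigma ws = ?c *s (\<Sum>q\<in>UNIV. vol_form (dir_vec q # ws) *\<^sub>R wz q)"
    unfolding dsigma_def sum_UNIV_bool smult_sum_right 1 ..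
  show "dsigma_d ws = ?c *s (\<Sum>q\<in>UNIV. vol_form (dir_vec q # ws) *\<^sub>R wzd q)"
    unfolding dsigma_d_def sum_UNIV_bool smult_sum_right sum_negf[symmetric] 2 ..
qed

lemma dirac_eq:
  "(\<Sum>q\<in>UNIV. wz q \<star> frechet_derivative g (at Y) (dir_vec q)) = dirac_z g Y"
  "(\<Sum>q\<in>UNIV. wzd q \<star> frechet_derivative g (at Y) (dir_vec q)) = dirac_zd g Y"
proof -
  have 1: "wz (k, False) \<star> frechet_derivative g (at Y) (dir_vec (k, False)) +
      wz (k, True) \<star> frechet_derivative g (at Y) (dir_vec (k, True)) = witt_fd k \<star> pderiv_z k g Y" for k
  proof -
    have "pderiv_z k g Y = (1 / 2) *s pderiv_x k g Y + (- \<i> / 2) *s pderiv_y k g Y"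
      by (simp add: pderiv_z_def vec_eq_iff algebra_simps)
    then show ?thesis
      by (simp add: cliff_simps cliff_smult_left cliff_smult_right pderiv_x_def pderiv_y_def)
  qed
  have 2: "wzd (k, False) \<star> frechet_derivative g (at Y) (dir_vec (k, False)) +
      wzd (k, True) \<star> frechet_derivative g (at Y) (dir_vec (k, True)) = witt_f k \<star> pderiv_zc k g Y" for k
  proof -
    have "pderiv_zc k g Y = (1 / 2) *s pderiv_x k g Y + (\<i> / 2) *s pderiv_y k g Y"
      by (simp add: pderiv_zc_def vec_eq_iff algebra_simps)
    then show ?thesis
      by (simp add: cliff_simps cliff_smult_left cliff_smult_right pderiv_x_def pderiv_y_def)
  qed
  show "(\<Sum>q\<in>UNIV. wz q \<star> frechet_derivative g (at Y) (dir_vec q)) = dirac_z g Y"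
    unfolding sum_UNIV_bool 1 dirac_z_def ..
  show "(\<Sum>q\<in>UNIV. wzd q \<star> frechet_derivative g (at Y) (dir_vec q)) = dirac_zd g Y"
    unfolding sum_UNIV_bool 2 dirac_zd_def ..
qed

lemma inner_dir_vec: "z \<bullet> dir_vec (k, False) = Re (z $ k)" "z \<bullet> dir_vec (k, True) = Im (z $ k)"
  by (simp_all add: inner_axis)

text \<open>Since \<open>2 z\<close> is the gradient of |z|^2, these are the Hermitian Dirac
  operators applied to |z|^2. They arise from differentiating the radial factor of a kernel.\<close>

lemma sum_inner_wz:
  "(\<Sum>q\<in>UNIV. (2 * (z \<bullet> dir_vec q)) *\<^sub>R wz q) = hvec_d z"
  "(\<Sum>q\<in>UNIV. (2 * (z \<bullet> dir_vec q)) *\<^sub>R wzd q) = hvec z"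
proof -
  have 1: "(2 * (z \<bullet> dir_vec (k, False))) *\<^sub>R wz (k, False) + (2 * (z \<bullet> dir_vec (k, True))) *\<^sub>R wz (k, True) =
      cnj (z $ k) *s witt_fd k" for k
    unfolding inner_dir_vec by (simp add: vec_eq_iff scaleR_conv_of_real[where 'a = complex] complex_eq_iff)
  have 2: "(2 * (z \<bullet> dir_vec (k, False))) *\<^sub>R wzd (k, False) + (2 * (z \<bullet> dir_vec (k, True))) *\<^sub>R wzd (k, True) =
      (z $ k) *s witt_f k" for k
    unfolding inner_dir_vec by (simp add: vec_eq_iff scaleR_conv_of_real[where 'a = complex] complex_eq_iff)
  show "(\<Sum>q\<in>UNIV. (2 * (z \<bullet> dir_vec q)) *\<^sub>R wz q) = hvec_d z"
    unfolding sum_UNIV_bool 1 hvec_d_def ..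
  show "(\<Sum>q\<in>UNIV. (2 * (z \<bullet> dir_vec q)) *\<^sub>R wzd q) = hvec z"
    unfolding sum_UNIV_bool 2 hvec_def ..
qed

lemma hvec_dir:
  "hvec (dir_vec (k, False)) = witt_f k" "hvec (dir_vec (k, True)) = \<i> *s witt_f k"
  "hvec_d (dir_vec (k, False)) = witt_fd k" "hvec_d (dir_vec (k, True)) = (- \<i>) *s witt_fd k"
proof -
  have "(\<Sum>j\<in>UNIV. (axis k c $ j) *s h j) = c *s h k" for c :: complex and h :: "'a \<Rightarrow> 'a clifford"
  proof -
    have "(\<Sum>j\<in>UNIV. (axis k c $ j) *s h j) = (\<Sum>j\<in>UNIV. if j = k then c *s h k else 0)"
      by (rule sum.cong) (auto simp: axis_def)
    then show ?thesis by simp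
  qed
  moreover have "(\<Sum>j\<in>UNIV. cnj (axis k c $ j) *s h j) = cnj c *s h k" for c :: complex and h :: "'a \<Rightarrow> 'a clifford"
  proof -
    have "(\<Sum>j\<in>UNIV. cnj (axis k c $ j) *s h j) = (\<Sum>j\<in>UNIV. if j = k then cnj c *s h k else 0)"
      by (rule sum.cong) (auto simp: axis_def)
    then show ?thesis by simp
  qed
  ultimately show "hvec (dir_vec (k, False)) = witt_f k" "hvec (dir_vec (k, True)) = \<i> *s witt_f k"
    "hvec_d (dir_vec (k, False)) = witt_fd k" "hvec_d (dir_vec (k, True)) = (- \<i>) *s witt_fd k"
    by (simp_all add: hvec_def hvec_d_def)
qed

text \<open>The divergence due to the linear factor of the kernels. In the first sum each k
  contributes the anticommutator of \<open>witt_f k\<close> and \<open>witt_fd k\<close>, which is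
  1; in the mixed sums the x and y terms cancel.\<close>

lemma sum_hvec_wz:
  "(\<Sum>q\<in>UNIV. hvec (dir_vec q) \<star> wz q) + (\<Sum>q\<in>UNIV. hvec_d (dir_vec q) \<star> wzd q) =
     real CARD('n) *\<^sub>R (cliff_one :: 'n::{finite,linorder} clifford)"
  "(\<Sum>q\<in>UNIV. hvec (dir_vec q) \<star> wzd q) = (0 :: 'n clifford)"
  "(\<Sum>q\<in>UNIV. hvec_d (dir_vec q) \<star> wz q) = (0 :: 'n clifford)"
proof -
  have half: "(1 / 2) *s a + (1 / 2) *s a = a" "(1 / 2) *s a + (- 1 / 2) *s a = 0" for a :: "'n clifford"
    by (simp_all add: vec_eq_iff)
  have 1: "hvec (dir_vec (k, False)) \<star> wz (k, False) + hvec (dir_vec (k, True)) \<star> wz (k, True) = witt_f k \<star> witt_fd k"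
    "hvec_d (dir_vec (k, False)) \<star> wzd (k, False) + hvec_d (dir_vec (k, True)) \<star> wzd (k, True) = witt_fd k \<star> witt_f k"
    "hvec (dir_vec (k, False)) \<star> wzd (k, False) + hvec (dir_vec (k, True)) \<star> wzd (k, True) = 0"
    "hvec_d (dir_vec (k, False)) \<star> wz (k, False) + hvec_d (dir_vec (k, True)) \<star> wz (k, True) = 0" for k :: 'n
    unfolding hvec_dir wz.simps wzd.simps cliff_smult_left cliff_smult_right vector_smult_assoc
    using half by simp_all
  have "(\<Sum>q\<in>UNIV. hvec (dir_vec q) \<star> wz q) + (\<Sum>q\<in>UNIV. hvec_d (dir_vec q) \<star> wzd q) =
      (\<Sum>k\<in>(UNIV :: 'n set). anti (witt_f k) (witt_fd k))"
    unfolding sum_UNIV_bool 1 anti_def sum.distrib ..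
  also have "\<dots> = real CARD('n) *\<^sub>R cliff_one"
    by (simp only: anti_witt refl if_True vector_smult_lid sum_constant_scaleR)
  finally show "(\<Sum>q\<in>UNIV. hvec (dir_vec q) \<star> wz q) + (\<Sum>q\<in>UNIV. hvec_d (dir_vec q) \<star> wzd q) =
     real CARD('n) *\<^sub>R (cliff_one :: 'n clifford)" .
  show "(\<Sum>q\<in>UNIV. hvec (dir_vec q) \<star> wzd q) = (0 :: 'n clifford)"
    "(\<Sum>q\<in>UNIV. hvec_d (dir_vec q) \<star> wz q) = (0 :: 'n clifford)"
    unfolding sum_UNIV_bool 1 by simp_all
qed

section \<open>A regularised kernel\<close>

lemma Ck_on_const: "Ck_on m (\<lambda>x. c) S"
  by (induction m arbitrary: c) auto

text \<open>The defining function |x|^2 - 1 is used off the origin, where its gradient 2x is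
  nonzero.\<close>

lemma smooth_boundary_ball: "smooth_boundary (ball (0 :: 'a::euclidean_space) 1)"
  unfolding smooth_boundary_def
proof
  fix p :: 'a assume "p \<in> frontier (ball 0 1)"
  then have p: "norm p = 1" by (simp add: frontier_ball)
  let ?r = "\<lambda>x :: 'a. x \<bullet> x - 1"
  have d1: "(?r has_derivative (\<lambda>h. 2 * (x \<bullet> h))) (at x)" for x
    by (auto intro!: derivative_eq_intros simp: inner_commute)
  have d2: "((\<lambda>x :: 'a. 2 * (x \<bullet> v)) has_derivative (\<lambda>h. 2 * (h \<bullet> v))) (at x)" for x v
    by (auto intro!: derivative_eq_intros)
  have f1: "frechet_derivative ?r (at x) = (\<lambda>h. 2 * (x \<bullet> h))" for x
    using frechet_derivative_at[OF d1] by simp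
  have f2: "frechet_derivative (\<lambda>x :: 'a. 2 * (x \<bullet> v)) (at x) = (\<lambda>h. 2 * (h \<bullet> v))" for x v
    using frechet_derivative_at[OF d2] by simp
  have Ck2: "Ck_on m (\<lambda>x :: 'a. 2 * (x \<bullet> v)) (- {0})" for m v
  proof (cases m)
    case (Suc k)
    have "(\<lambda>x :: 'a. 2 * (x \<bullet> v)) differentiable at x" for x
      using d2 unfolding differentiable_def by blast
    then show ?thesis by (simp add: Suc f2 Ck_on_const)
  qed (auto intro!: continuous_intros)
  have Ck1: "Ck_on m ?r (- {0})" for m
  proof (cases m)
    case (Suc k)
    have "?r differentiable at x" for x
      using d1 unfolding differentiable_def by blast
    then show ?thesis by (simp add: Suc f1 Ck2)
  qed (auto intro!: continuous_intros)
  have sq: "x \<bullet> x < 1 \<longleftrightarrow> norm x < 1" "x \<bullet> x = 1 \<longleftrightarrow> norm x = 1" for x :: 'a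
    by (simp_all add: norm_eq_sqrt_inner)
  show "\<exists>U (r :: 'a \<Rightarrow> real). open U \<and> p \<in> U \<and> (\<forall>m. Ck_on m r U) \<and>
     (\<forall>q\<in>U. frechet_derivative r (at q) \<noteq> (\<lambda>v. 0)) \<and>
     ball 0 1 \<inter> U = {q\<in>U. r q < 0} \<and> frontier (ball 0 1) \<inter> U = {q\<in>U. r q = 0}"
  proof (intro exI conjI allI ballI)
    show "open (- {0 :: 'a})" by auto
    show "p \<in> - {0}" using p by auto
    show "Ck_on m ?r (- {0})" for m by (rule Ck1)
    show "frechet_derivative ?r (at q) \<noteq> (\<lambda>v. 0)" if "q \<in> - {0}" for q :: 'a
    proof
      assume "frechet_derivative ?r (at q) = (\<lambda>v. 0)"
      then have "2 * (q \<bullet> q) = 0" unfolding f1 by (rule fun_cong)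
      then show False using that by simp
    qed
    show "ball 0 1 \<inter> - {0} = {q \<in> - {0}. ?r q < 0}"
      unfolding set_eq_iff by (simp add: sq(1) conj_commute)
    show "frontier (ball 0 1) \<inter> - {0} = {q \<in> - {0}. ?r q = 0}"
      unfolding set_eq_iff by (simp add: sq(2) frontier_ball conj_commute)
  qed
qed

text \<open>
  \<open>radial n R s\<close> is continuously differentiable and agrees with \<open>s\<^bsup>-n\<^esup>\<close> for \<open>s \<ge> R\<close>.  Replacing
  \<open>|z|\<^bsup>-2n\<^esup>\<close> by \<open>radial n R (|z|\<^sup>2)\<close> removes the singularity of the Cauchy kernels, and \<open>weight n R\<close> is
  the divergence which this creates.
\<close>
definition soft :: "real \<Rightarrow> real \<Rightarrow> real"
  where "soft R s = s + (max 0 (R - s))\<^sup>2 / R"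

definition soft' :: "real \<Rightarrow> real \<Rightarrow> real"
  where "soft' R s = 1 - 2 * max 0 (R - s) / R"

definition radial :: "nat \<Rightarrow> real \<Rightarrow> real \<Rightarrow> real"
  where "radial n R s = inverse (soft R s) ^ n"

definition radial' :: "nat \<Rightarrow> real \<Rightarrow> real \<Rightarrow> real"
  where "radial' n R s = - (real n * soft' R s * inverse (soft R s) ^ (n + 1))"

definition weight :: "nat \<Rightarrow> real \<Rightarrow> real \<Rightarrow> real"
  where "weight n R s = real n * radial n R s + s * radial' n R s"

text \<open>For \<open>s < R\<close>, multiplying by \<open>R\<close> gives the positive definite
  form s^2 - sR + R^2. So the regularised denominator stays positive even at
  \<open>s = 0\<close>.\<close>

lemma soft_pos: "R > 0 \<Longrightarrow> soft R s > 0"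
proof (cases "s \<ge> R")
  case False
  assume R: "R > 0"
  have "R * soft R s = s\<^sup>2 - s * R + R\<^sup>2"
    using R False by (simp add: soft_def max_def power2_eq_square field_simps)
  also have "\<dots> = (s - R / 2)\<^sup>2 + 3 / 4 * R\<^sup>2"
    by (simp add: power2_eq_square algebra_simps)
  also have "\<dots> > 0" using R by (intro add_nonneg_pos) auto
  finally show ?thesis using R by (simp add: zero_less_mult_iff)
qed (auto simp: soft_def max_def)

lemma soft_eq: "s \<ge> R \<Longrightarrow> soft R s = s"
  by (simp add: soft_def max_def)

lemma DERIV_soft: "(soft R has_real_derivative soft' R s) (at s)"
proof -
  have "((\<lambda>s. (max 0 (R - s))\<^sup>2) has_real_derivative 2 * max 0 (R - s) * (- 1)) (at s)"
    by (rule DERIV_chain2[OF DERIV_max_0_square]) (auto intro!: derivative_eq_intros)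
  from DERIV_add[OF DERIV_ident DERIV_cdivide[OF this, of R]] show ?thesis
    unfolding soft_def[abs_def] soft'_def by simp
qed

lemma DERIV_radial: "R > 0 \<Longrightarrow> (radial n R has_real_derivative radial' n R s) (at s)"
proof -
  assume R: "R > 0"
  have nz: "soft R s \<noteq> 0" using soft_pos[OF R, of s] by simp
  have "((\<lambda>s. inverse (soft R s)) has_real_derivative - (inverse (soft R s) * soft' R s * inverse (soft R s))) (at s)"
    by (rule DERIV_inverse'[OF DERIV_soft nz])
  from DERIV_power[OF this, of n] show ?thesis
    unfolding radial_def[abs_def] radial'_def by (cases n) (simp_all add: mult_ac)
qed

lemma continuous_on_soft: "continuous_on S (soft R)"
  unfolding soft_def[abs_def] divide_inverse by (intro continuous_intros)

lemma continuous_on_inverse_soft: "R > 0 \<Longrightarrow> continuous_on S (\<lambda>s. inverse (soft R s))"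
  using soft_pos[of R] by (intro continuous_on_inverse continuous_on_soft) (auto simp: less_imp_neq[symmetric])

lemma continuous_on_radial: "R > 0 \<Longrightarrow> continuous_on S (radial n R)"
  unfolding radial_def[abs_def] by (intro continuous_intros continuous_on_inverse_soft)

lemma continuous_on_radial': "R > 0 \<Longrightarrow> continuous_on S (radial' n R)"
  unfolding radial'_def[abs_def] soft'_def[abs_def] divide_inverse
  by (intro continuous_intros continuous_on_inverse_soft)

text \<open>By Euler's relation s^(-n) itself contributes nothing, so only the correction in
  \<open>soft\<close> is left. The closed form displays the sign for \<open>s \<ge> 0\<close> and
  the vanishing for \<open>s \<ge> R\<close>, on which the mean value argument rests.\<close>

lemma weight_eq:
  assumes "R > 0"
  shows "weight n R s = real n * inverse (soft R s) ^ (n + 1) * (max 0 (R - s) * (R + s) / R)"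
proof -
  have nz: "soft R s \<noteq> 0" using soft_pos[OF assms, of s] by simp
  have "soft R s - s * soft' R s = max 0 (R - s) * (R + s) / R"
    using assms by (simp add: soft_def soft'_def max_def power2_eq_square field_simps)
  moreover have "inverse (soft R s) ^ n = inverse (soft R s) ^ (n + 1) * soft R s"
    using nz by simp
  ultimately show ?thesis
    unfolding weight_def radial_def radial'_def by (simp only: flip: \<open>_ = max 0 (R - s) * (R + s) / R\<close>) (simp add: algebra_simps)
qed

lemma weight_nonneg: "R > 0 \<Longrightarrow> s \<ge> 0 \<Longrightarrow> weight n R s \<ge> 0"
  using soft_pos[of R s] by (simp add: weight_eq)

lemma weight_eq_0: "R > 0 \<Longrightarrow> s \<ge> R \<Longrightarrow> weight n R s = 0"
  by (simp add: weight_eq max_def)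

lemma continuous_on_weight:
  assumes "R > 0" shows "continuous_on S (\<lambda>Y :: 'a::euclidean_space. weight n R ((Y - X) \<bullet> (Y - X)))"
proof -
  have "continuous_on UNIV (weight n R)"
    unfolding weight_def[abs_def] using assms
    by (intro continuous_intros continuous_on_radial continuous_on_radial')
  then show ?thesis
    by (rule continuous_on_compose2) (auto intro!: continuous_intros)
qed

lemma C1_on_radial:
  fixes X :: "'a::euclidean_space"
  assumes "R > 0"
  shows "C1_on (\<lambda>Y. radial n R ((Y - X) \<bullet> (Y - X)))
    (\<lambda>Y h. radial' n R ((Y - X) \<bullet> (Y - X)) * (2 * ((Y - X) \<bullet> h))) S"
  by (rule C1_on_compose_real[OF C1_on_norm_square DERIV_radial[OF assms] continuous_on_radial'[OF assms]])

section \<open>The area of the sphere\<close>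

lemma sum_dir_vec: "(\<Sum>q\<in>UNIV. f (dir_vec q)) = (\<Sum>b\<in>(Basis :: 'n::{finite,linorder} cvec set). f b)"
  unfolding Basis_cvec by (subst sum.reindex[OF inj_dir_vec]) simp

lemma vol_form_expand:
  fixes ws :: "'n::{finite,linorder} cvec list"
  assumes "length ws = 2 * CARD('n) - 1"
  shows "vol_form (p # ws) = (\<Sum>q\<in>UNIV. vol_form (dir_vec q # ws) *\<^sub>R (p \<bullet> dir_vec q))"
proof -
  have "vol_form (p # ws) = vol_form ((\<Sum>b\<in>Basis. (p \<bullet> b) *\<^sub>R b) # ws)"
    by (simp add: euclidean_representation)
  also have "\<dots> = (\<Sum>b\<in>Basis. (p \<bullet> b) * vol_form (b # ws))"
    by (simp add: linear_sum[OF linear_vol_form[OF assms]] linear_scale[OF linear_vol_form[OF assms]])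
  also have "\<dots> = (\<Sum>q\<in>UNIV. vol_form (dir_vec q # ws) *\<^sub>R (p \<bullet> dir_vec q))"
    using sum_dir_vec[where f = "\<lambda>b. (p \<bullet> b) * vol_form (b # ws)"] by (simp add: mult.commute)
  finally show ?thesis .
qed

text \<open>On the unit sphere the normal field Y may be multiplied by any \<sigma> that equals 1
  there. The constant 1 gives 2n times the volume of the ball; a radial \<sigma> gives the mass of
  the weight.\<close>

lemma sphere_area_radial:
  fixes \<sigma> :: "'n::{finite,linorder} cvec \<Rightarrow> real"
  assumes \<sigma>: "C1_on \<sigma> \<sigma>' UNIV" and one: "\<And>Y. norm Y = 1 \<Longrightarrow> \<sigma> Y = 1"
  shows "sphere_area TYPE('n) = integral (ball (0 :: 'n cvec) 1)
    (\<lambda>Y. \<Sum>q\<in>UNIV. \<sigma> Y * (dir_vec q \<bullet> dir_vec q) + \<sigma>' Y (dir_vec q) * (Y \<bullet> dir_vec q))"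
  unfolding sphere_area_def
proof (rule boundary_integral_eq[where V = UNIV and F = "\<lambda>q Y. \<sigma> Y * (Y \<bullet> dir_vec q)"
      and F' = "\<lambda>q Y h. \<sigma> Y * (h \<bullet> dir_vec q) + \<sigma>' Y h * (Y \<bullet> dir_vec q)"])
  show "smooth_boundary (ball (0 :: 'n cvec) 1)" by (rule smooth_boundary_ball)
  show "C1_on (\<lambda>Y. \<sigma> Y * (Y \<bullet> dir_vec q)) (\<lambda>Y h. \<sigma> Y * (h \<bullet> dir_vec q) + \<sigma>' Y h * (Y \<bullet> dir_vec q)) UNIV" for q
    by (rule C1_on_mult[OF \<sigma> C1_on_linear_fun]) (rule bounded_linear_inner_left)
  fix Y :: "'n cvec" and ws :: "'n cvec list"
  assume "Y \<in> frontier (ball 0 1)" and len: "length ws = 2 * CARD('n) - 1"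
  then have "\<sigma> Y = 1" by (intro one) (simp add: frontier_ball)
  then show "vol_form (Y # ws) = (\<Sum>q\<in>UNIV. vol_form (dir_vec q # ws) *\<^sub>R (\<sigma> Y * (Y \<bullet> dir_vec q)))"
    by (subst vol_form_expand[OF len]) simp
qed auto

lemma sum_dir_vec_inner: "(\<Sum>q\<in>UNIV. dir_vec q \<bullet> (dir_vec q :: 'n::{finite,linorder} cvec)) = 2 * real CARD('n)"
  using sum_dir_vec[where f = "\<lambda>b. b \<bullet> (b :: 'n cvec)"] by simp

lemma sphere_area_pos: "sphere_area TYPE('n::{finite,linorder}) > 0"
proof -
  have "sphere_area TYPE('n) = integral (ball (0 :: 'n cvec) 1) (\<lambda>Y. 2 * real CARD('n))"
    using sphere_area_radial[OF C1_on_const[of 1], where 'n = 'n] by (simp add: sum_dir_vec_inner)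
  also have "\<dots> = integral (ball (0 :: 'n cvec) 1) (\<lambda>Y. 2 * real CARD('n) * 1)"
    by (simp only: mult_1_right)
  also have "\<dots> = 2 * real CARD('n) * integral (ball (0 :: 'n cvec) 1) (\<lambda>Y. 1)"
    by (rule Henstock_Kurzweil_Integration.integral_mult_right)
  also have "\<dots> = 2 * real CARD('n) * measure lebesgue (ball (0 :: 'n cvec) 1)"
    by (simp only: lmeasure_integral[OF lmeasurable_ball])
  finally show ?thesis using content_ball_pos[of 1 "0 :: 'n cvec"] by simp
qed

text \<open>In dimension 2n the field Y times the radial factor has divergence 2n radial + 2 |Y|^2
  radial', twice the weight; hence half the area. The bound \<open>R \<le> 1\<close> makes the field
  equal to Y on the sphere.\<close>

lemma integral_weight_ball:
  assumes R: "0 < R" "R \<le> 1"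
  shows "integral (ball (0 :: 'n::{finite,linorder} cvec) 1) (\<lambda>Y. weight CARD('n) R (Y \<bullet> Y)) = sphere_area TYPE('n) / 2"
proof -
  let ?n = "CARD('n)"
  note C1 = C1_on_radial[OF R(1), of ?n "0 :: 'n cvec" UNIV, simplified]
  have "sphere_area TYPE('n) = integral (ball (0 :: 'n cvec) 1) (\<lambda>Y. \<Sum>q\<in>UNIV. radial ?n R (Y \<bullet> Y) * (dir_vec q \<bullet> dir_vec q) +
      radial' ?n R (Y \<bullet> Y) * (2 * (Y \<bullet> dir_vec q)) * (Y \<bullet> dir_vec q))"
  proof (rule sphere_area_radial[OF C1])
    fix Y :: "'n cvec" assume "norm Y = 1"
    then have "Y \<bullet> Y = 1" by (simp add: norm_eq_1)
    then show "radial ?n R (Y \<bullet> Y) = 1" using R by (simp add: radial_def soft_eq)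
  qed
  also have "\<dots> = integral (ball (0 :: 'n cvec) 1) (\<lambda>Y. 2 * weight ?n R (Y \<bullet> Y))"
  proof (rule arg_cong[where f = "integral _"], rule ext)
    fix Y :: "'n cvec"
    have "(\<Sum>q\<in>UNIV. (Y \<bullet> dir_vec q) * (Y \<bullet> dir_vec q)) = Y \<bullet> Y"
      using sum_dir_vec[where f = "\<lambda>b. (Y \<bullet> b) * (Y \<bullet> b)"] by (simp flip: euclidean_inner)
    moreover have "(\<Sum>q\<in>UNIV. radial ?n R (Y \<bullet> Y) * (dir_vec q \<bullet> (dir_vec q :: 'n cvec)) +
        radial' ?n R (Y \<bullet> Y) * (2 * (Y \<bullet> dir_vec q)) * (Y \<bullet> dir_vec q)) =
      radial ?n R (Y \<bullet> Y) * (\<Sum>q\<in>UNIV. dir_vec q \<bullet> (dir_vec q :: 'n cvec)) +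
      2 * radial' ?n R (Y \<bullet> Y) * (\<Sum>q\<in>UNIV. (Y \<bullet> dir_vec q) * (Y \<bullet> dir_vec q))"
      unfolding sum.distrib sum_distrib_left by (simp add: mult_ac)
    ultimately show "(\<Sum>q\<in>UNIV. radial ?n R (Y \<bullet> Y) * (dir_vec q \<bullet> (dir_vec q :: 'n cvec)) +
        radial' ?n R (Y \<bullet> Y) * (2 * (Y \<bullet> dir_vec q)) * (Y \<bullet> dir_vec q)) = 2 * weight ?n R (Y \<bullet> Y)"
      by (simp add: weight_def sum_dir_vec_inner)
  qed
  finally show ?thesis by simp
qed

lemma integral_translate:
  fixes f :: "'a::euclidean_space \<Rightarrow> real"
  assumes "continuous_on UNIV f"
  shows "integral (ball X 1) (\<lambda>Y. f (Y - X)) = integral (ball 0 1) f"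
proof -
  have int: "set_integrable lborel (ball 0 1) f"
    by (rule set_integrable_C1_closure[of "ball 0 1" UNIV]) (use assms in auto)
  have c: "continuous_on UNIV (\<lambda>Y. f (Y - X))"
    by (rule continuous_on_compose2[OF assms]) (auto intro!: continuous_intros)
  have int': "set_integrable lborel (ball X 1) (\<lambda>Y. f (Y - X))"
    by (rule set_integrable_C1_closure[of "ball X 1" UNIV]) (use c in auto)
  have "(LINT Y:ball X 1|lborel. f (Y - X)) = (\<integral>Y. indicator (ball X 1) Y *\<^sub>R f (Y - X) \<partial>distr lborel borel ((+) X))"
    unfolding set_lebesgue_integral_def lborel_distr_plus ..
  also have "\<dots> = (\<integral>Y. indicator (ball X 1) (X + Y) *\<^sub>R f (X + Y - X) \<partial>lborel)"
    using int' by (intro integral_distr) (auto simp: set_integrable_def)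
  also have "\<dots> = (LINT Y:ball 0 1|lborel. f Y)"
    unfolding set_lebesgue_integral_def
    by (intro Bochner_Integration.integral_cong) (auto simp: indicator_def dist_norm)
  finally show ?thesis
    using set_borel_integral_eq_integral(2)[OF int] set_borel_integral_eq_integral(2)[OF int'] by simp
qed

text \<open>The weight vanishes off the ball of radius \<open>d\<close>, which lies in
  \<open>D\<close> and, as \<open>d \<le> 1\<close>, in the unit ball around \<open>X\<close>. So
  \<open>D\<close> may be exchanged for that unit ball, which is then translated to the
  origin.\<close>

lemma integral_weight:
  fixes X :: "'n::{finite,linorder} cvec"
  assumes d: "0 < d" "d \<le> 1" and D: "ball X d \<subseteq> D"
  shows "integral D (\<lambda>Y. weight CARD('n) (d\<^sup>2) ((Y - X) \<bullet> (Y - X))) = sphere_area TYPE('n) / 2"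
proof -
  let ?w = "\<lambda>Y. weight CARD('n) (d\<^sup>2) ((Y - X) \<bullet> (Y - X))"
  have R: "0 < d\<^sup>2" "d\<^sup>2 \<le> 1" using d by (auto simp: power_le_one)
  have w0: "?w Y = 0" if "Y \<notin> ball X d" for Y
  proof (rule weight_eq_0[OF R(1)])
    have "d \<le> norm (Y - X)" using that by (simp add: dist_norm norm_minus_commute)
    then have "d\<^sup>2 \<le> (norm (Y - X))\<^sup>2" using d by (intro power_mono) auto
    then show "d\<^sup>2 \<le> (Y - X) \<bullet> (Y - X)" by (simp add: power2_norm_eq_inner)
  qed
  have "integral D ?w = integral UNIV (\<lambda>Y. if Y \<in> D then ?w Y else 0)"
    by (rule integral_restrict_UNIV[symmetric])
  also have "(\<lambda>Y. if Y \<in> D then ?w Y else 0) = (\<lambda>Y. if Y \<in> ball X 1 then ?w Y else 0)"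
  proof
    fix Y
    show "(if Y \<in> D then ?w Y else 0) = (if Y \<in> ball X 1 then ?w Y else 0)"
    proof (cases "Y \<in> ball X d")
      case True
      then have "Y \<in> D" "Y \<in> ball X 1" using D d by auto
      then show ?thesis by simp
    qed (use w0 in simp)
  qed
  also have "integral UNIV \<dots> = integral (ball X 1) ?w"
    by (rule integral_restrict_UNIV)
  also have "\<dots> = integral (ball (0 :: 'n cvec) 1) (\<lambda>Y. weight CARD('n) (d\<^sup>2) (Y \<bullet> Y))"
    using integral_translate[of "\<lambda>Y :: 'n cvec. weight CARD('n) (d\<^sup>2) (Y \<bullet> Y)" X]
      continuous_on_weight[OF R(1), of UNIV "CARD('n)" "0 :: 'n cvec"] by simp
  also have "\<dots> = sphere_area TYPE('n) / 2" by (rule integral_weight_ball[OF R])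
  finally show ?thesis .
qed

section \<open>The Cauchy formula\<close>

text \<open>The regularised Cauchy kernel without its constant \<open>2 / sphere_area\<close>;
  \<open>P\<close> will be \<open>hvec\<close> or \<open>hvec_d\<close>.\<close>

definition kern :: "('n cvec \<Rightarrow> 'n clifford) \<Rightarrow> real \<Rightarrow> 'n::{finite,linorder} cvec \<Rightarrow> 'n cvec \<Rightarrow> 'n clifford"
  where "kern P R X Y = radial CARD('n) R ((Y - X) \<bullet> (Y - X)) *\<^sub>R P (Y - X)"

definition kern' :: "('n cvec \<Rightarrow> 'n clifford) \<Rightarrow> real \<Rightarrow> 'n::{finite,linorder} cvec \<Rightarrow> 'n cvec \<Rightarrow> 'n cvec \<Rightarrow> 'n clifford"
  where "kern' P R X Y h = radial CARD('n) R ((Y - X) \<bullet> (Y - X)) *\<^sub>R P h +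
    (radial' CARD('n) R ((Y - X) \<bullet> (Y - X)) * (2 * ((Y - X) \<bullet> h))) *\<^sub>R P (Y - X)"

lemma C1_on_kern:
  fixes P :: "'n::{finite,linorder} cvec \<Rightarrow> 'n clifford"
  assumes "linear P" "R > 0"
  shows "C1_on (kern P R X) (kern' P R X) S"
proof -
  have bl: "bounded_linear P" using assms(1) by (simp add: linear_conv_bounded_linear)
  have "C1_on (\<lambda>Y. P (Y - X)) (\<lambda>Y. P) S"
    unfolding C1_on_def
  proof (intro conjI ballI allI)
    fix Y
    have "((\<lambda>Y. Y - X) has_derivative (\<lambda>h. h)) (at Y)" by (auto intro!: derivative_eq_intros)
    then show "((\<lambda>Y. P (Y - X)) has_derivative P) (at Y)"
      by (rule bounded_linear.has_derivative[OF bl])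
  qed auto
  from C1_on_bilinear[OF bounded_bilinear_scaleR C1_on_radial[OF assms(2)] this]
  show ?thesis unfolding kern_def[abs_def] kern'_def[abs_def] .
qed

text \<open>The component in direction \<open>q\<close> of the field whose flux is the boundary
  form, constants aside. The parameters \<open>P\<close> and \<open>w\<close> cover all four
  pairings of a kernel with a surface form.\<close>

definition cauchy_field where
  "cauchy_field P w R X g q Y = (kern P R X Y \<star> w q) \<star> g Y"

definition cauchy_field' where
  "cauchy_field' P w R X g g' q Y h = (kern P R X Y \<star> w q) \<star> g' Y h + (kern' P R X Y h \<star> w q) \<star> g Y"

lemma C1_on_cauchy_field:
  fixes P :: "'n::{finite,linorder} cvec \<Rightarrow> 'n clifford"
  assumes "linear P" "R > 0" "C1_on g g' S"
  shows "C1_on (cauchy_field P w R X g q) (cauchy_field' P w R X g g' q) S"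
proof -
  have "linear (\<lambda>a. a \<star> w q)"
    using bounded_bilinear.bounded_linear_left[OF bounded_bilinear_cliff, of "w q"]
    by (simp add: linear_conv_bounded_linear)
  from C1_on_bilinear[OF bounded_bilinear_cliff C1_on_linear_compose[OF C1_on_kern[OF assms(1,2)] this] assms(3)]
  show ?thesis unfolding cauchy_field_def[abs_def] cauchy_field'_def[abs_def] .
qed

text \<open>Product rule with three contributions: a Dirac operator acting on \<open>g\<close>, the
  derivative of the linear factor \<open>P\<close>, and the derivative of the radial factor along
  the gradient of |Y - X|^2.\<close>

lemma cauchy_field_divergence:
  fixes P :: "'n::{finite,linorder} cvec \<Rightarrow> 'n clifford"
  shows "(\<Sum>q\<in>UNIV. cauchy_field' P w R X g g' q Y (dir_vec q)) =
    kern P R X Y \<star> (\<Sum>q\<in>UNIV. w q \<star> g' Y (dir_vec q)) +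
    (radial CARD('n) R ((Y - X) \<bullet> (Y - X)) *\<^sub>R (\<Sum>q\<in>UNIV. P (dir_vec q) \<star> w q) +
     radial' CARD('n) R ((Y - X) \<bullet> (Y - X)) *\<^sub>R (P (Y - X) \<star> (\<Sum>q\<in>UNIV. (2 * ((Y - X) \<bullet> dir_vec q)) *\<^sub>R w q))) \<star> g Y"
  unfolding cauchy_field'_def kern'_def sum.distrib cliff_simps cliff_sum scaleR_sum_right
  by (simp add: cliff_mult_assoc mult_ac)

lemma cauchy_form_expand:
  fixes P :: "'n::{finite,linorder} cvec \<Rightarrow> 'n clifford"
  assumes K: "K = k *\<^sub>R kern P R X Y" and s: "S = c *s (\<Sum>q\<in>UNIV. vol_form (dir_vec q # ws) *\<^sub>R w q)"
  shows "(K \<star> S) \<star> g Y = (\<Sum>q\<in>UNIV. vol_form (dir_vec q # ws) *\<^sub>R (k *\<^sub>R (c *s cauchy_field P w R X g q Y)))"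
  unfolding K s cauchy_field_def
  by (simp add: cliff_simps cliff_smult_left cliff_smult_right cliff_sum smult_sum_right smult_scaleR
      scaleR_sum_right mult.commute)

lemma kernel_eq:
  assumes "R > 0" "R \<le> (Y - X) \<bullet> (Y - X)"
  shows "E_kernel (Y - X) = (2 / sphere_area TYPE('n)) *\<^sub>R kern hvec R X (Y :: 'n::{finite,linorder} cvec)"
    and "E_kernel_d (Y - X) = (2 / sphere_area TYPE('n)) *\<^sub>R kern hvec_d R X Y"
proof -
  have "radial CARD('n) R ((Y - X) \<bullet> (Y - X)) = 1 / norm (Y - X) ^ (2 * CARD('n))"
    using assms unfolding radial_def soft_eq[OF assms(2)]
    by (simp add: power_mult power2_norm_eq_inner power_inverse inverse_eq_divide power_one_over)
  then show "E_kernel (Y - X) = (2 / sphere_area TYPE('n)) *\<^sub>R kern hvec R X Y"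
     "E_kernel_d (Y - X) = (2 / sphere_area TYPE('n)) *\<^sub>R kern hvec_d R X Y"
    by (simp_all add: E_kernel_def E_kernel_d_def kern_def)
qed

lemma hermitian_monogenicD:
  assumes "hermitian_monogenic_on \<Omega> g"
  shows "C1_on g (\<lambda>x. frechet_derivative g (at x)) \<Omega>"
    "\<And>Y. Y \<in> \<Omega> \<Longrightarrow> dirac_z g Y = 0" "\<And>Y. Y \<in> \<Omega> \<Longrightarrow> dirac_zd g Y = 0"
  using assms unfolding hermitian_monogenic_on_def Ck_on_1_iff by auto

context
  fixes g :: "'n::{finite,linorder} cvec \<Rightarrow> 'n clifford"
    and \<Omega> D :: "'n cvec set" and X :: "'n cvec"
  assumes \<Omega>: "open \<Omega>" and g: "hermitian_monogenic_on \<Omega> g"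
    and D: "open D" "bounded D" "smooth_boundary D" and D\<Omega>: "closure D \<subseteq> \<Omega>"
begin

abbreviation (input) "g' \<equiv> \<lambda>x. frechet_derivative g (at x)"
abbreviation (input) "scal (v :: 'n clifford) \<equiv> (2 / sphere_area TYPE('n)) *\<^sub>R ((- 2 * \<i>) ^ CARD('n) *s v)"

lemma linear_scal: "linear (\<lambda>v :: 'n clifford. scal v)"
  by (rule linearI) (simp_all add: vec_eq_iff algebra_simps)

lemma frontier_dist:
  assumes "ball X d \<subseteq> D" "d > 0" "Y \<in> frontier D"
  shows "d\<^sup>2 \<le> (Y - X) \<bullet> (Y - X)"
proof -
  have "Y \<notin> D" using assms(3) D(1) by (simp add: frontier_def interior_open)
  then have "Y \<notin> ball X d" using assms(1) by blast
  then have "d \<le> norm (Y - X)" by (simp add: dist_norm norm_minus_commute)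
  then have "d\<^sup>2 \<le> (norm (Y - X))\<^sup>2" using assms(2) by (intro power_mono) auto
  then show ?thesis by (simp add: power2_norm_eq_inner)
qed

text \<open>In both mixed pairings the three contributions to the divergence vanish separately:
  through the Dirac equations for \<open>g\<close>, by cancellation of x and y terms, and because
  Hermitian vectors square to zero.\<close>

lemma vanishing_integral:
  assumes d: "ball X d \<subseteq> D" "d > 0" and P: "linear P"
    and K: "\<And>Y. Y \<in> frontier D \<Longrightarrow> K Y = (2 / sphere_area TYPE('n)) *\<^sub>R kern P (d\<^sup>2) X Y"
    and S: "\<And>ws :: 'n cvec list. length ws = 2 * CARD('n) - 1 \<Longrightarrow>
      S ws = (- 2 * \<i>) ^ CARD('n) *s (\<Sum>q\<in>UNIV. vol_form (dir_vec q # ws) *\<^sub>R w q)"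
    and w: "\<And>Y. Y \<in> \<Omega> \<Longrightarrow> (\<Sum>q\<in>UNIV. w q \<star> g' Y (dir_vec q)) = 0"
    and Pw: "(\<Sum>q\<in>UNIV. P (dir_vec q) \<star> w q) = 0"
      "\<And>z. P z \<star> (\<Sum>q\<in>UNIV. (2 * (z \<bullet> dir_vec q)) *\<^sub>R w q) = 0"
  shows "boundary_integral D (\<lambda>Y ws. K Y \<star> S ws \<star> g Y) = 0"
proof -
  have R: "d\<^sup>2 > 0" using d by simp
  have "boundary_integral D (\<lambda>Y ws. K Y \<star> S ws \<star> g Y) =
      integral D (\<lambda>Y. \<Sum>q\<in>UNIV. scal (cauchy_field' P w (d\<^sup>2) X g g' q Y (dir_vec q)))"
  proof (rule boundary_integral_eq[OF D \<Omega> D\<Omega>])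
    show "C1_on (\<lambda>Y. scal (cauchy_field P w (d\<^sup>2) X g q Y))
      (\<lambda>Y h. scal (cauchy_field' P w (d\<^sup>2) X g g' q Y h)) \<Omega>" for q
      by (rule C1_on_linear_compose[OF C1_on_cauchy_field[OF P R hermitian_monogenicD(1)[OF g]] linear_scal])
    fix Y and ws :: "'n cvec list"
    assume Y: "Y \<in> frontier D" and len: "length ws = 2 * CARD('n) - 1"
    show "K Y \<star> S ws \<star> g Y = (\<Sum>q\<in>UNIV. vol_form (dir_vec q # ws) *\<^sub>R scal (cauchy_field P w (d\<^sup>2) X g q Y))"
      by (rule cauchy_form_expand[OF K[OF Y] S[OF len]])
  qed
  also have "\<dots> = integral D (\<lambda>Y. 0)"
  proof (rule Henstock_Kurzweil_Integration.integral_cong)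
    fix Y assume "Y \<in> D"
    then have Y: "Y \<in> \<Omega>" using D\<Omega> closure_subset by blast
    have "(\<Sum>q\<in>UNIV. cauchy_field' P w (d\<^sup>2) X g g' q Y (dir_vec q)) = 0"
      unfolding cauchy_field_divergence Pw w[OF Y] by (simp add: cliff_simps)
    then show "(\<Sum>q\<in>UNIV. scal (cauchy_field' P w (d\<^sup>2) X g g' q Y (dir_vec q))) = 0"
      unfolding linear_sum[OF linear_scal, symmetric] by (simp only: linear_0[OF linear_scal])
  qed
  finally show ?thesis by simp
qed

lemma vanishing_integrals:
  assumes d: "ball X d \<subseteq> D" "d > 0"
  shows "boundary_integral D (\<lambda>Y ws. E_kernel (Y - X) \<star> dsigma_d ws \<star> g Y) = 0"
    and "boundary_integral D (\<lambda>Y ws. E_kernel_d (Y - X) \<star> dsigma ws \<star> g Y) = 0"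
proof -
  have R: "d\<^sup>2 > 0" using d by simp
  note K = kernel_eq[OF R frontier_dist[OF d]] and simps = sum_hvec_wz sum_inner_wz dirac_eq
    hvec_hvec hvec_d_hvec_d hermitian_monogenicD(2,3)[OF g]
  show "boundary_integral D (\<lambda>Y ws. E_kernel (Y - X) \<star> dsigma_d ws \<star> g Y) = 0"
    by (rule vanishing_integral[OF d linear_hvec(1) K(1) dsigma_eq(2)]) (simp_all add: simps)
  show "boundary_integral D (\<lambda>Y ws. E_kernel_d (Y - X) \<star> dsigma ws \<star> g Y) = 0"
    by (rule vanishing_integral[OF d linear_hvec(2) K(2) dsigma_eq(1)]) (simp_all add: simps)
qed

abbreviation (input) "wgt d \<equiv> \<lambda>Y. weight CARD('n) (d\<^sup>2) ((Y - X) \<bullet> (Y - X))"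

lemma weight_integrable:
  fixes h :: "'n cvec \<Rightarrow> 'b::euclidean_space"
  assumes "d > 0" and h: "continuous_on \<Omega> h"
  shows "(\<lambda>Y. wgt d Y *\<^sub>R h Y) integrable_on D"
proof -
  have "continuous_on \<Omega> (\<lambda>Y. wgt d Y *\<^sub>R h Y)"
    using assms by (intro continuous_on_scaleR continuous_on_weight h) auto
  from set_integrable_C1_closure[OF D(2) D\<Omega> this, of D] show ?thesis
    using D(1) by (intro set_borel_integral_eq_integral(1)) auto
qed

text \<open>Neither pairing alone leaves a scalar, but their sum does: the linear factors add up to
  n and the products of Hermitian vectors to |z|^2, and these combine to the weight.\<close>

lemma boundary_integral_weight:
  assumes d: "ball X d \<subseteq> D" "d > 0"
  shows "boundary_integral D (\<lambda>Y ws. (E_kernel_d (Y - X) \<star> dsigma_d ws + E_kernel (Y - X) \<star> dsigma ws) \<star> g Y) =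
    scal (integral D (\<lambda>Y. wgt d Y *\<^sub>R g Y))"
proof -
  have R: "d\<^sup>2 > 0" using d by simp
  note gD = hermitian_monogenicD[OF g]
  have D_sub: "D \<subseteq> \<Omega>" using D\<Omega> closure_subset by blast
  let ?F = "\<lambda>q Y. cauchy_field hvec_d wzd (d\<^sup>2) X g q Y + cauchy_field hvec wz (d\<^sup>2) X g q Y"
  let ?F' = "\<lambda>q Y h. cauchy_field' hvec_d wzd (d\<^sup>2) X g g' q Y h + cauchy_field' hvec wz (d\<^sup>2) X g g' q Y h"
  have "boundary_integral D (\<lambda>Y ws. (E_kernel_d (Y - X) \<star> dsigma_d ws + E_kernel (Y - X) \<star> dsigma ws) \<star> g Y) =
      integral D (\<lambda>Y. \<Sum>q\<in>UNIV. scal (?F' q Y (dir_vec q)))"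
  proof (rule boundary_integral_eq[OF D \<Omega> D\<Omega>])
    show "C1_on (\<lambda>Y. scal (?F q Y)) (\<lambda>Y h. scal (?F' q Y h)) \<Omega>" for q
      by (intro C1_on_linear_compose[OF C1_on_add linear_scal] C1_on_cauchy_field linear_hvec R gD(1))
    fix Y and ws :: "'n cvec list"
    assume Y: "Y \<in> frontier D" and len: "length ws = 2 * CARD('n) - 1"
    note fd = frontier_dist[OF d Y]
    show "(E_kernel_d (Y - X) \<star> dsigma_d ws + E_kernel (Y - X) \<star> dsigma ws) \<star> g Y =
      (\<Sum>q\<in>UNIV. vol_form (dir_vec q # ws) *\<^sub>R scal (?F q Y))"
      unfolding bounded_bilinear.add_left[OF bounded_bilinear_cliff]
        cauchy_form_expand[OF kernel_eq(1)[OF R fd] dsigma_eq(1)[OF len]]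
        cauchy_form_expand[OF kernel_eq(2)[OF R fd] dsigma_eq(2)[OF len]]
        linear_add[OF linear_scal] scaleR_add_right sum.distrib ..
  qed
  also have "\<dots> = integral D (\<lambda>Y. scal (wgt d Y *\<^sub>R g Y))"
  proof (rule Henstock_Kurzweil_Integration.integral_cong)
    fix Y assume "Y \<in> D"
    then have Y: "Y \<in> \<Omega>" using D_sub by blast
    let ?z = "Y - X"
    let ?m = "radial CARD('n) (d\<^sup>2) (?z \<bullet> ?z)" and ?m' = "radial' CARD('n) (d\<^sup>2) (?z \<bullet> ?z)"
    have "(\<Sum>q\<in>UNIV. ?F' q Y (dir_vec q)) =
       (?m *\<^sub>R (\<Sum>q\<in>UNIV. hvec_d (dir_vec q) \<star> wzd q) + ?m' *\<^sub>R (hvec_d ?z \<star> hvec ?z)) \<star> g Y +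
       (?m *\<^sub>R (\<Sum>q\<in>UNIV. hvec (dir_vec q) \<star> wz q) + ?m' *\<^sub>R (hvec ?z \<star> hvec_d ?z)) \<star> g Y"
      unfolding sum.distrib cauchy_field_divergence sum_inner_wz dirac_eq gD(2)[OF Y] gD(3)[OF Y]
      by (simp add: cliff_simps)
    also have "\<dots> = (?m *\<^sub>R ((\<Sum>q\<in>UNIV. hvec (dir_vec q) \<star> wz q) + (\<Sum>q\<in>UNIV. hvec_d (dir_vec q) \<star> wzd q)) +
        ?m' *\<^sub>R (hvec ?z \<star> hvec_d ?z + hvec_d ?z \<star> hvec ?z)) \<star> g Y"
      unfolding bounded_bilinear.add_left[OF bounded_bilinear_cliff, symmetric] scaleR_add_right
      by (simp only: add_ac)
    also have "\<dots> = (wgt d Y *\<^sub>R cliff_one) \<star> g Y"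
      unfolding sum_hvec_wz hvec_hvec_d weight_def by (simp add: scaleR_left_distrib mult.commute)
    also have "\<dots> = wgt d Y *\<^sub>R g Y"
      by (simp add: cliff_simps cliff_one_left)
    finally show "(\<Sum>q\<in>UNIV. scal (?F' q Y (dir_vec q))) = scal (wgt d Y *\<^sub>R g Y)"
      unfolding linear_sum[OF linear_scal, symmetric] by (simp only:)
  qed
  also have "\<dots> = scal (integral D (\<lambda>Y. wgt d Y *\<^sub>R g Y))"
    using integral_linear[OF weight_integrable[OF d(2) C1_on_continuous[OF gD(1)]], of "\<lambda>v. scal v"]
      linear_scal by (simp add: linear_conv_bounded_linear o_def)
  finally show ?thesis .
qed

text \<open>The weight is nonnegative with mass half the sphere area and vanishes outside the ball
  on which \<open>g\<close> is within \<epsilon> of \<open>g X\<close>.\<close>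

lemma weight_mean_value:
  assumes d: "ball X d \<subseteq> D" "0 < d" "d \<le> 1"
    and eps: "\<And>Y. Y \<in> ball X d \<Longrightarrow> norm (g Y - g X) \<le> \<epsilon>"
  shows "norm (integral D (\<lambda>Y. wgt d Y *\<^sub>R g Y) - (sphere_area TYPE('n) / 2) *\<^sub>R g X) \<le> \<epsilon> * (sphere_area TYPE('n) / 2)"
proof -
  note gD = hermitian_monogenicD[OF g]
  have R: "d\<^sup>2 > 0" using d by simp
  note iw = integral_weight[OF d(2,3,1)]
  have i1: "(\<lambda>Y. wgt d Y *\<^sub>R g Y) integrable_on D"
    by (rule weight_integrable[OF d(2) C1_on_continuous[OF gD(1)]])
  have i2: "(\<lambda>Y. wgt d Y *\<^sub>R g X) integrable_on D"
    by (rule weight_integrable[OF d(2) continuous_on_const])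
  have i3: "wgt d integrable_on D"
    using weight_integrable[OF d(2) continuous_on_const[where c = "1 :: real"]] by simp
  have "integral D (\<lambda>Y. wgt d Y *\<^sub>R g X) = (sphere_area TYPE('n) / 2) *\<^sub>R g X"
    using integral_linear[OF i3 bounded_linear_scaleR_left, of "g X"] unfolding o_def iw .
  then have "integral D (\<lambda>Y. wgt d Y *\<^sub>R g Y) - (sphere_area TYPE('n) / 2) *\<^sub>R g X =
      integral D (\<lambda>Y. wgt d Y *\<^sub>R g Y - wgt d Y *\<^sub>R g X)"
    using Henstock_Kurzweil_Integration.integral_diff[OF i1 i2] by simp
  also have "norm \<dots> \<le> integral D (\<lambda>Y. \<epsilon> * wgt d Y)"
  proof (rule integral_norm_bound_integral)
    show "(\<lambda>Y. wgt d Y *\<^sub>R g Y - wgt d Y *\<^sub>R g X) integrable_on D"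
      by (rule integrable_diff[OF i1 i2])
    show "(\<lambda>Y. \<epsilon> * wgt d Y) integrable_on D"
      using integrable_on_cmult_left[OF i3, of \<epsilon>] by simp
    fix Y assume "Y \<in> D"
    have w: "wgt d Y \<ge> 0" by (rule weight_nonneg[OF R]) simp
    show "norm (wgt d Y *\<^sub>R g Y - wgt d Y *\<^sub>R g X) \<le> \<epsilon> * wgt d Y"
    proof (cases "Y \<in> ball X d")
      case True
      have "norm (wgt d Y *\<^sub>R g Y - wgt d Y *\<^sub>R g X) = wgt d Y * norm (g Y - g X)"
        using w by (simp flip: scaleR_diff_right)
      also have "\<dots> \<le> wgt d Y * \<epsilon>" by (rule mult_left_mono[OF eps[OF True] w])
      finally show ?thesis by (simp add: mult.commute)
    next
      case False
      then have "d \<le> norm (Y - X)" by (simp add: dist_norm norm_minus_commute)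
      then have "d\<^sup>2 \<le> (norm (Y - X))\<^sup>2" using d(2) by (intro power_mono) auto
      then have "wgt d Y = 0" by (intro weight_eq_0[OF R]) (simp add: power2_norm_eq_inner)
      then show ?thesis by simp
    qed
  qed
  also have "integral D (\<lambda>Y. \<epsilon> * wgt d Y) = \<epsilon> * (sphere_area TYPE('n) / 2)"
    using Henstock_Kurzweil_Integration.integral_mult_right[of D \<epsilon> "wgt d"] unfolding iw .
  finally show ?thesis .
qed

text \<open>The boundary integral does not depend on \<open>d\<close>, so the weighted volume
  integral is the same for every small \<open>d\<close>; continuity of \<open>g\<close> at
  \<open>X\<close> then determines this common value.\<close>

lemma cauchy_formula:
  assumes X: "X \<in> D"
  shows "boundary_integral D (\<lambda>Y ws. (E_kernel_d (Y - X) \<star> dsigma_d ws + E_kernel (Y - X) \<star> dsigma ws) \<star> g Y) =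
    (- 2 * \<i>) ^ CARD('n) *s g X"
proof -
  let ?a = "sphere_area TYPE('n)"
  define B where "B = boundary_integral D (\<lambda>Y ws. (E_kernel_d (Y - X) \<star> dsigma_d ws + E_kernel (Y - X) \<star> dsigma ws) \<star> g Y)"
  \<comment> \<open>The boundary integral with the constants of \<open>scal\<close> removed, hence a
    quantity that does not refer to \<open>d\<close>.\<close>
  define Q where "Q = (?a / 2) *\<^sub>R ((1 / (- 2 * \<i>) ^ CARD('n)) *s B)"
  have a: "?a > 0" by (rule sphere_area_pos)
  have c: "(- 2 * \<i> :: complex) ^ CARD('n) \<noteq> 0" by simp
  have "X \<in> \<Omega>" using X D\<Omega> closure_subset by blast
  have BQ: "B = scal Q"
    using a c by (simp add: Q_def vec_eq_iff)
  have Q: "integral D (\<lambda>Y. wgt d Y *\<^sub>R g Y) = Q" if "ball X d \<subseteq> D" "d > 0" for d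
    using a c unfolding Q_def B_def boundary_integral_weight[OF that] by (simp add: vec_eq_iff)
  have bound: "norm (Q - (?a / 2) *\<^sub>R g X) \<le> \<epsilon> * (?a / 2)" if "\<epsilon> > 0" for \<epsilon>
  proof -
    obtain d1 where d1: "d1 > 0" "ball X d1 \<subseteq> D" using D(1) X open_contains_ball by blast
    have "isCont g X"
      using C1_on_continuous[OF hermitian_monogenicD(1)[OF g]] \<Omega> \<open>X \<in> \<Omega>\<close>
      by (simp add: continuous_on_eq_continuous_at)
    then obtain d2 where d2: "d2 > 0" "\<And>Y. dist Y X < d2 \<Longrightarrow> dist (g Y) (g X) < \<epsilon>"
      using \<open>\<epsilon> > 0\<close> unfolding continuous_at_eps_delta by blast
    define d where "d = min 1 (min d1 d2)"
    have d: "0 < d" "d \<le> 1" "ball X d \<subseteq> D" using d1 d2(1) by (auto simp: d_def)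
    have "norm (g Y - g X) \<le> \<epsilon>" if "Y \<in> ball X d" for Y
      using d2(2)[of Y] that by (simp add: d_def dist_norm dist_commute norm_minus_commute less_imp_le)
    from weight_mean_value[OF d(3,1,2) this] show ?thesis
      unfolding Q[OF d(3,1)] by simp
  qed
  have "norm (Q - (?a / 2) *\<^sub>R g X) \<le> 0"
  proof (rule field_le_epsilon)
    fix e :: real assume "e > 0"
    then have "e / (?a / 2) > 0" using a by simp
    from bound[OF this] show "norm (Q - (?a / 2) *\<^sub>R g X) \<le> 0 + e" using a by simp
  qed
  then have "Q = (?a / 2) *\<^sub>R g X" by simp
  then show ?thesis
    using a BQ unfolding B_def[symmetric] by (simp add: vec_eq_iff)
qed

end

theorem proposition1:
  fixes g :: "'n::{finite,linorder} cvec \<Rightarrow> 'n clifford"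
    and \<Omega> D :: "'n cvec set" and X :: "'n cvec"
  assumes "open \<Omega>"
    and "\<forall>Y\<in>\<Omega>. g Y \<in> spinor_space"
    and "hermitian_monogenic_on \<Omega> g"
    and "open D" and "connected D" and "bounded D" and "smooth_boundary D"
    and "closure D \<subseteq> \<Omega>"
    and "X \<in> interior D"
  shows
    "g X = (1 / (- 2 * \<i>) ^ CARD('n)) *s
       boundary_integral D (\<lambda>Y ws.
         (E_kernel_d (Y - X) \<star> dsigma_d ws + E_kernel (Y - X) \<star> dsigma ws) \<star> g Y) \<and>
     boundary_integral D (\<lambda>Y ws. E_kernel (Y - X) \<star> dsigma_d ws \<star> g Y) = 0 \<and>
     boundary_integral D (\<lambda>Y ws. E_kernel_d (Y - X) \<star> dsigma ws \<star> g Y) = 0"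
proof (intro conjI)
  have X: "X \<in> D" using assms(9) interior_subset by blast
  then obtain d where d: "d > 0" "ball X d \<subseteq> D" using assms(4) open_contains_ball by blast
  note ctx = assms(1,3,4,6,7,8)
  show "g X = (1 / (- 2 * \<i>) ^ CARD('n)) *s
       boundary_integral D (\<lambda>Y ws.
         (E_kernel_d (Y - X) \<star> dsigma_d ws + E_kernel (Y - X) \<star> dsigma ws) \<star> g Y)"
    unfolding cauchy_formula[OF ctx X] by (simp add: vec_eq_iff)
  show "boundary_integral D (\<lambda>Y ws. E_kernel (Y - X) \<star> dsigma_d ws \<star> g Y) = 0"
    by (rule vanishing_integrals(1)[OF ctx d(2,1)])
  show "boundary_integral D (\<lambda>Y ws. E_kernel_d (Y - X) \<star> dsigma ws \<star> g Y) = 0"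
    by (rule vanishing_integrals(2)[OF ctx d(2,1)])
qed

end
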